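(* Let $M$ be a smooth manifold, $\Delta$ a vector field on $M$, and $N\subset M$ a closed submanifold of codimension $1$ such that $\Delta$ is transversal to $N$. Let $U$ be a tubular neighborhood of $N$ in $M$ such that $(U,N,\Delta_{|U})$ is diffeomorphically equivalent to $(N\times\mathbb{R},N\times\{0\},\partial_s)$, and let $\Psi$, $\Psi_N$ be the maps defined in the context. Then, for every $k$: (i) The map $\Psi$ defines a one-to-one correspondence between the space of $k$-forms on $U$ which are $\Delta_{|U}$-homogeneous of degree $1$ and the space of sections of the vector bundle $\wedge^k(T^1U)^*\to U$ which are $\Delta_{|U}$-basic. (ii) The map $\Psi_N$ defines a one-to-one correspondence between the space of $k$-forms on $U$ which are $\Delta_{|U}$-homogeneous of degree $1$ and the space of sections of the vector bundle $\wedge^k(T^1N)^*\to N$, that is, $\Omega^k(N)\oplus\Omega^{k-1}(N)$. Moreover, if $\alpha\in\Omega^k(U)$ is $\Delta_{|U}$-homogeneous of degree $1$ then $$\Psi(d_U\alpha)=d^1_U(\Psi\alpha),\qquad \Psi_N(d_U\alpha)=d^1_N(\Psi_N\alpha),$$ where $d_U$ is the usual exterior differential on $U$ and $d^1_U$ (respectively $d^1_N$) is the Jacobi differential on $U$ (respectively $N$).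
   Context: All objects are smooth. For a manifold $M$, $\Omega^k(M)$ is the space of $k$-forms and $T^1M=TM\oplus\mathbb{R}$. The space of sections of $\wedge^k(T^1M)^*$ is identified with $\Omega^k(M)\oplus\Omega^{k-1}(M)$: with $\phi_M\in\mathrm{Sec}((T^1M)^* )$ given by $\phi_M(X\oplus f)=f$, the pair $(\alpha^0,\alpha^1)$ corresponds to $\alpha^0+\phi_M\wedge\alpha^1$. Under this identification the Jacobi differential is $d^1_M(\alpha^0,\alpha^1)=(d_M\alpha^0,\,-d_M\alpha^1+\alpha^0)$, where $d_M$ is the exterior differential. A form $\alpha$ is $\Delta$-homogeneous of degree $n$ if $\mathcal{L}_\Delta\alpha=n\alpha$. "Diffeomorphically equivalent" means there is a diffeomorphism $U\to N\times\mathbb{R}$ mapping $\Delta_{|U}$ to $\partial_s$ ($s$ the coordinate on $\mathbb{R}$) and each $x\in N$ to $(x,0)$. On such a $U$ there is a unique function $\tilde 1_N\in C^\infty(U)$ with $\Delta(\tilde 1_N)=\tilde 1_N$ and $(\tilde 1_N)_{|N}\equiv1$ (it corresponds to $e^s$, so is positive). Any $\alpha\in\Omega^k(U)$ has a unique decomposition $\alpha=\tilde 1_N(\alpha^0+d(\ln\tilde 1_N)\wedge\alpha^1)$ with $(\alpha^0,\alpha^1)\in\Omega^k(U)\oplus\Omega^{k-1}(U)$, $i_{\Delta_{|U}}\alpha^0=0$, $i_{\Delta_{|U}}\alpha^1=0$. One sets $\Psi(\alpha)=(\alpha^0,\alpha^1)$, a section of $\wedge^k(T^1U)^*\to U$.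 A section $(\alpha^0,\alpha^1)\in\Omega^k(U)\oplus\Omega^{k-1}(U)$ is $\Delta_{|U}$-basic if $i_{\Delta_{|U}}\alpha^0=0$, $i_{\Delta_{|U}}\alpha^1=0$, $\mathcal{L}_{\Delta_{|U}}\alpha^0=0$, $\mathcal{L}_{\Delta_{|U}}\alpha^1=0$. With $j:N\to U$ the canonical inclusion, $\Psi_N:\Omega^k(U)\to\Omega^k(N)\oplus\Omega^{k-1}(N)$ is $\Psi_N(\alpha)=(j^*\alpha,\;j^*(i_{\Delta_{|U}}\alpha))$. *)

theory Defs
  imports "HOL-Analysis.Analysis"
begin

section \<open>Smooth maps between open subsets of finite-dimensional normed spaces\<close>

text \<open>For \<open>S\<close> open, \<open>C_on k S f\<close> says that \<open>f\<close> is of class \<open>C^k\<close> on \<open>S\<close>; on a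
  finite-dimensional space it is enough to iterate directional derivatives.\<close>

primrec C_on :: "nat \<Rightarrow> 'a::real_normed_vector set \<Rightarrow> ('a \<Rightarrow> 'b::real_normed_vector) \<Rightarrow> bool" where
  "C_on 0 S f \<longleftrightarrow> continuous_on S f"
| "C_on (Suc k) S f \<longleftrightarrow> (\<forall>x\<in>S. f differentiable (at x)) \<and>
     (\<forall>v. C_on k S (\<lambda>x. frechet_derivative f (at x) v))"

definition smooth_on :: "'a::real_normed_vector set \<Rightarrow> ('a \<Rightarrow> 'b::real_normed_vector) \<Rightarrow> bool" where
  "smooth_on S f \<longleftrightarrow> (\<forall>k. C_on k S f)"

section \<open>Smooth manifolds\<close>

text \<open>A chart is a pair \<open>(D, \<phi>)\<close> of its domain and its coordinate map; values of \<open>\<phi>\<close> outside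
  \<open>D\<close> are irrelevant.  The atlas is not required to be maximal.

  The model space \<open>'e\<close> is only a real normed vector space, of finite dimension by
  \<open>smooth_manifold\<close>, because the class \<open>euclidean_space\<close> excludes dimension 0, which is needed
  for the hypersurfaces of a one-dimensional manifold.\<close>

type_synonym ('m, 'e) chart = "'m set \<times> ('m \<Rightarrow> 'e)"

record ('m, 'e) manifold =
  mtop :: "'m topology"
  atlas :: "('m, 'e) chart set"

definition carr :: "('m, 'e) manifold \<Rightarrow> 'm set" where
  "carr M = topspace (mtop M)"

definition chart_inv :: "('m, 'e) chart \<Rightarrow> 'e \<Rightarrow> 'm" where
  "chart_inv c = inv_into (fst c) (snd c)"

definition finite_dimensional :: "'e::real_vector itself \<Rightarrow> bool" where
  "finite_dimensional _ \<longleftrightarrow> (\<exists>B :: 'e set. finite B \<and> span B = UNIV)"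

definition smooth_manifold :: "('m, 'e::real_normed_vector) manifold \<Rightarrow> bool" where
  "smooth_manifold M \<longleftrightarrow>
     finite_dimensional TYPE('e) \<and>
     Hausdorff_space (mtop M) \<and> second_countable (mtop M) \<and>
     (\<Union>c\<in>atlas M. fst c) = carr M \<and>
     (\<forall>c\<in>atlas M. openin (mtop M) (fst c) \<and> open (snd c ` fst c) \<and>
        homeomorphic_map (subtopology (mtop M) (fst c)) (top_of_set (snd c ` fst c)) (snd c)) \<and>
     (\<forall>c\<in>atlas M. \<forall>c'\<in>atlas M.
        smooth_on (snd c ` (fst c \<inter> fst c')) (snd c' \<circ> chart_inv c))"

definition charts_at :: "('m, 'e) manifold \<Rightarrow> 'm \<Rightarrow> ('m, 'e) chart set" where
  "charts_at M x = {c \<in> atlas M. x \<in> fst c}"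

definition some_chart :: "('m, 'e) manifold \<Rightarrow> 'm \<Rightarrow> ('m, 'e) chart" where
  "some_chart M x = (SOME c. c \<in> charts_at M x)"

definition smooth_map ::
  "('m, 'e::real_normed_vector) manifold \<Rightarrow> ('n, 'f::real_normed_vector) manifold \<Rightarrow> ('m \<Rightarrow> 'n) \<Rightarrow> bool" where
  "smooth_map M N f \<longleftrightarrow> continuous_map (mtop M) (mtop N) f \<and>
     (\<forall>c\<in>atlas M. \<forall>c'\<in>atlas N.
        smooth_on (snd c ` {x \<in> fst c. f x \<in> fst c'}) (snd c' \<circ> f \<circ> chart_inv c))"

definition diffeomorphism ::
  "('m, 'e::real_normed_vector) manifold \<Rightarrow> ('n, 'f::real_normed_vector) manifold \<Rightarrow> ('m \<Rightarrow> 'n) \<Rightarrow> bool" where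
  "diffeomorphism M N f \<longleftrightarrow> smooth_map M N f \<and>
     (\<exists>g. smooth_map N M g \<and> (\<forall>x\<in>carr M. g (f x) = x) \<and> (\<forall>y\<in>carr N. f (g y) = y))"

definition smooth_fun :: "('m, 'e::real_normed_vector) manifold \<Rightarrow> ('m \<Rightarrow> real) \<Rightarrow> bool" where
  "smooth_fun M f \<longleftrightarrow> (\<forall>c\<in>atlas M. smooth_on (snd c ` fst c) (f \<circ> chart_inv c))"

definition open_submanifold :: "('m, 'e) manifold \<Rightarrow> 'm set \<Rightarrow> ('m, 'e) manifold" where
  "open_submanifold M U =
     \<lparr>mtop = subtopology (mtop M) U, atlas = (\<lambda>c. (fst c \<inter> U, snd c)) ` atlas M\<rparr>"

definition times_line :: "('m, 'e) manifold \<Rightarrow> ('m \<times> real, 'e \<times> real) manifold" where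
  "times_line M =
     \<lparr>mtop = prod_topology (mtop M) euclideanreal,
      atlas = (\<lambda>c. (fst c \<times> UNIV, \<lambda>(x, s). (snd c x, s))) ` atlas M\<rparr>"

section \<open>Tangent vectors and vector fields\<close>

text \<open>A tangent vector at \<open>x\<close> is the family of its coordinate representations in all charts
  around \<open>x\<close>, which are related by the derivatives of the transition maps.  The vector space
  operations of a tangent space are the pointwise ones.\<close>

type_synonym ('m, 'e) tvec = "('m, 'e) chart \<Rightarrow> 'e"

definition tangent_space :: "('m, 'e::real_normed_vector) manifold \<Rightarrow> 'm \<Rightarrow> ('m, 'e) tvec set" where
  "tangent_space M x =
     {v. (\<forall>c\<in>charts_at M x. \<forall>c'\<in>charts_at M x.
            v c' = frechet_derivative (snd c' \<circ> chart_inv c) (at (snd c x)) (v c)) \<and>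
         (\<forall>c. c \<notin> charts_at M x \<longrightarrow> v c = 0)}"

text \<open>The tangent vector at \<open>x\<close> whose coordinates in the chart \<open>c\<close> are \<open>w\<close>.\<close>

definition tvec_of ::
  "('m, 'e::real_normed_vector) manifold \<Rightarrow> ('m, 'e) chart \<Rightarrow> 'm \<Rightarrow> 'e \<Rightarrow> ('m, 'e) tvec" where
  "tvec_of M c x w = (\<lambda>c'. if c' \<in> charts_at M x
     then frechet_derivative (snd c' \<circ> chart_inv c) (at (snd c x)) w else 0)"

text \<open>The tangent map at \<open>x\<close>; it depends on the germ of \<open>f\<close> at \<open>x\<close> only (and, by the chain
  rule, not on the chosen chart), so it may be used for maps defined near \<open>x\<close>.\<close>

definition tmap ::
  "('m, 'e::real_normed_vector) manifold \<Rightarrow> ('n, 'f::real_normed_vector) manifold \<Rightarrow> ('m \<Rightarrow> 'n) \<Rightarrow>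
   'm \<Rightarrow> ('m, 'e) tvec \<Rightarrow> ('n, 'f) tvec" where
  "tmap M N f x v = (\<lambda>c'. if c' \<in> charts_at N (f x)
     then frechet_derivative (snd c' \<circ> f \<circ> chart_inv (some_chart M x))
            (at (snd (some_chart M x) x)) (v (some_chart M x))
     else 0)"

definition vector_field ::
  "('m, 'e::real_normed_vector) manifold \<Rightarrow> ('m \<Rightarrow> ('m, 'e) tvec) \<Rightarrow> bool" where
  "vector_field M X \<longleftrightarrow> (\<forall>x\<in>carr M. X x \<in> tangent_space M x) \<and>
     (\<forall>c\<in>atlas M. smooth_on (snd c ` fst c) (\<lambda>y. X (chart_inv c y) c))"

text \<open>The restriction of a vector field to an open subset \<open>U\<close>: for \<open>x \<in> U\<close> the spaces
  \<open>T_x M\<close> and \<open>T_x U\<close> are identified through the germ at \<open>x\<close> of the identity.\<close>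

definition vf_restrict ::
  "('m, 'e::real_normed_vector) manifold \<Rightarrow> 'm set \<Rightarrow> ('m \<Rightarrow> ('m, 'e) tvec) \<Rightarrow> 'm \<Rightarrow> ('m, 'e) tvec" where
  "vf_restrict M U X = (\<lambda>x. tmap M (open_submanifold M U) (\<lambda>x. x) x (X x))"

text \<open>The vector field \<open>\<partial>_s\<close> on the product of a manifold with the line: its value at \<open>(x, s)\<close>
  is the velocity of the curve \<open>r \<mapsto> (x, r)\<close> at \<open>r = s\<close>.\<close>

definition d_ds :: "('m, 'e::real_normed_vector) manifold \<Rightarrow> 'm \<times> real \<Rightarrow> ('m \<times> real, 'e \<times> real) tvec" where
  "d_ds M p = (\<lambda>c. if c \<in> charts_at (times_line M) p
     then vector_derivative (\<lambda>r. snd c (fst p, r)) (at (snd p)) else 0)"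

section \<open>Differential forms\<close>

text \<open>The arguments of a form are passed as a list of tangent vectors.  Degrees are integers, so
  that there is a (zero) space of forms of degree \<open>-1\<close>.  Forms vanish by convention on everything
  that is not a list of the right number of tangent vectors at a point of the manifold; equality
  of forms is therefore equality of functions.\<close>

type_synonym ('m, 'e) form = "'m \<Rightarrow> ('m, 'e) tvec list \<Rightarrow> real"

definition Omega :: "('m, 'e::real_normed_vector) manifold \<Rightarrow> int \<Rightarrow> ('m, 'e) form set" where
  "Omega M k = {\<alpha>.
     (\<forall>x vs. \<not> (x \<in> carr M \<and> set vs \<subseteq> tangent_space M x \<and> int (length vs) = k) \<longrightarrow> \<alpha> x vs = 0) \<and>
     (\<forall>x\<in>carr M. \<forall>us\<in>lists (tangent_space M x). \<forall>ws\<in>lists (tangent_space M x).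
        \<forall>v\<in>tangent_space M x. \<forall>w\<in>tangent_space M x. \<forall>a b.
          \<alpha> x (us @ (\<lambda>c. a *\<^sub>R v c + b *\<^sub>R w c) # ws) =
          a * \<alpha> x (us @ v # ws) + b * \<alpha> x (us @ w # ws)) \<and>
     (\<forall>x\<in>carr M. \<forall>vs. \<not> distinct vs \<longrightarrow> \<alpha> x vs = 0) \<and>
     (\<forall>c\<in>atlas M. \<forall>ws.
        smooth_on (snd c ` fst c) (\<lambda>y. \<alpha> (chart_inv c y) (map (tvec_of M c (chart_inv c y)) ws)))}"

definition zero_form :: "('m, 'e) form" where
  "zero_form = (\<lambda>x vs. 0)"

definition fun_form :: "('m, 'e) manifold \<Rightarrow> ('m \<Rightarrow> real) \<Rightarrow> ('m, 'e) form" where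
  "fun_form M f = (\<lambda>x vs. if x \<in> carr M \<and> vs = [] then f x else 0)"

definition omit :: "nat \<Rightarrow> 'a list \<Rightarrow> 'a list" where
  "omit i xs = take i xs @ drop (Suc i) xs"

definition insertion :: "('m \<Rightarrow> ('m, 'e) tvec) \<Rightarrow> ('m, 'e) form \<Rightarrow> ('m, 'e) form" where
  "insertion X \<alpha> = (\<lambda>x vs. \<alpha> x (X x # vs))"

text \<open>The wedge product \<open>\<beta> \<and> \<alpha>\<close> for a 1-form \<open>\<beta>\<close>, normalized so that
  \<open>i_X (\<beta> \<and> \<alpha>) = \<beta>(X) \<alpha> - \<beta> \<and> i_X \<alpha>\<close>.\<close>

definition wedge1 :: "('m, 'e) form \<Rightarrow> ('m, 'e) form \<Rightarrow> ('m, 'e) form" where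
  "wedge1 \<beta> \<alpha> = (\<lambda>x vs. \<Sum>i<length vs. (-1) ^ i * \<beta> x [vs ! i] * \<alpha> x (omit i vs))"

definition pullback ::
  "('m, 'e::real_normed_vector) manifold \<Rightarrow> ('n, 'f::real_normed_vector) manifold \<Rightarrow> ('m \<Rightarrow> 'n) \<Rightarrow>
   ('n, 'f) form \<Rightarrow> ('m, 'e) form" where
  "pullback M N f \<alpha> = (\<lambda>x vs. if x \<in> carr M \<and> set vs \<subseteq> tangent_space M x
     then \<alpha> (f x) (map (tmap M N f x) vs) else 0)"

text \<open>The exterior differential, computed in a chart around each point by the formula
  \<open>(d\<alpha>)(v_0, \<dots>, v_k) = \<Sum>_i (-1)^i D_{v_i} \<alpha>(v_0, \<dots>, v_{i-1}, v_{i+1}, \<dots>, v_k)\<close>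
  with \<open>v_0, \<dots>, v_k\<close> extended to vector fields with constant coordinates.\<close>

definition ext_deriv :: "('m, 'e::real_normed_vector) manifold \<Rightarrow> ('m, 'e) form \<Rightarrow> ('m, 'e) form" where
  "ext_deriv M \<alpha> = (\<lambda>x vs. if x \<in> carr M \<and> set vs \<subseteq> tangent_space M x then
     (let c = some_chart M x in
      \<Sum>i<length vs. (-1) ^ i *
        frechet_derivative
          (\<lambda>y. \<alpha> (chart_inv c y) (map (\<lambda>v. tvec_of M c (chart_inv c y) (v c)) (omit i vs)))
          (at (snd c x)) ((vs ! i) c))
     else 0)"

definition vf_apply :: "('m, 'e::real_normed_vector) manifold \<Rightarrow> ('m \<Rightarrow> ('m, 'e) tvec) \<Rightarrow> ('m \<Rightarrow> real) \<Rightarrow> 'm \<Rightarrow> real" where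
  "vf_apply M X f x = ext_deriv M (fun_form M f) x [X x]"

definition local_flow ::
  "('m, 'e::real_normed_vector) manifold \<Rightarrow> ('m \<Rightarrow> ('m, 'e) tvec) \<Rightarrow> 'm \<Rightarrow> (real \<Rightarrow> 'm \<Rightarrow> 'm) \<Rightarrow> bool" where
  "local_flow M X x \<theta> \<longleftrightarrow> (\<exists>\<epsilon>>0. \<exists>V. openin (mtop M) V \<and> x \<in> V \<and>
     smooth_map (open_submanifold (times_line M) (V \<times> {-\<epsilon><..<\<epsilon>})) M (\<lambda>(y, t). \<theta> t y) \<and>
     (\<forall>y\<in>V. \<theta> 0 y = y) \<and>
     (\<forall>y\<in>V. \<forall>t\<in>{-\<epsilon><..<\<epsilon>}. \<forall>c\<in>charts_at M (\<theta> t y).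
        ((\<lambda>r. snd c (\<theta> r y)) has_vector_derivative X (\<theta> t y) c) (at t)))"

text \<open>The Lie derivative, that is, the derivative at \<open>t = 0\<close> of the pullback of \<open>\<alpha>\<close> by the flow
  of \<open>X\<close>.  The derivative does not depend on the local flow chosen.\<close>

definition lie_derivative ::
  "('m, 'e::real_normed_vector) manifold \<Rightarrow> ('m \<Rightarrow> ('m, 'e) tvec) \<Rightarrow> ('m, 'e) form \<Rightarrow> ('m, 'e) form" where
  "lie_derivative M X \<alpha> = (\<lambda>x vs. if x \<in> carr M \<and> set vs \<subseteq> tangent_space M x then
     (let \<theta> = (SOME \<theta>. local_flow M X x \<theta>) in
      deriv (\<lambda>t. \<alpha> (\<theta> t x) (map (tmap M M (\<theta> t) x) vs)) 0)
     else 0)"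

definition homogeneous ::
  "('m, 'e::real_normed_vector) manifold \<Rightarrow> ('m \<Rightarrow> ('m, 'e) tvec) \<Rightarrow> real \<Rightarrow> ('m, 'e) form \<Rightarrow> bool" where
  "homogeneous M X n \<alpha> \<longleftrightarrow> lie_derivative M X \<alpha> = (\<lambda>x vs. n * \<alpha> x vs)"

section \<open>Hypersurfaces\<close>

text \<open>\<open>N\<close> is an embedded submanifold of \<open>M\<close>: a subset with the subspace topology and a smooth
  structure for which the inclusion is an immersion.\<close>

definition submanifold ::
  "('m, 'f::real_normed_vector) manifold \<Rightarrow> ('m, 'e::real_normed_vector) manifold \<Rightarrow> bool" where
  "submanifold N M \<longleftrightarrow> smooth_manifold N \<and> carr N \<subseteq> carr M \<and>
     mtop N = subtopology (mtop M) (carr N) \<and>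
     smooth_map N M (\<lambda>x. x) \<and>
     (\<forall>x\<in>carr N. inj_on (tmap N M (\<lambda>x. x) x) (tangent_space N x))"

definition codimension_one ::
  "('m, 'f::real_normed_vector) manifold \<Rightarrow> ('m, 'e::real_normed_vector) manifold \<Rightarrow> bool" where
  "codimension_one N M \<longleftrightarrow> dim (UNIV :: 'e set) = dim (UNIV :: 'f set) + 1"

definition transversal ::
  "('m, 'e::real_normed_vector) manifold \<Rightarrow> ('m \<Rightarrow> ('m, 'e) tvec) \<Rightarrow> ('m, 'f::real_normed_vector) manifold \<Rightarrow> bool" where
  "transversal M X N \<longleftrightarrow> (\<forall>x\<in>carr N. \<forall>v\<in>tangent_space M x.
     \<exists>w\<in>tangent_space N x. \<exists>a. v = (\<lambda>c. tmap N M (\<lambda>x. x) x w c + a *\<^sub>R X x c))"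

definition diffeo_equivalent_line ::
  "('m, 'e::real_normed_vector) manifold \<Rightarrow> ('m, 'f::real_normed_vector) manifold \<Rightarrow> ('m \<Rightarrow> ('m, 'e) tvec) \<Rightarrow> bool" where
  "diffeo_equivalent_line U N X \<longleftrightarrow> (\<exists>F. diffeomorphism U (times_line N) F \<and>
     (\<forall>x\<in>carr U. tmap U (times_line N) F x (X x) = d_ds N (F x)) \<and>
     (\<forall>x\<in>carr N. F x = (x, 0)))"

section \<open>Sections of the exterior powers of the dual of TM + R, and the maps Psi\<close>

text \<open>Sections of the \<open>k\<close>-th exterior power of the dual of \<open>TM \<oplus> \<real>\<close>, as pairs
  \<open>(\<alpha>0, \<alpha>1)\<close> standing for \<open>\<alpha>0 + \<phi>_M \<and> \<alpha>1\<close>.\<close>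

definition jsections :: "('m, 'e::real_normed_vector) manifold \<Rightarrow> int \<Rightarrow> (('m, 'e) form \<times> ('m, 'e) form) set" where
  "jsections M k = Omega M k \<times> Omega M (k - 1)"

definition jacobi_deriv ::
  "('m, 'e::real_normed_vector) manifold \<Rightarrow> ('m, 'e) form \<times> ('m, 'e) form \<Rightarrow> ('m, 'e) form \<times> ('m, 'e) form" where
  "jacobi_deriv M = (\<lambda>(\<alpha>0, \<alpha>1). (ext_deriv M \<alpha>0, \<lambda>x vs. - ext_deriv M \<alpha>1 x vs + \<alpha>0 x vs))"

definition basic ::
  "('m, 'e::real_normed_vector) manifold \<Rightarrow> ('m \<Rightarrow> ('m, 'e) tvec) \<Rightarrow> ('m, 'e) form \<times> ('m, 'e) form \<Rightarrow> bool" where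
  "basic M X = (\<lambda>(\<alpha>0, \<alpha>1). insertion X \<alpha>0 = zero_form \<and> insertion X \<alpha>1 = zero_form \<and>
     lie_derivative M X \<alpha>0 = zero_form \<and> lie_derivative M X \<alpha>1 = zero_form)"

text \<open>The function on \<open>U\<close> extending the constant 1 on the subset \<open>N\<close> with \<open>X(f) = f\<close>
  (extensional, so that it is unique as a HOL function).\<close>

definition one_tilde ::
  "('m, 'e::real_normed_vector) manifold \<Rightarrow> ('m \<Rightarrow> ('m, 'e) tvec) \<Rightarrow> 'm set \<Rightarrow> 'm \<Rightarrow> real" where
  "one_tilde U X N = (THE f. smooth_fun U f \<and> f \<in> extensional (carr U) \<and>
     (\<forall>x\<in>carr U. vf_apply U X f x = f x) \<and> (\<forall>x\<in>N. f x = 1))"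

definition Psi ::
  "('m, 'e::real_normed_vector) manifold \<Rightarrow> ('m \<Rightarrow> ('m, 'e) tvec) \<Rightarrow> 'm set \<Rightarrow> int \<Rightarrow>
   ('m, 'e) form \<Rightarrow> ('m, 'e) form \<times> ('m, 'e) form" where
  "Psi U X N k \<alpha> = (let f = one_tilde U X N in
     THE (\<alpha>0, \<alpha>1). (\<alpha>0, \<alpha>1) \<in> jsections U k \<and>
       insertion X \<alpha>0 = zero_form \<and> insertion X \<alpha>1 = zero_form \<and>
       \<alpha> = (\<lambda>x vs. f x * (\<alpha>0 x vs + wedge1 (ext_deriv U (fun_form U (\<lambda>x. ln (f x)))) \<alpha>1 x vs)))"

definition Psi_N ::
  "('m, 'e::real_normed_vector) manifold \<Rightarrow> ('m \<Rightarrow> ('m, 'e) tvec) \<Rightarrow> ('m, 'f::real_normed_vector) manifold \<Rightarrow>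
   ('m, 'e) form \<Rightarrow> ('m, 'f) form \<times> ('m, 'f) form" where
  "Psi_N U X N \<alpha> = (pullback N U (\<lambda>x. x) \<alpha>, pullback N U (\<lambda>x. x) (insertion X \<alpha>))"

end

theory Submission
  imports Defs
begin

text \<open>
  Let \<open>F : U \<rightarrow> N \<times> \<real>\<close> be the given diffeomorphism, \<open>\<pi>\<close> and \<open>s\<close> its components (\<open>pr\<close> and \<open>ht\<close> below),
  and \<open>\<theta>\<close> the flow of \<open>X\<close>, which \<open>F\<close> carries to the translations \<open>(x, s) \<mapsto> (x, s + t)\<close>.
  Every local flow of \<open>X\<close> agrees with \<open>\<theta>\<close>, so a form \<open>\<alpha>\<close> is homogeneous of degree \<open>n\<close> iff
  \<open>\<theta>\<^sub>t\<^sup>* \<alpha> = e\<^sup>n\<^sup>t \<alpha>\<close> for all \<open>t\<close>.  The function extending \<open>1\<close> is \<open>f = e\<^sup>s\<close>, and \<open>\<Psi> \<alpha>\<close> consists of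
  \<open>\<alpha>\<^sup>1 = i\<^sub>X \<alpha> / f\<close> and \<open>\<alpha>\<^sup>0 = \<alpha> / f - ds \<and> \<alpha>\<^sup>1\<close>; since \<open>\<theta>\<^sub>t\<^sup>* f = e\<^sup>t f\<close> and \<open>ds\<close> is invariant, \<open>\<alpha>\<close> is
  homogeneous of degree 1 iff both parts are invariant.  A horizontal invariant form is \<open>\<pi>\<^sup>*\<close> of its
  restriction to \<open>N\<close> (flow each point down to \<open>N\<close>), which gives the second correspondence; and as \<open>d\<close>
  commutes with \<open>\<pi>\<^sup>*\<close>, its differential is horizontal too.  The formula for \<open>d\<close> then follows from
  \<open>d(f (\<alpha>\<^sup>0 + ds \<and> \<alpha>\<^sup>1)) = f (d\<alpha>\<^sup>0 + ds \<and> (\<alpha>\<^sup>0 - d\<alpha>\<^sup>1))\<close> by uniqueness of the decomposition.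
\<close>

section \<open>Calculus on finite-dimensional normed spaces\<close>

subsection \<open>Coordinates\<close>

text \<open>Three obstacles shape the development. The model spaces are merely normed and of finite
  dimension, so calculus is done with directional derivatives, and bases enter through continuous
  coordinate functionals. Next, \<open>lie_derivative\<close> picks an unspecified local flow; it
  can be computed only because in the straightened coordinates an integral curve has constant
  \<open>pr\<close> and \<open>ht\<close> of slope 1, which forces every local flow to be the
  translation for small times. This controls the derivative at time 0; the group law carries it to
  all times, and the linear ODE h' = n h turns the infinitesimal condition into the identity with
  the factor exp (n t). Finally, \<open>ext_deriv\<close> is defined in one chosen chart. Its
  independence of the chart is naturality of the coordinate formula, applied to the identity map,
  and naturality rests on the symmetry of second derivatives. The wedge product with dg is regular
  because Leibniz' rule exhibits it as d(g \<alpha>) - g d\<alpha>. Equality of forms is equality of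
  functions, so each identity is also checked on arguments that are not tangent vectors.\<close>

lemma coordinates_bounded:
  fixes B :: "'a::real_normed_vector set"
  assumes "finite B" "independent B"
  shows "\<exists>K>0. \<forall>c. \<forall>b\<in>B. \<bar>c b\<bar> \<le> K * norm (\<Sum>b\<in>B. c b *\<^sub>R b)"
  using assms
proof (induction B)
  case empty
  then show ?case by (intro exI[of _ 1]) auto
next
  case (insert a B)
  from insert.prems have ind: "independent B" and a: "a \<notin> span B"
    using insert.hyps by (auto simp: independent_insert)
  obtain K where K: "K > 0" "\<And>c b. b \<in> B \<Longrightarrow> \<bar>c b\<bar> \<le> K * norm (\<Sum>b\<in>B. c b *\<^sub>R b)"
    using insert.IH[OF ind] by blast
  \<comment> \<open>The vector \<open>a\<close> has positive distance from the span of
    \<open>B\<close>. Otherwise a sequence in the span tends to -a; by the induction hypothesis its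
    coordinates are Cauchy, hence convergent, and their limits put \<open>a\<close> into the
    span.\<close>
  have "\<exists>\<delta>>0. \<forall>c. \<delta> \<le> norm (a + (\<Sum>b\<in>B. c b *\<^sub>R b))"
  proof (rule ccontr)
    assume "\<not> ?thesis"
    then have "\<forall>n. \<exists>c. norm (a + (\<Sum>b\<in>B. c b *\<^sub>R b)) < 1 / real (Suc n)"
      by (meson not_le of_nat_0_less_iff zero_less_Suc zero_less_divide_1_iff)
    then obtain c where c: "\<And>n. norm (a + (\<Sum>b\<in>B. c n b *\<^sub>R b)) < 1 / real (Suc n)"
      by metis
    have lim0: "(\<lambda>n. a + (\<Sum>b\<in>B. c n b *\<^sub>R b)) \<longlonglongrightarrow> 0"
      by (rule Lim_null_comparison[OF _ LIMSEQ_inverse_real_of_nat])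
        (use c in \<open>auto intro!: eventuallyI less_imp_le simp: inverse_eq_divide\<close>)
    have "\<exists>l. (\<lambda>n. c n b) \<longlonglongrightarrow> l" if b: "b \<in> B" for b
    proof -
      have "Cauchy (\<lambda>n. c n b)"
      proof (rule metric_CauchyI)
        fix e :: real assume "e > 0"
        have "Cauchy (\<lambda>n. a + (\<Sum>b\<in>B. c n b *\<^sub>R b))"
          using lim0 LIMSEQ_imp_Cauchy by blast
        moreover have "e / K > 0" using K(1) \<open>e > 0\<close> by simp
        ultimately obtain N where
          N: "\<And>m n. m \<ge> N \<Longrightarrow> n \<ge> N \<Longrightarrow>
            dist (a + (\<Sum>b\<in>B. c m b *\<^sub>R b)) (a + (\<Sum>b\<in>B. c n b *\<^sub>R b)) < e / K"
          using metric_CauchyD by blast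
        have "dist (c m b) (c n b) < e" if "m \<ge> N" "n \<ge> N" for m n
        proof -
          have "\<bar>c m b - c n b\<bar> \<le> K * norm (\<Sum>b\<in>B. (c m b - c n b) *\<^sub>R b)"
            using K(2)[OF b, of "\<lambda>b. c m b - c n b"] .
          also have "(\<Sum>b\<in>B. (c m b - c n b) *\<^sub>R b) =
              (a + (\<Sum>b\<in>B. c m b *\<^sub>R b)) - (a + (\<Sum>b\<in>B. c n b *\<^sub>R b))"
            by (simp add: scaleR_diff_left sum_subtractf)
          also have "K * norm \<dots> < K * (e / K)"
            using N[OF that] K(1) by (intro mult_strict_left_mono) (auto simp: dist_norm)
          finally show ?thesis using K(1) by (simp add: dist_real_def)
        qed
        then show "\<exists>N. \<forall>m\<ge>N. \<forall>n\<ge>N. dist (c m b) (c n b) < e" by blast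
      qed
      then show ?thesis using Cauchy_convergent convergent_def by blast
    qed
    then obtain l where l: "\<And>b. b \<in> B \<Longrightarrow> (\<lambda>n. c n b) \<longlonglongrightarrow> l b" by metis
    have "(\<lambda>n. a + (\<Sum>b\<in>B. c n b *\<^sub>R b)) \<longlonglongrightarrow> a + (\<Sum>b\<in>B. l b *\<^sub>R b)"
      by (intro tendsto_intros l)
    with lim0 have "a + (\<Sum>b\<in>B. l b *\<^sub>R b) = 0" using LIMSEQ_unique by blast
    then have "a = - (\<Sum>b\<in>B. l b *\<^sub>R b)" by (simp add: eq_neg_iff_add_eq_0)
    then have "a \<in> span B"
      by (simp add: span_neg span_sum span_scale span_base)
    with a show False by blast
  qed
  then obtain \<delta> where \<delta>: "\<delta> > 0" "\<And>c. \<delta> \<le> norm (a + (\<Sum>b\<in>B. c b *\<^sub>R b))" by blast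
  \<comment> \<open>The first summand bounds the coordinate of \<open>a\<close>. After subtracting
    the \<open>a\<close>-component, whose coefficient is at most norm x / \<delta>, a vector of norm
    at most (1 + norm a / \<delta>) * norm x remains; this gives the second summand.\<close>
  define L where "L = 1 / \<delta> + K * (1 + norm a / \<delta>)"
  have "\<bar>c b\<bar> \<le> L * norm (\<Sum>b\<in>insert a B. c b *\<^sub>R b)" if b: "b \<in> insert a B" for c b
  proof -
    let ?x = "\<Sum>b\<in>insert a B. c b *\<^sub>R b" and ?y = "\<Sum>b\<in>B. c b *\<^sub>R b"
    have x: "?x = c a *\<^sub>R a + ?y" using insert.hyps by simp
    have ca: "\<bar>c a\<bar> \<le> norm ?x / \<delta>"
    proof (cases "c a = 0")
      case False
      have "?x = c a *\<^sub>R (a + (\<Sum>b\<in>B. (c b / c a) *\<^sub>R b))"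
        using False by (simp add: x scaleR_add_right scaleR_sum_right)
      then have "norm ?x = \<bar>c a\<bar> * norm (a + (\<Sum>b\<in>B. (c b / c a) *\<^sub>R b))"
        by (simp only: norm_scaleR)
      then have "\<bar>c a\<bar> * \<delta> \<le> norm ?x" using \<delta>(2) by (simp add: mult_left_mono)
      then show ?thesis using \<delta>(1) by (simp add: pos_le_divide_eq)
    qed (use \<delta>(1) in simp)
    show ?thesis
    proof (cases "b = a")
      case True
      have "norm ?x / \<delta> \<le> L * norm ?x"
        using \<delta>(1) K(1) by (auto simp: L_def algebra_simps)
      from order_trans[OF ca this] show ?thesis by (simp only: True)
    next
      case False
      with b have "b \<in> B" by blast
      have "?y = ?x - c a *\<^sub>R a" by (simp add: x)
      then have "norm ?y \<le> norm ?x + \<bar>c a\<bar> * norm a"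
        using norm_triangle_ineq4[of ?x "c a *\<^sub>R a"] by simp
      also have "\<dots> \<le> norm ?x + (norm ?x / \<delta>) * norm a"
        by (intro add_left_mono mult_right_mono ca) auto
      finally have "K * norm ?y \<le> K * (norm ?x + (norm ?x / \<delta>) * norm a)"
        using K(1) by (intro mult_left_mono) auto
      also have "\<dots> \<le> L * norm ?x"
        using \<delta>(1) by (auto simp: L_def algebra_simps)
      finally show ?thesis using K(2)[OF \<open>b \<in> B\<close>, of c] by linarith
    qed
  qed
  moreover have "L > 0" using \<delta>(1) K(1)
    by (auto simp: L_def intro!: add_pos_nonneg mult_nonneg_nonneg)
  ultimately show ?case by blast
qed

text \<open>The functionals \<open>\<kappa> b\<close> reduce vector-valued statements to real ones,
  and the expansion turns a multilinear expression with a moving argument into a finite combination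
  of expressions with fixed arguments.\<close>

definition coord_system :: "'a::real_normed_vector set \<Rightarrow> ('a \<Rightarrow> 'a \<Rightarrow> real) \<Rightarrow> bool" where
  "coord_system B \<kappa> \<longleftrightarrow> finite B \<and> (\<forall>b\<in>B. bounded_linear (\<kappa> b)) \<and> (\<forall>x. (\<Sum>b\<in>B. \<kappa> b x *\<^sub>R b) = x)"

text \<open>A finite spanning set contains a basis, and \<open>coordinates_bounded\<close> makes its
  coordinate functionals continuous; this is where the equivalence of norms enters.\<close>

lemma finite_dimensional_coord_system:
  assumes "finite_dimensional TYPE('a::real_normed_vector)"
  obtains B :: "'a::real_normed_vector set" and \<kappa> where "coord_system B \<kappa>"
proof -
  obtain B0 :: "'a set" where B0: "finite B0" "span B0 = UNIV"
    using assms by (auto simp: finite_dimensional_def)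
  obtain B where B: "B \<subseteq> B0" "independent B" "B0 \<subseteq> span B"
    by (rule maximal_independent_subset[of B0])
  have fin: "finite B" using B(1) B0(1) finite_subset by blast
  have sp: "span B = UNIV" using B(3) B0(2) by (metis span_mono span_span top.extremum_uniqueI)
  obtain K where K: "\<And>c b. b \<in> B \<Longrightarrow> \<bar>c b\<bar> \<le> K * norm (\<Sum>b\<in>B. c b *\<^sub>R b)"
    using coordinates_bounded[OF fin B(2)] by blast
  have rep: "(\<Sum>b\<in>B. representation B x b *\<^sub>R b) = x" for x
    by (rule sum_representation_eq) (use fin sp B(2) in auto)
  have "bounded_linear (\<lambda>x. representation B x b)" if "b \<in> B" for b
  proof (rule bounded_linear_intro[where K = K])
    show "norm (representation B x b) \<le> norm x * K" for x
      using K[OF that, of "representation B x"] by (simp add: rep mult.commute)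
  qed (use B(2) sp in \<open>auto simp: representation_add representation_scale\<close>)
  then have "coord_system B (\<lambda>b x. representation B x b)" using fin rep by (simp add: coord_system_def)
  then show ?thesis using that by blast
qed

lemma finite_dimensional_prod:
  assumes "finite_dimensional TYPE('a::real_vector)" "finite_dimensional TYPE('b::real_vector)"
  shows "finite_dimensional TYPE('a \<times> 'b)"
proof -
  obtain B :: "'a set" where B: "finite B" "span B = UNIV"
    using assms by (auto simp: finite_dimensional_def)
  obtain C :: "'b set" where C: "finite C" "span C = UNIV"
    using assms by (auto simp: finite_dimensional_def)
  let ?D = "(\<lambda>b. (b, 0)) ` B \<union> (\<lambda>c. (0, c)) ` C"
  have "(x, y) \<in> span ?D" for x :: 'a and y :: 'b
  proof -
    have l1: "linear (\<lambda>b::'a. (b, 0::'b))" and l2: "linear (\<lambda>b::'b. (0::'a, b))"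
      by (auto intro!: linearI)
    have "(x, 0) \<in> span ?D"
      using linear_span_image[OF l1, of B] B(2) span_mono[of "(\<lambda>b. (b, 0)) ` B" ?D] by blast
    moreover have "(0, y) \<in> span ?D"
      using linear_span_image[OF l2, of C] C(2) span_mono[of "(\<lambda>b. (0, b)) ` C" ?D] by blast
    ultimately have "(x, 0) + (0, y) \<in> span ?D" by (rule span_add)
    then show ?thesis by simp
  qed
  then have "span ?D = UNIV" by auto
  then show ?thesis unfolding finite_dimensional_def using B(1) C(1) by (intro exI[of _ ?D]) auto
qed

lemma finite_dimensional_real: "finite_dimensional TYPE(real)"
  unfolding finite_dimensional_def
proof (intro exI conjI)
  have "x \<in> span {1}" for x :: real
    using span_scale[of 1 "{1::real}" x] by (simp add: span_base)
  then show "span {1::real} = UNIV" by blast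
qed simp

subsection \<open>Calculus of smooth maps\<close>

abbreviation FD :: "('a::real_normed_vector \<Rightarrow> 'b::real_normed_vector) \<Rightarrow> 'a \<Rightarrow> 'a \<Rightarrow> 'b" where
  "FD f x \<equiv> frechet_derivative f (at x)"

lemma frechet_derivative_eq: "(f has_derivative f') (at x) \<Longrightarrow> FD f x = f'"
  using frechet_derivative_at by metis

lemma has_frechet_derivative:
  "f differentiable (at x) \<Longrightarrow> (f has_derivative FD f x) (at x)"
  using frechet_derivative_works by blast

lemma C_on_Suc_imp: "C_on (Suc k) S f \<Longrightarrow> C_on k S f"
proof (induction k arbitrary: f)
  case 0
  then show ?case
    by (auto intro!: continuous_at_imp_continuous_on differentiable_imp_continuous_within)
qed (simp del: C_on.simps(1))

lemma C_on_cong: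
  assumes "open S" "\<And>x. x \<in> S \<Longrightarrow> f x = g x" "C_on k S f"
  shows "C_on k S g"
  using assms(2,3)
proof (induction k arbitrary: f g)
  case 0
  then show ?case by (simp cong: continuous_on_cong)
next
  case (Suc k)
  have d: "g differentiable (at x)" "FD g x = FD f x"
    if "x \<in> S" for x
  proof -
    have "f differentiable (at x)" using Suc.prems that by simp
    then have "(g has_derivative FD f x) (at x)"
      using has_derivative_transform_within_open[OF has_frechet_derivative assms(1) that] Suc.prems(1)
      by blast
    then show "g differentiable (at x)" "FD g x = FD f x"
      by (auto simp: differentiable_def frechet_derivative_eq)
  qed
  show ?case using Suc.prems(2) by (auto simp: d intro: Suc.IH[rotated])
qed

text \<open>Introduction rule for a derivative known in closed form. The definition speaks of
  \<open>frechet_derivative\<close>, which is known to be \<open>f'\<close> on \<open>S\<close>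
  only, so \<open>C_on_cong\<close> and openness of \<open>S\<close> are called for.\<close>

lemma C_on_SucI:
  assumes "open S" and d: "\<And>x. x \<in> S \<Longrightarrow> (f has_derivative f' x) (at x)" and "\<And>v. C_on k S (\<lambda>x. f' x v)"
  shows "C_on (Suc k) S f"
proof -
  have "C_on k S (\<lambda>x. FD f x v)" for v
    by (rule C_on_cong[OF assms(1) _ assms(3)]) (simp add: frechet_derivative_eq[OF d])
  then show ?thesis using d by (auto simp: differentiable_def)
qed

lemma C_on_subset: "C_on k S f \<Longrightarrow> T \<subseteq> S \<Longrightarrow> C_on k T f"
  by (induction k arbitrary: f) (auto intro: continuous_on_subset)

lemma C_on_local:
  assumes "\<And>x. x \<in> S \<Longrightarrow> \<exists>T. open T \<and> x \<in> T \<and> C_on k T f"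
  shows "C_on k S f"
  using assms
proof (induction k arbitrary: f)
  case 0
  then show ?case
    by (auto intro!: continuous_at_imp_continuous_on)
      (metis continuous_on_eq_continuous_at)
next
  case (Suc k)
  show ?case
    unfolding C_on.simps
  proof safe
    show "f differentiable at x" if "x \<in> S" for x using Suc.prems[OF that] by auto
    show "C_on k S (\<lambda>x. FD f x v)" for v
      by (rule Suc.IH) (use Suc.prems in fastforce)
  qed
qed

lemma C_on_bounded_linear:
  assumes "bounded_linear L" "open S" "C_on k S f"
  shows "C_on k S (\<lambda>x. L (f x))"
  using assms(3)
proof (induction k arbitrary: f)
  case 0
  then show ?case using assms(1) by (simp add: bounded_linear.continuous_on)
next
  case (Suc k)
  show ?case
    by (rule C_on_SucI[OF assms(2) bounded_linear.has_derivative[OF assms(1) has_frechet_derivative] Suc.IH])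
      (use Suc.prems in auto)
qed

lemma C_on_const: "C_on k S (\<lambda>x. c)"
  by (induction k arbitrary: c) auto

lemma C_on_linear:
  assumes "bounded_linear L" shows "C_on k S L"
proof (cases k)
  case 0
  then show ?thesis using assms by (simp add: linear_continuous_on)
next
  case (Suc n)
  have "(L has_derivative L) (at x)" for x using assms by (rule bounded_linear_imp_has_derivative)
  then show ?thesis using Suc by (auto simp: frechet_derivative_eq[OF \<open>(L has_derivative L) (at _)\<close>] differentiable_def C_on_const)
qed

lemma C_on_add:
  assumes "open S" "C_on k S f" "C_on k S g"
  shows "C_on k S (\<lambda>x. f x + g x)"
  using assms(2,3)
proof (induction k arbitrary: f g)
  case 0
  then show ?case by (auto intro: continuous_intros)
next
  case (Suc k)
  show ?case
    by (rule C_on_SucI[OF assms(1) has_derivative_add[OF has_frechet_derivative has_frechet_derivative] Suc.IH])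
      (use Suc.prems in auto)
qed

lemma C_on_scaleR:
  fixes f :: "'a::real_normed_vector \<Rightarrow> real"
  assumes "open S" "C_on k S f" "C_on k S g"
  shows "C_on k S (\<lambda>x. f x *\<^sub>R g x)"
  using assms(2,3)
proof (induction k arbitrary: f g)
  case 0
  then show ?case by (auto intro: continuous_intros)
next
  case (Suc k)
  show ?case
    by (rule C_on_SucI[OF assms(1) has_derivative_scaleR[OF has_frechet_derivative has_frechet_derivative]
          C_on_add[OF assms(1) Suc.IH Suc.IH]])
      (use Suc.prems C_on_Suc_imp[of k S f] C_on_Suc_imp[of k S g] in auto)
qed

lemma C_on_sum:
  assumes "open S" "finite I" "\<And>i. i \<in> I \<Longrightarrow> C_on k S (f i)"
  shows "C_on k S (\<lambda>x. \<Sum>i\<in>I. f i x)"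
  using assms(2,3) by (induction I) (auto intro: C_on_const C_on_add[OF assms(1)])

text \<open>By the chain rule the derivative of g in the composite is taken in the direction FD f x
  v, which varies with x, while \<open>C_on\<close> controls fixed directions. Expanding this
  direction in a basis of the intermediate space gives a sum of products, to whose factors the
  induction hypothesis applies.\<close>

lemma C_on_compose:
  fixes f :: "'a::real_normed_vector \<Rightarrow> 'b::real_normed_vector"
  assumes "finite_dimensional TYPE('b)" "open S" "open T" "f ` S \<subseteq> T" "C_on k S f" "C_on k T g"
  shows "C_on k S (\<lambda>x. g (f x))"
  using assms(5,6)
proof (induction k arbitrary: g)
  case 0
  then show ?case using assms(4) continuous_on_compose2 by auto
next
  case (Suc k)
  obtain B :: "'b set" and \<kappa> where "coord_system B \<kappa>"
    using assms(1) by (rule finite_dimensional_coord_system)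
  then have B: "finite B" "\<And>b. b \<in> B \<Longrightarrow> bounded_linear (\<kappa> b)" "\<And>x. (\<Sum>b\<in>B. \<kappa> b x *\<^sub>R b) = x"
    by (auto simp: coord_system_def)
  have gd: "g differentiable (at (f x))" if "x \<in> S" for x using Suc.prems that assms(4) by auto
  have d: "((\<lambda>x. g (f x)) has_derivative
      (\<lambda>v. FD g (f x) (FD f x v))) (at x)"
    if "x \<in> S" for x
    by (rule has_derivative_compose[where f = f and g = g, OF has_frechet_derivative has_frechet_derivative[OF gd[OF that]]])
      (use Suc.prems that in auto)
  have e: "FD g (f x) w = (\<Sum>b\<in>B. \<kappa> b w *\<^sub>R FD g (f x) b)"
    if "x \<in> S" for x w
  proof -
    have l: "linear (FD g (f x))" using gd[OF that] by (rule linear_frechet_derivative)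
    have "FD g (f x) w = FD g (f x) (\<Sum>b\<in>B. \<kappa> b w *\<^sub>R b)"
      by (simp add: B(3))
    then show ?thesis by (simp only: linear_sum[OF l] linear_scale[OF l])
  qed
  show ?case
  proof (rule C_on_SucI[OF assms(2) d])
    fix v
    have "C_on k S (\<lambda>x. \<Sum>b\<in>B. \<kappa> b (FD f x v) *\<^sub>R FD g (f x) b)"
    proof (intro C_on_sum[OF assms(2) B(1)] C_on_scaleR[OF assms(2)])
      show "C_on k S (\<lambda>x. \<kappa> b (FD f x v))" if "b \<in> B" for b
        using Suc.prems(1) by (intro C_on_bounded_linear[OF B(2)[OF that] assms(2)]) simp
      show "C_on k S (\<lambda>x. FD g (f x) b)" for b
        using Suc.prems by (intro Suc.IH C_on_Suc_imp[of k S f]) auto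
    qed
    then show "C_on k S (\<lambda>x. FD g (f x) (FD f x v))"
      by (rule C_on_cong[OF assms(2), rotated]) (rule e[symmetric])
  qed
qed

section \<open>Maps of class C^k for all k\<close>

lemma smooth_on_differentiable: "smooth_on S f \<Longrightarrow> x \<in> S \<Longrightarrow> f differentiable (at x)"
  unfolding smooth_on_def using C_on.simps(2) by blast

lemma smooth_on_has_derivative:
  "smooth_on S f \<Longrightarrow> x \<in> S \<Longrightarrow> (f has_derivative FD f x) (at x)"
  by (simp add: smooth_on_differentiable has_frechet_derivative)

lemma smooth_on_frechet_derivative:
  assumes "smooth_on S f" shows "smooth_on S (\<lambda>x. FD f x v)"
  unfolding smooth_on_def
proof
  show "C_on k S (\<lambda>x. FD f x v)" for k
    using assms[unfolded smooth_on_def, rule_format, of "Suc k"] by simp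
qed

lemma smooth_on_cong: "open S \<Longrightarrow> (\<And>x. x \<in> S \<Longrightarrow> f x = g x) \<Longrightarrow> smooth_on S f \<Longrightarrow> smooth_on S g"
  unfolding smooth_on_def by (auto intro: C_on_cong)

lemma smooth_on_subset: "smooth_on S f \<Longrightarrow> T \<subseteq> S \<Longrightarrow> smooth_on T f"
  unfolding smooth_on_def by (auto intro: C_on_subset)

lemma smooth_on_local:
  "(\<And>x. x \<in> S \<Longrightarrow> \<exists>T. open T \<and> x \<in> T \<and> smooth_on T f) \<Longrightarrow> smooth_on S f"
  unfolding smooth_on_def by (meson C_on_local)

lemma smooth_on_bounded_linear: "bounded_linear L \<Longrightarrow> open S \<Longrightarrow> smooth_on S f \<Longrightarrow> smooth_on S (\<lambda>x. L (f x))"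
  unfolding smooth_on_def by (auto intro: C_on_bounded_linear)

lemma smooth_on_linear: "bounded_linear L \<Longrightarrow> smooth_on S L"
  unfolding smooth_on_def by (auto intro: C_on_linear)

lemma smooth_on_const: "smooth_on S (\<lambda>x. c)"
  unfolding smooth_on_def by (auto intro: C_on_const)

lemma smooth_on_add:
  "open S \<Longrightarrow> smooth_on S f \<Longrightarrow> smooth_on S g \<Longrightarrow> smooth_on S (\<lambda>x. f x + g x)"
  unfolding smooth_on_def by (auto intro: C_on_add)

lemma smooth_on_scaleR:
  "open S \<Longrightarrow> smooth_on S f \<Longrightarrow> smooth_on S g \<Longrightarrow> smooth_on S (\<lambda>x. f x *\<^sub>R g x)"
  unfolding smooth_on_def by (auto intro: C_on_scaleR)

lemma smooth_on_mult:
  fixes f g :: "'a::real_normed_vector \<Rightarrow> real"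
  shows "open S \<Longrightarrow> smooth_on S f \<Longrightarrow> smooth_on S g \<Longrightarrow> smooth_on S (\<lambda>x. f x * g x)"
  using smooth_on_scaleR[of S f g] by simp

lemma smooth_on_sum:
  "open S \<Longrightarrow> finite I \<Longrightarrow> (\<And>i. i \<in> I \<Longrightarrow> smooth_on S (f i)) \<Longrightarrow> smooth_on S (\<lambda>x. \<Sum>i\<in>I. f i x)"
  unfolding smooth_on_def by (auto intro: C_on_sum)

lemma smooth_on_compose:
  fixes f :: "'a::real_normed_vector \<Rightarrow> 'b::real_normed_vector"
  assumes "finite_dimensional TYPE('b)" "open S" "open T" "f ` S \<subseteq> T" "smooth_on S f" "smooth_on T g"
  shows "smooth_on S (\<lambda>x. g (f x))"
  using assms unfolding smooth_on_def by (blast intro: C_on_compose)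

lemma smooth_on_Pair:
  assumes "open S" "smooth_on S f" "smooth_on S g"
  shows "smooth_on S (\<lambda>x. (f x, g x))"
proof -
  have "smooth_on S (\<lambda>x. (f x, 0) + (0, g x))"
    by (intro smooth_on_add assms smooth_on_bounded_linear[of "\<lambda>a. (a, 0)"]
        smooth_on_bounded_linear[of "\<lambda>a. (0, a)"] bounded_linear_Pair bounded_linear_ident
        bounded_linear_zero)
  then show ?thesis by simp
qed

lemma smooth_on_exp:
  fixes f :: "'a::real_normed_vector \<Rightarrow> real"
  assumes "open S" "smooth_on S f"
  shows "smooth_on S (\<lambda>x. exp (f x))"
  unfolding smooth_on_def
proof
  have f: "C_on k S f" for k using assms(2) by (simp add: smooth_on_def)
  have d: "((\<lambda>x. exp (f x)) has_derivative (\<lambda>v. exp (f x) *\<^sub>R FD f x v)) (at x)"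
    if "x \<in> S" for x
    using smooth_on_has_derivative[OF assms(2) that]
    by (auto intro!: derivative_eq_intros simp: mult.commute)
  show "C_on k S (\<lambda>x. exp (f x))" for k
  proof (induction k)
    case 0
    then show ?case using f[of 0] by (auto intro: continuous_intros)
  next
    case (Suc k)
    show ?case
      by (rule C_on_SucI[OF assms(1) d C_on_scaleR[OF assms(1) Suc]]) (use f[of "Suc k"] in auto)
  qed
qed

text \<open>The integrating factor exp (- n t) makes the product constant. The lemma determines the
  extension of 1 along flow lines and characterizes homogeneous forms.\<close>

lemma exponential_growth:
  fixes h :: "real \<Rightarrow> real"
  assumes "\<And>t. (h has_real_derivative n * h t) (at t)"
  shows "h t = exp (n * t) * h 0"
proof -
  have "((\<lambda>t. exp (- n * t) * h t) has_real_derivative 0) (at t)" for t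
    by (rule derivative_eq_intros assms refl | simp)+
  then have "exp (- n * t) * h t = exp (- n * 0) * h 0"
    by (intro DERIV_isconst_all[of "\<lambda>t. exp (- n * t) * h t"]) blast
  then show ?thesis by (simp add: exp_minus field_simps)
qed

subsection \<open>Symmetry of second derivatives\<close>

text \<open>The mean value theorem is applied twice: in direction \<open>u\<close> to the increment
  of f by h v, then in direction \<open>v\<close> to the derivative. The second difference is
  symmetric in \<open>u\<close> and \<open>v\<close>, so it links the two mixed derivatives.\<close>

lemma second_difference_mean_value:
  fixes f :: "'a::real_normed_vector \<Rightarrow> real"
  assumes "C_on 2 S f" "h > 0"
    and S: "\<And>s t. 0 \<le> s \<Longrightarrow> s \<le> h \<Longrightarrow> 0 \<le> t \<Longrightarrow> t \<le> h \<Longrightarrow> x + s *\<^sub>R u + t *\<^sub>R v \<in> S"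
  obtains s t where "0 \<le> s" "s \<le> h" "0 \<le> t" "t \<le> h"
    "f (x + h *\<^sub>R u + h *\<^sub>R v) - f (x + h *\<^sub>R u) - f (x + h *\<^sub>R v) + f x =
     h * h * FD (\<lambda>y. FD f y u) (x + s *\<^sub>R u + t *\<^sub>R v) v"
proof -
  let ?D = "\<lambda>y. FD f y u"
  have f: "(f has_derivative FD f y) (at y)"
    and Df: "(?D has_derivative FD ?D y) (at y)" if "y \<in> S" for y
    using assms(1) that by (auto simp: numeral_2_eq_2 intro!: has_frechet_derivative)
  have d1: "((\<lambda>s. f (x + s *\<^sub>R u + t *\<^sub>R v)) has_real_derivative ?D (x + s *\<^sub>R u + t *\<^sub>R v)) (at s)"
    if "0 \<le> s" "s \<le> h" "0 \<le> t" "t \<le> h" for s t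
  proof -
    note * = f[OF S[OF that]]
    have "((\<lambda>s. f (x + s *\<^sub>R u + t *\<^sub>R v)) has_derivative
        (\<lambda>r. FD f (x + s *\<^sub>R u + t *\<^sub>R v) (r *\<^sub>R u))) (at s)"
      by (rule has_derivative_compose[where f = "\<lambda>s. x + s *\<^sub>R u + t *\<^sub>R v", OF _ *]) (auto intro!: derivative_eq_intros)
    then show ?thesis
      using linear_scale[OF has_derivative_linear[OF *]]
      by (simp add: has_field_derivative_def mult.commute[of _ "frechet_derivative _ _ _"])
  qed
  have d2: "((\<lambda>t. ?D (x + s *\<^sub>R u + t *\<^sub>R v)) has_real_derivative
      FD ?D (x + s *\<^sub>R u + t *\<^sub>R v) v) (at t)"
    if "0 \<le> s" "s \<le> h" "0 \<le> t" "t \<le> h" for s t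
  proof -
    note * = Df[OF S[OF that]]
    have "((\<lambda>t. ?D (x + s *\<^sub>R u + t *\<^sub>R v)) has_derivative
        (\<lambda>r. FD ?D (x + s *\<^sub>R u + t *\<^sub>R v) (r *\<^sub>R v))) (at t)"
      by (rule has_derivative_compose[where f = "\<lambda>t. x + s *\<^sub>R u + t *\<^sub>R v", OF _ *]) (auto intro!: derivative_eq_intros)
    then show ?thesis
      using linear_scale[OF has_derivative_linear[OF *]]
      by (simp add: has_field_derivative_def mult.commute[of _ "frechet_derivative _ _ _"])
  qed
  have "\<exists>s. 0 < s \<and> s < h \<and>
    (f (x + h *\<^sub>R u + h *\<^sub>R v) - f (x + h *\<^sub>R u + 0 *\<^sub>R v)) - (f (x + 0 *\<^sub>R u + h *\<^sub>R v) - f (x + 0 *\<^sub>R u + 0 *\<^sub>R v))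
     = (h - 0) * (?D (x + s *\<^sub>R u + h *\<^sub>R v) - ?D (x + s *\<^sub>R u + 0 *\<^sub>R v))"
    by (rule MVT2[of 0 h "\<lambda>s. f (x + s *\<^sub>R u + h *\<^sub>R v) - f (x + s *\<^sub>R u + 0 *\<^sub>R v)"])
      (use assms(2) in \<open>auto intro!: DERIV_diff d1 simp del: scaleR_zero_left\<close>)
  then obtain s where s: "0 < s" "s < h"
    "f (x + h *\<^sub>R u + h *\<^sub>R v) - f (x + h *\<^sub>R u) - f (x + h *\<^sub>R v) + f x
     = h * (?D (x + s *\<^sub>R u + h *\<^sub>R v) - ?D (x + s *\<^sub>R u + 0 *\<^sub>R v))" by auto
  have "\<exists>t. 0 < t \<and> t < h \<and> ?D (x + s *\<^sub>R u + h *\<^sub>R v) - ?D (x + s *\<^sub>R u + 0 *\<^sub>R v)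
     = (h - 0) * FD ?D (x + s *\<^sub>R u + t *\<^sub>R v) v"
    by (rule MVT2) (use assms(2) s in \<open>auto intro!: d2\<close>)
  then obtain t where "0 < t" "t < h" "?D (x + s *\<^sub>R u + h *\<^sub>R v) - ?D (x + s *\<^sub>R u + 0 *\<^sub>R v)
     = h * FD ?D (x + s *\<^sub>R u + t *\<^sub>R v) v" by auto
  with s show ?thesis by (intro that[of s t]) (auto simp only: mult.assoc less_imp_le)
qed

text \<open>Schwarz' theorem. One and the same second difference, divided by h * h, is a value of
  either mixed derivative at some point near \<open>x\<close>; by continuity the two values at
  \<open>x\<close> differ by at most 2 e.\<close>

lemma C2_symmetric_real:
  fixes f :: "'a::real_normed_vector \<Rightarrow> real"
  assumes "open S" "x \<in> S" "C_on 2 S f"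
  shows "FD (\<lambda>y. FD f y u) x v =
    FD (\<lambda>y. FD f y v) x u"
proof -
  let ?A = "\<lambda>y. FD (\<lambda>y. FD f y u) y v"
  let ?B = "\<lambda>y. FD (\<lambda>y. FD f y v) y u"
  have "continuous_on S ?A" "continuous_on S ?B" using assms(3) by (auto simp: numeral_2_eq_2)
  then have cA: "isCont ?A x" and cB: "isCont ?B x"
    using assms(1,2) continuous_on_eq_continuous_at by blast+
  have "\<bar>?A x - ?B x\<bar> \<le> 2 * e" if e: "e > 0" for e
  proof -
    obtain d1 where d1: "d1 > 0" "\<And>y. dist y x < d1 \<Longrightarrow> dist (?A y) (?A x) < e"
      using cA e by (auto simp: continuous_at_eps_delta)
    obtain d2 where d2: "d2 > 0" "\<And>y. dist y x < d2 \<Longrightarrow> dist (?B y) (?B x) < e"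
      using cB e by (auto simp: continuous_at_eps_delta)
    obtain d3 where d3: "d3 > 0" "\<And>y. dist y x < d3 \<Longrightarrow> y \<in> S"
      using assms(1,2) open_dist by blast
    define d where "d = min d1 (min d2 d3)"
    \<comment> \<open>With this choice the parallelogram with sides h u and h v at \<open>x\<close>
      stays within distance d / 2 of \<open>x\<close>; the summand 1 keeps the denominator positive
      if both vectors vanish.\<close>
    define h where "h = d / 2 / (norm u + norm v + 1)"
    have pos: "norm u + norm v + 1 > 0" by (smt (verit) norm_ge_zero)
    have d: "d > 0" using d1 d2 d3 by (simp add: d_def)
    have h: "h > 0" using pos d by (simp add: h_def)
    have near: "dist (x + s *\<^sub>R u + t *\<^sub>R v) x < d" if "0 \<le> s" "s \<le> h" "0 \<le> t" "t \<le> h" for s t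
    proof -
      have "dist (x + s *\<^sub>R u + t *\<^sub>R v) x = norm (s *\<^sub>R u + t *\<^sub>R v)" by (simp add: dist_norm)
      also have "\<dots> \<le> s * norm u + t * norm v"
        using norm_triangle_ineq[of "s *\<^sub>R u" "t *\<^sub>R v"] that by simp
      also have "\<dots> \<le> h * norm u + h * norm v" using that by (intro add_mono mult_right_mono) auto
      also have "\<dots> \<le> h * (norm u + norm v + 1)" using h by (simp add: algebra_simps)
      also have "\<dots> = d / 2" using pos unfolding h_def by (metis less_irrefl nonzero_eq_divide_eq)
      also have "\<dots> < d" using d by simp
      finally show ?thesis .
    qed
    have near': "dist (x + s *\<^sub>R v + t *\<^sub>R u) x < d" if "0 \<le> s" "s \<le> h" "0 \<le> t" "t \<le> h" for s t
      using near[of t s] that by (simp add: add.commute add.left_commute)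
    obtain s t where st: "0 \<le> s" "s \<le> h" "0 \<le> t" "t \<le> h"
      "f (x + h *\<^sub>R u + h *\<^sub>R v) - f (x + h *\<^sub>R u) - f (x + h *\<^sub>R v) + f x = h * h * ?A (x + s *\<^sub>R u + t *\<^sub>R v)"
      by (rule second_difference_mean_value[OF assms(3) h, of x u v]) (use near d3 d_def in auto)
    obtain s' t' where st': "0 \<le> s'" "s' \<le> h" "0 \<le> t'" "t' \<le> h"
      "f (x + h *\<^sub>R v + h *\<^sub>R u) - f (x + h *\<^sub>R v) - f (x + h *\<^sub>R u) + f x = h * h * ?B (x + s' *\<^sub>R v + t' *\<^sub>R u)"
      by (rule second_difference_mean_value[OF assms(3) h, of x v u]) (use near' d3 d_def in auto)
    have eq: "x + h *\<^sub>R v + h *\<^sub>R u = x + h *\<^sub>R u + h *\<^sub>R v" by simp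
    have "h * h * ?A (x + s *\<^sub>R u + t *\<^sub>R v) = h * h * ?B (x + s' *\<^sub>R v + t' *\<^sub>R u)"
      using st(5) st'(5) unfolding eq by linarith
    then have "?A (x + s *\<^sub>R u + t *\<^sub>R v) = ?B (x + s' *\<^sub>R v + t' *\<^sub>R u)" using h by simp
    moreover have "dist (?A (x + s *\<^sub>R u + t *\<^sub>R v)) (?A x) < e" using near[OF st(1-4)] d1(2) d_def by simp
    moreover have "dist (?B (x + s' *\<^sub>R v + t' *\<^sub>R u)) (?B x) < e" using near'[OF st'(1-4)] d2(2) d_def by simp
    ultimately show ?thesis by (simp add: dist_real_def)
  qed
  then have "\<bar>?A x - ?B x\<bar> \<le> 0" using field_le_epsilon[of "\<bar>?A x - ?B x\<bar>" 0]
    by (metis add_0 field_sum_of_halves half_gt_zero mult.commute mult_2_right)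
  then show ?thesis by simp
qed

text \<open>Schwarz' theorem in each coordinate: a bounded linear functional passes through both
  derivatives.\<close>

lemma smooth_on_symmetric:
  fixes f :: "'a::real_normed_vector \<Rightarrow> 'b::real_normed_vector"
  assumes "finite_dimensional TYPE('b)" "open S" "x \<in> S" "smooth_on S f"
  shows "FD (\<lambda>y. FD f y u) x v =
    FD (\<lambda>y. FD f y v) x u"
proof -
  obtain B :: "'b set" and \<kappa> where "coord_system B \<kappa>"
    using assms(1) by (rule finite_dimensional_coord_system)
  then have B: "\<And>b. b \<in> B \<Longrightarrow> bounded_linear (\<kappa> b)" "\<And>x. (\<Sum>b\<in>B. \<kappa> b x *\<^sub>R b) = x"
    by (auto simp: coord_system_def)
  have k: "\<kappa> b (FD (\<lambda>y. FD f y u) x v) =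
    FD (\<lambda>y. FD (\<lambda>z. \<kappa> b (f z)) y u) x v"
    if b: "b \<in> B" for b u v
  proof -
    have e: "FD (\<lambda>z. \<kappa> b (f z)) y u = \<kappa> b (FD f y u)"
      if "y \<in> S" for y
      by (rule fun_cong[OF frechet_derivative_eq[OF bounded_linear.has_derivative[OF B(1)[OF b]]]])
        (rule smooth_on_has_derivative[OF assms(4) that])
    have "((\<lambda>y. \<kappa> b (FD f y u)) has_derivative
       (\<lambda>v. \<kappa> b (FD (\<lambda>y. FD f y u) x v))) (at x)"
      by (rule bounded_linear.has_derivative[OF B(1)[OF b]])
        (rule smooth_on_has_derivative[OF smooth_on_frechet_derivative[OF assms(4)] assms(3)])
    then have "((\<lambda>y. FD (\<lambda>z. \<kappa> b (f z)) y u) has_derivative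
       (\<lambda>v. \<kappa> b (FD (\<lambda>y. FD f y u) x v))) (at x)"
      by (rule has_derivative_transform_within_open[OF _ assms(2,3)]) (simp add: e)
    then show ?thesis by (simp add: frechet_derivative_eq)
  qed
  have "\<kappa> b (FD (\<lambda>y. FD f y u) x v) =
      \<kappa> b (FD (\<lambda>y. FD f y v) x u)" if b: "b \<in> B" for b
    unfolding k[OF b]
    by (rule C2_symmetric_real[OF assms(2,3)])
      (use smooth_on_bounded_linear[OF B(1)[OF b] assms(2,4)] in \<open>simp add: smooth_on_def\<close>)
  then show ?thesis by (metis (no_types, lifting) B(2) sum.cong)
qed

section \<open>Alternating multilinear functions of lists\<close>

text \<open>The number of arguments is left free, so that one predicate serves all degrees, and
  alternation is vanishing on lists with a repetition, as in \<open>Omega\<close>.\<close>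

definition alternating_map :: "('a::real_vector list \<Rightarrow> real) \<Rightarrow> bool" where
  "alternating_map a \<longleftrightarrow>
     (\<forall>us ws v w p q. a (us @ (p *\<^sub>R v + q *\<^sub>R w) # ws) = p * a (us @ v # ws) + q * a (us @ w # ws)) \<and>
     (\<forall>vs. \<not> distinct vs \<longrightarrow> a vs = 0)"

lemma alternating_mapD:
  assumes "alternating_map a"
  shows "a (us @ (p *\<^sub>R v + q *\<^sub>R w) # ws) = p * a (us @ v # ws) + q * a (us @ w # ws)"
    and "\<not> distinct vs \<Longrightarrow> a vs = 0"
  using assms by (auto simp: alternating_map_def)

lemma alternating_map_add:
  assumes "alternating_map a"
  shows "a (us @ (v + w) # ws) = a (us @ v # ws) + a (us @ w # ws)"
  using alternating_mapD(1)[OF assms, of us 1 v 1 w ws] by simp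

lemma alternating_map_scale:
  assumes "alternating_map a"
  shows "a (us @ (p *\<^sub>R v) # ws) = p * a (us @ v # ws)"
  using alternating_mapD(1)[OF assms, of us p v 0 v ws] by simp

lemma alternating_map_zero:
  assumes "alternating_map a"
  shows "a (us @ 0 # ws) = 0"
  using alternating_map_scale[OF assms, of us 0 0 ws] by simp

lemma alternating_map_sum:
  assumes "alternating_map a" "finite I"
  shows "a (us @ (\<Sum>i\<in>I. c i *\<^sub>R f i) # ws) = (\<Sum>i\<in>I. c i * a (us @ f i # ws))"
  using assms(2)
  by (induction I)
    (simp_all add: alternating_map_zero[OF assms(1)] alternating_map_add[OF assms(1)]
      alternating_map_scale[OF assms(1)])

text \<open>Polarization: expand the value with v + w in both places, which is zero.\<close>

lemma alternating_map_swap: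
  assumes "alternating_map a"
  shows "a (us @ v # w # ws) = - a (us @ w # v # ws)"
proof -
  have "a (us @ (v + w) # (v + w) # ws) = 0"
    by (rule alternating_mapD(2)[OF assms]) auto
  moreover have "a (us @ (v + w) # (v + w) # ws) =
      a (us @ v # v # ws) + a (us @ v # w # ws) + (a (us @ w # v # ws) + a (us @ w # w # ws))"
    using alternating_map_add[OF assms, of us v w "(v + w) # ws"]
      alternating_map_add[OF assms, of "us @ [v]" v w ws]
      alternating_map_add[OF assms, of "us @ [w]" v w ws] by simp
  moreover have "a (us @ v # v # ws) = 0" "a (us @ w # w # ws) = 0"
    by (auto intro!: alternating_mapD(2)[OF assms])
  ultimately show ?thesis by linarith
qed

lemma alternating_map_move:
  assumes "alternating_map a"
  shows "a (us @ ws @ h # zs) = (-1) ^ length ws * a (us @ h # ws @ zs)"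
proof (induction ws arbitrary: us)
  case (Cons w ws)
  have "a (us @ (w # ws) @ h # zs) = (-1) ^ length ws * a (us @ w # h # ws @ zs)"
    using Cons[of "us @ [w]"] by simp
  then show ?case using alternating_map_swap[OF assms, of us w h "ws @ zs"] by simp
qed simp

subsection \<open>Omitting list elements\<close>

lemma length_omit: "i < length vs \<Longrightarrow> length (omit i vs) = length vs - 1"
  by (simp add: omit_def)

lemma nth_omit: "i < length vs \<Longrightarrow> j < length vs - 1 \<Longrightarrow> omit i vs ! j = (if j < i then vs ! j else vs ! Suc j)"
  by (auto simp: omit_def nth_append min_def)

lemma set_omit_subset: "set (omit i vs) \<subseteq> set vs"
  using set_take_subset[of i vs] set_drop_subset[of "Suc i" vs] by (auto simp: omit_def)

lemma map_omit: "map f (omit i vs) = omit i (map f vs)"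
  by (simp add: omit_def take_map drop_map)

text \<open>The simplicial identity for faces; it is behind d \<circ> d = 0 and the cancellation of
  second derivatives in a pullback.\<close>

lemma omit_omit:
  assumes "j < i" "i < length vs"
  shows "omit j (omit i vs) = omit (i - 1) (omit j vs)"
proof (rule nth_equalityI)
  show "length (omit j (omit i vs)) = length (omit (i - 1) (omit j vs))"
    using assms by (simp add: length_omit)
  fix k assume "k < length (omit j (omit i vs))"
  then have k: "k < length vs - 2" using assms by (simp add: length_omit)
  have "omit j (omit i vs) ! k = omit i vs ! (if k < j then k else Suc k)"
    using assms k by (subst nth_omit) (auto simp: length_omit)
  moreover have "omit (i - 1) (omit j vs) ! k = omit j vs ! (if k < i - 1 then k else Suc k)"
    using assms k by (subst nth_omit) (auto simp: length_omit)
  ultimately show "omit j (omit i vs) ! k = omit (i - 1) (omit j vs) ! k"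
    using assms k by (auto simp: nth_omit)
qed

lemma omit_less: "i < length us \<Longrightarrow> omit i (us @ x # ws) = omit i us @ x # ws"
  by (simp add: omit_def)

lemma omit_eq: "omit (length us) (us @ x # ws) = us @ ws"
  by (simp add: omit_def)

lemma omit_greater: "omit (Suc (length us + j)) (us @ x # ws) = us @ x # omit j ws"
  by (simp add: omit_def)

lemma list_index_cases:
  assumes "i < length (us @ x # ws)"
  obtains "i < length us" | "i = length us" | j where "i = Suc (length us + j)" "j < length ws"
proof -
  consider "i < length us" | "i = length us" | "i > length us" by linarith
  then show ?thesis
  proof cases
    case 3
    then show ?thesis using that(3)[of "i - length us - 1"] assms by auto
  qed (use that in auto)
qed

lemma alternating_map_update:
  assumes "alternating_map a" "j < length xs"
  shows "a (xs[j := x]) = (-1) ^ j * a (x # omit j xs)"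
  using alternating_map_move[OF assms(1), of "[]" "take j xs" x "drop (Suc j) xs"] assms(2)
  by (simp add: upd_conv_take_nth_drop omit_def)

text \<open>If \<open>v\<close> occurs twice, every term that keeps both copies vanishes. The two
  remaining terms contain the same list up to moving \<open>v\<close> across \<open>ms\<close>; the
  sign of this move and the distance of the two positions make them cancel. Applied to derivatives
  of coefficients, this shows that the exterior derivative is alternating.\<close>

lemma alternating_map_antisymmetrization:
  assumes alt: "\<And>v. alternating_map (T v)"
    and lin: "\<And>p v q w ws. T (p *\<^sub>R v + q *\<^sub>R w) ws = p * T v ws + q * T w ws"
  shows "alternating_map (\<lambda>vs. \<Sum>i<length vs. (-1) ^ i * T (vs ! i) (omit i vs))"
  unfolding alternating_map_def
proof (intro conjI allI impI)
  fix us ws :: "'a list" and v w p q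
  let ?F = "\<lambda>x i. T ((us @ x # ws) ! i) (omit i (us @ x # ws))"
  let ?n = "length (us @ v # ws)"
  have "?F (p *\<^sub>R v + q *\<^sub>R w) i = p * ?F v i + q * ?F w i" if i: "i < length (us @ v # ws)" for i
    using i
  proof (cases rule: list_index_cases)
    case 1
    then show ?thesis by (simp add: omit_less nth_append alternating_mapD(1)[OF alt])
  next
    case 2
    then show ?thesis by (simp add: omit_eq lin)
  next
    case (3 j)
    then show ?thesis
      by (simp add: omit_greater nth_append alternating_mapD(1)[OF alt])
  qed
  then have "(\<Sum>i<?n. (-1) ^ i * ?F (p *\<^sub>R v + q *\<^sub>R w) i) =
     (\<Sum>i<?n. p * ((-1) ^ i * ?F v i) + q * ((-1) ^ i * ?F w i))"
    by (intro sum.cong) (auto simp: algebra_simps)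
  then show "(\<Sum>i<length (us @ (p *\<^sub>R v + q *\<^sub>R w) # ws). (-1) ^ i * ?F (p *\<^sub>R v + q *\<^sub>R w) i) =
     p * (\<Sum>i<length (us @ v # ws). (-1) ^ i * ?F v i) + q * (\<Sum>i<length (us @ w # ws). (-1) ^ i * ?F w i)"
    by (simp add: sum.distrib sum_distrib_left[symmetric] del: sum.lessThan_Suc)
next
  fix vs :: "'a list" assume "\<not> distinct vs"
  then obtain us v ms ws where vs: "vs = us @ v # ms @ v # ws"
    using not_distinct_decomp by force
  let ?t = "\<lambda>i. (-1) ^ i * T (vs ! i) (omit i vs)"
  let ?a = "length us" and ?b = "Suc (length us + length ms)"
  have "?t i = 0" if i: "i < length vs" "i \<notin> {?a, ?b}" for i
  proof -
    have "\<not> distinct (omit i vs)"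
      using i(1) unfolding vs
    proof (cases rule: list_index_cases)
      case 1
      then show "\<not> distinct (omit i (us @ v # ms @ v # ws))" by (simp add: omit_less)
    next
      case 2
      then show "\<not> distinct (omit i (us @ v # ms @ v # ws))" using i(2) by simp
    next
      case (3 j)
      note i3 = 3
      from 3(2) show "\<not> distinct (omit i (us @ v # ms @ v # ws))"
      proof (cases rule: list_index_cases)
        case 1
        then show ?thesis by (simp add: i3 omit_greater omit_less)
      next
        case 2
        then show ?thesis using i(2) i3 by simp
      next
        case (3 k)
        have "omit i (us @ v # ms @ v # ws) = us @ v # ms @ v # omit k ws"
          unfolding i3 3(1) omit_greater ..
        then show ?thesis by simp
      qed
    qed
    then show ?thesis using alternating_mapD(2)[OF alt] by simp
  qed
  then have "(\<Sum>i<length vs. ?t i) = (\<Sum>i\<in>{?a, ?b}. ?t i)"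
    by (intro sum.mono_neutral_right) (auto simp: vs)
  also have "\<dots> = ?t ?a + ?t ?b" by simp
  also have "?t ?a = (-1) ^ ?a * T v (us @ ms @ v # ws)" by (simp add: vs omit_eq)
  also have "T v (us @ ms @ v # ws) = (-1) ^ length ms * T v (us @ v # ms @ ws)"
    by (rule alternating_map_move[OF alt])
  also have "?t ?b = (-1) ^ ?b * T v (us @ v # ms @ ws)"
    by (simp add: vs omit_greater omit_eq nth_append)
  finally show "(\<Sum>i<length vs. ?t i) = 0" by (simp add: power_add)
qed

text \<open>The pair (i, j) with j < i is matched with (j, i - 1): the same two entries are removed
  in the other order, the arguments of \<open>Q\<close> are exchanged and the sign changes.\<close>

lemma double_omit_sum_zero:
  fixes Q :: "'a \<Rightarrow> 'a \<Rightarrow> 'a list \<Rightarrow> real"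
  assumes "\<And>u v ws. Q u v ws = Q v u ws"
  shows "(\<Sum>i<length vs. (-1) ^ i *
    (\<Sum>j<length (omit i vs). (-1) ^ j * Q (vs ! i) (omit i vs ! j) (omit j (omit i vs)))) = 0"
proof -
  let ?n = "length vs"
  define P where "P = (\<lambda>(i, j). (-1) ^ (i + j) * Q (vs ! i) (omit i vs ! j) (omit j (omit i vs)))"
  define A where "A = {(i, j). i < ?n \<and> j < i}"
  define B where "B = {(i, j). i \<le> j \<and> j < ?n - 1}"
  have fin: "finite A" "finite B"
    by (auto simp: A_def B_def intro: finite_subset[of _ "{..<?n} \<times> {..<?n}"])
  have "(\<Sum>i<?n. (-1) ^ i *
      (\<Sum>j<length (omit i vs). (-1) ^ j * Q (vs ! i) (omit i vs ! j) (omit j (omit i vs)))) =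
      (\<Sum>i<?n. \<Sum>j<?n - 1. P (i, j))"
    by (intro sum.cong refl) (simp add: sum_distrib_left length_omit P_def power_add mult.assoc)
  also have "\<dots> = (\<Sum>p\<in>{..<?n} \<times> {..<?n - 1}. P p)" by (simp add: sum.cartesian_product)
  also have "{..<?n} \<times> {..<?n - 1} = A \<union> B" by (auto simp: A_def B_def)
  also have "(\<Sum>p\<in>A \<union> B. P p) = (\<Sum>p\<in>A. P p) + (\<Sum>p\<in>B. P p)"
    by (intro sum.union_disjoint fin) (auto simp: A_def B_def)
  also have "(\<Sum>p\<in>B. P p) = (\<Sum>p\<in>A. P (snd p, fst p - 1))"
    by (rule sum.reindex_bij_witness[where i = "\<lambda>(i, j). (j, i - 1)" and j = "\<lambda>(i, j). (Suc j, i)"])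
      (auto simp: A_def B_def)
  also have "\<dots> = (\<Sum>p\<in>A. - P p)"
  proof (intro sum.cong refl)
    fix p assume "p \<in> A"
    then obtain i j where p: "p = (i, j)" and ij: "j < i" "i < ?n" by (auto simp: A_def)
    then obtain m where m: "i = Suc m" by (cases i) auto
    have "vs ! i = omit j vs ! (i - 1)" "omit i vs ! j = vs ! j"
      using ij by (auto simp: nth_omit m)
    then show "P (snd p, fst p - 1) = - P p"
      using ij omit_omit[OF ij] assms[of "vs ! i"] by (simp add: p P_def m add.commute)
  qed
  finally show ?thesis by (simp add: sum_negf)
qed

text \<open>Expanding one argument at a time, each term containing \<xi> vanishes once \<xi> is
  moved to the front. Later \<xi> is the coordinate vector of \<open>X\<close> and the map is a
  horizontal form.\<close>

lemma alternating_map_mod_kernel: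
  assumes a: "alternating_map a" and \<xi>: "\<And>ws. a (\<xi> # ws) = 0"
  shows "a (us @ map (\<lambda>v. w v + r v *\<^sub>R \<xi>) vs) = a (us @ map w vs)"
proof (induction vs arbitrary: us)
  case (Cons v vs)
  let ?zs = "map (\<lambda>v. w v + r v *\<^sub>R \<xi>) vs"
  have "a (us @ \<xi> # ?zs) = 0" using alternating_map_move[OF a, of "[]" us \<xi> ?zs] \<xi> by simp
  then have "a (us @ map (\<lambda>v. w v + r v *\<^sub>R \<xi>) (v # vs)) = a (us @ w v # ?zs)"
    by (simp add: alternating_map_add[OF a] alternating_map_scale[OF a])
  also have "\<dots> = a (us @ map w (v # vs))" using Cons[of "us @ [w v]"] by simp
  finally show ?case .
qed simp

subsection \<open>Alternating functions depending on a parameter\<close>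

text \<open>Induction over the moving arguments: each is expanded in a fixed basis with smooth
  coefficients, and the basis vector joins the constant arguments collected in
  \<open>us\<close>.\<close>

lemma smooth_on_alternating:
  fixes hs :: "('y::real_normed_vector \<Rightarrow> 'a::real_normed_vector) list"
  assumes B: "coord_system (B :: 'a set) \<kappa>" and S: "open S" and alt: "\<And>y. y \<in> S \<Longrightarrow> alternating_map (a y)"
    and sm: "\<And>ws. smooth_on S (\<lambda>y. a y ws)" and hs: "\<And>h. h \<in> set hs \<Longrightarrow> smooth_on S h"
  shows "smooth_on S (\<lambda>y. a y (us @ map (\<lambda>h. h y) hs))"
  using hs
proof (induction hs arbitrary: us)
  case Nil
  then show ?case by (simp add: sm)
next
  case (Cons h hs)
  have fin: "finite B" and bl: "\<And>b. b \<in> B \<Longrightarrow> bounded_linear (\<kappa> b)"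
    and rep: "\<And>x. (\<Sum>b\<in>B. \<kappa> b x *\<^sub>R b) = x" using B by (auto simp: coord_system_def)
  have "smooth_on S (\<lambda>y. \<Sum>b\<in>B. \<kappa> b (h y) * a y ((us @ [b]) @ map (\<lambda>h. h y) hs))"
  proof (intro smooth_on_sum[OF S fin] smooth_on_mult[OF S])
    show "smooth_on S (\<lambda>y. \<kappa> b (h y))" if "b \<in> B" for b
      using Cons.prems by (intro smooth_on_bounded_linear[OF bl[OF that] S]) auto
    show "smooth_on S (\<lambda>y. a y ((us @ [b]) @ map (\<lambda>h. h y) hs))" for b
      by (rule Cons.IH) (use Cons.prems in auto)
  qed
  moreover have "(\<Sum>b\<in>B. \<kappa> b (h y) * a y ((us @ [b]) @ map (\<lambda>h. h y) hs)) =
      a y (us @ map (\<lambda>h. h y) (h # hs))" if "y \<in> S" for y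
    using alternating_map_sum[OF alt[OF that] fin, of us "\<lambda>b. \<kappa> b (h y)" "\<lambda>b. b"] by (simp add: rep)
  ultimately show ?case by (rule smooth_on_cong[OF S, rotated])
qed

text \<open>Product rule for a multilinear expression in which the coefficients and all arguments
  move: \<open>a'\<close> comes from the coefficients, the sum from one argument at a time. The
  induction again shifts expanded arguments into \<open>us\<close>.\<close>

lemma has_derivative_alternating:
  fixes G G' :: "'w \<Rightarrow> 'y::real_normed_vector \<Rightarrow> 'a::real_normed_vector"
  assumes B: "coord_system (B :: 'a set) \<kappa>" and S: "open S" "y0 \<in> S" and alt: "\<And>y. y \<in> S \<Longrightarrow> alternating_map (a y)"
    and a': "\<And>ws. ((\<lambda>y. a y ws) has_derivative a' ws) (at y0)"
    and G: "\<And>w. (G w has_derivative G' w) (at y0)"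
  shows "((\<lambda>y. a y (us @ map (\<lambda>w. G w y) ws)) has_derivative
    (\<lambda>v. a' (us @ map (\<lambda>w. G w y0) ws) v +
       (\<Sum>j<length ws. a y0 (us @ (map (\<lambda>w. G w y0) ws)[j := G' (ws ! j) v])))) (at y0)"
proof (induction ws arbitrary: us)
  case Nil
  then show ?case using a' by simp
next
  case (Cons w ws)
  have fin: "finite B" and bl: "\<And>b. b \<in> B \<Longrightarrow> bounded_linear (\<kappa> b)"
    and rep: "\<And>x. (\<Sum>b\<in>B. \<kappa> b x *\<^sub>R b) = x" using B by (auto simp: coord_system_def)
  let ?g = "map (\<lambda>w. G w y0) ws"
  have ex: "(\<Sum>b\<in>B. \<kappa> b x * a y (us @ b # zs)) = a y (us @ x # zs)" if "y \<in> S" for y x zs us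
    using alternating_map_sum[OF alt[OF that] fin, of us "\<lambda>b. \<kappa> b x" "\<lambda>b. b"] by (simp add: rep)
  \<comment> \<open>\<open>a'\<close> is known only as a derivative; it inherits the expansion in a
    basis from \<open>a\<close> by uniqueness of derivatives.\<close>
  have ex': "(\<Sum>b\<in>B. \<kappa> b x * a' (us @ b # zs) v) = a' (us @ x # zs) v" for x zs us v
  proof -
    have "((\<lambda>y. \<Sum>b\<in>B. \<kappa> b x * a y (us @ b # zs)) has_derivative
       (\<lambda>v. \<Sum>b\<in>B. \<kappa> b x * a' (us @ b # zs) v)) (at y0)"
      by (intro has_derivative_sum has_derivative_mult_right a')
    then have "((\<lambda>y. a y (us @ x # zs)) has_derivative (\<lambda>v. \<Sum>b\<in>B. \<kappa> b x * a' (us @ b # zs) v)) (at y0)"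
      by (rule has_derivative_transform_within_open[OF _ S]) (simp add: ex)
    from has_derivative_unique[OF this a'] show ?thesis by (rule fun_cong)
  qed
  have \<kappa>: "((\<lambda>y. \<kappa> b (G w y)) has_derivative (\<lambda>v. \<kappa> b (G' w v))) (at y0)" if "b \<in> B" for b
    by (rule bounded_linear.has_derivative[OF bl[OF that] G])
  have "((\<lambda>y. \<Sum>b\<in>B. \<kappa> b (G w y) * a y ((us @ [b]) @ map (\<lambda>w. G w y) ws)) has_derivative
    (\<lambda>v. \<Sum>b\<in>B. \<kappa> b (G w y0) * (a' ((us @ [b]) @ ?g) v +
        (\<Sum>j<length ws. a y0 ((us @ [b]) @ ?g[j := G' (ws ! j) v]))) +
      \<kappa> b (G' w v) * a y0 ((us @ [b]) @ ?g))) (at y0)"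
    by (intro has_derivative_sum has_derivative_mult \<kappa> Cons.IH)
  also have "(\<lambda>v. \<Sum>b\<in>B. \<kappa> b (G w y0) * (a' ((us @ [b]) @ ?g) v +
        (\<Sum>j<length ws. a y0 ((us @ [b]) @ ?g[j := G' (ws ! j) v]))) +
      \<kappa> b (G' w v) * a y0 ((us @ [b]) @ ?g)) =
    (\<lambda>v. a' (us @ map (\<lambda>w. G w y0) (w # ws)) v +
       (\<Sum>j<length (w # ws). a y0 (us @ (map (\<lambda>w. G w y0) (w # ws))[j := G' ((w # ws) ! j) v])))"
    (is "?L = ?R")
  proof
    fix v
    have "?L v = (\<Sum>b\<in>B. \<kappa> b (G w y0) * a' (us @ b # ?g) v) +
        (\<Sum>b\<in>B. \<Sum>j<length ws. \<kappa> b (G w y0) * a y0 (us @ b # ?g[j := G' (ws ! j) v])) +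
        (\<Sum>b\<in>B. \<kappa> b (G' w v) * a y0 (us @ b # ?g))"
      by (simp add: algebra_simps sum.distrib sum_distrib_left)
    also have "(\<Sum>b\<in>B. \<Sum>j<length ws. \<kappa> b (G w y0) * a y0 (us @ b # ?g[j := G' (ws ! j) v])) =
       (\<Sum>j<length ws. a y0 (us @ G w y0 # ?g[j := G' (ws ! j) v]))"
      by (subst sum.swap) (simp add: ex S)
    finally show "?L v = ?R v"
      by (simp add: ex ex' S sum.lessThan_Suc_shift del: sum.lessThan_Suc)
  qed
  finally show ?case
    by (rule has_derivative_transform_within_open[OF _ S]) (simp add: ex)
qed

section \<open>The exterior derivative in coordinates\<close>

definition coord_ext_deriv :: "('e::real_normed_vector \<Rightarrow> 'e list \<Rightarrow> real) \<Rightarrow> 'e \<Rightarrow> 'e list \<Rightarrow> real" where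
  "coord_ext_deriv a y ws =
     (\<Sum>i<length ws. (-1) ^ i * FD (\<lambda>z. a z (omit i ws)) y (ws ! i))"

lemma coord_ext_deriv_cong:
  assumes "open S" "y \<in> S" "\<And>z ws. z \<in> S \<Longrightarrow> a z ws = b z ws"
    and "\<And>ws. (\<lambda>z. a z ws) differentiable (at y)"
  shows "coord_ext_deriv b y ws = coord_ext_deriv a y ws"
proof -
  have "FD (\<lambda>z. b z zs) y = FD (\<lambda>z. a z zs) y" for zs
    by (rule frechet_derivative_eq[OF has_derivative_transform_within_open[OF
            has_frechet_derivative[OF assms(4)] assms(1,2)]]) (simp add: assms(3))
  then show ?thesis by (simp add: coord_ext_deriv_def)
qed

text \<open>Naturality of d. Differentiating the pulled back coefficients also differentiates the
  arguments \<open>D y w\<close>, which produces second derivatives \<open>H\<close> of \<psi>.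
  These are symmetric, so their alternating sum vanishes and only the first-order term is
  left.\<close>

lemma coord_ext_deriv_pullback:
  fixes \<psi> :: "'e::real_normed_vector \<Rightarrow> 'f::real_normed_vector"
  assumes fd: "finite_dimensional TYPE('f)"
    and S: "open S" "y0 \<in> S" and T: "open T" "\<psi> ` S \<subseteq> T" and sm: "smooth_on S \<psi>"
    and alt: "\<And>z. z \<in> T \<Longrightarrow> alternating_map (a z)"
    and a: "\<And>ws. smooth_on T (\<lambda>z. a z ws)"
  defines "D \<equiv> \<lambda>y. FD \<psi> y"
  shows "coord_ext_deriv (\<lambda>y ws. a (\<psi> y) (map (D y) ws)) y0 ws =
    coord_ext_deriv a (\<psi> y0) (map (D y0) ws)"
proof -
  obtain B :: "'f set" and \<kappa> where B: "coord_system B \<kappa>"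
    using fd by (rule finite_dimensional_coord_system)
  let ?a = "\<lambda>z zs v. FD (\<lambda>z. a z zs) z v"
  define H where "H = (\<lambda>w. FD (\<lambda>y. D y w) y0)"
  have yT: "\<psi> y0 \<in> T" using S(2) T(2) by auto
  have "((\<lambda>y. a (\<psi> y) ([] @ map (\<lambda>w. D y w) zs)) has_derivative
    (\<lambda>v. ?a (\<psi> y0) ([] @ map (\<lambda>w. D y0 w) zs) (D y0 v) +
       (\<Sum>j<length zs. a (\<psi> y0) ([] @ (map (\<lambda>w. D y0 w) zs)[j := H (zs ! j) v])))) (at y0)" for zs
  proof (rule has_derivative_alternating[OF B S])
    show "alternating_map (a (\<psi> y))" if "y \<in> S" for y using that T(2) alt by auto
    show "((\<lambda>y. a (\<psi> y) ws) has_derivative (\<lambda>v. ?a (\<psi> y0) ws (D y0 v))) (at y0)" for ws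
      unfolding D_def
      by (rule has_derivative_compose[where f = \<psi> and g = "\<lambda>z. a z ws",
            OF smooth_on_has_derivative[OF sm S(2)] smooth_on_has_derivative[OF a yT]])
    show "((\<lambda>y. D y w) has_derivative H w) (at y0)" for w
      unfolding D_def H_def
      by (rule smooth_on_has_derivative[OF smooth_on_frechet_derivative[OF sm] S(2)])
  qed
  then have d: "FD (\<lambda>y. a (\<psi> y) (map (D y) zs)) y0 =
    (\<lambda>v. ?a (\<psi> y0) (map (D y0) zs) (D y0 v) +
       (\<Sum>j<length zs. a (\<psi> y0) ((map (D y0) zs)[j := H (zs ! j) v])))" for zs
    by (simp add: frechet_derivative_eq)
  have H: "H u v = H v u" for u v
    unfolding H_def D_def by (rule smooth_on_symmetric[OF fd S sm])
  \<comment> \<open>Moving the updated entry to the front costs the sign (-1)^j and brings the sum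
    into the shape of \<open>double_omit_sum_zero\<close>.\<close>
  have "(\<Sum>i<length ws. (-1) ^ i * (\<Sum>j<length (omit i ws).
       a (\<psi> y0) ((map (D y0) (omit i ws))[j := H (omit i ws ! j) (ws ! i)]))) =
     (\<Sum>i<length ws. (-1) ^ i * (\<Sum>j<length (omit i ws). (-1) ^ j *
       a (\<psi> y0) (H (ws ! i) (omit i ws ! j) # map (D y0) (omit j (omit i ws)))))"
    by (intro sum.cong refl arg_cong2[where f = "(*)"])
      (simp only: lessThan_iff alternating_map_update[OF alt[OF yT]] length_map map_omit[symmetric]
        H[of "omit _ ws ! _"])
  also have "\<dots> = 0"
    by (rule double_omit_sum_zero[where Q = "\<lambda>u v zs. a (\<psi> y0) (H u v # map (D y0) zs)"]) (simp add: H)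
  finally show ?thesis by (simp add: coord_ext_deriv_def d map_omit[symmetric] algebra_simps sum.distrib)
qed

lemma alternating_map_compose_linear:
  assumes "alternating_map a" "linear L"
  shows "alternating_map (\<lambda>ws. a (map L ws))"
  unfolding alternating_map_def
  by (auto simp: linear_add[OF assms(2)] linear_scale[OF assms(2)] alternating_mapD(1)[OF assms(1)]
      distinct_map intro: alternating_mapD(2)[OF assms(1)])

lemma alternating_map_Cons: "alternating_map a \<Longrightarrow> alternating_map (\<lambda>ws. a (x # ws))"
  unfolding alternating_map_def by (metis append_Cons distinct.simps(2))

lemma alternating_map_combination:
  assumes "alternating_map a" "alternating_map b"
  shows "alternating_map (\<lambda>ws. r * a ws + s * b ws)"
  unfolding alternating_map_def
  by (auto simp: alternating_mapD(1)[OF assms(1)] alternating_mapD(1)[OF assms(2)]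
      alternating_mapD(2)[OF assms(1)] alternating_mapD(2)[OF assms(2)] algebra_simps)

lemma alternating_map_derivative:
  assumes S: "open S" "y \<in> S" and alt: "\<And>z. z \<in> S \<Longrightarrow> alternating_map (a z)"
    and a: "\<And>ws. smooth_on S (\<lambda>z. a z ws)"
  shows "alternating_map (\<lambda>ws. FD (\<lambda>z. a z ws) y v)"
  unfolding alternating_map_def
proof (intro conjI allI impI)
  fix us ws v' w p q
  note d = smooth_on_has_derivative[OF a S(2)]
  have "((\<lambda>z. p * a z (us @ v' # ws) + q * a z (us @ w # ws)) has_derivative
     (\<lambda>v. p * FD (\<lambda>z. a z (us @ v' # ws)) y v +
          q * FD (\<lambda>z. a z (us @ w # ws)) y v)) (at y)"
    by (intro has_derivative_add has_derivative_mult_right d)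
  then have "((\<lambda>z. a z (us @ (p *\<^sub>R v' + q *\<^sub>R w) # ws)) has_derivative
     (\<lambda>v. p * FD (\<lambda>z. a z (us @ v' # ws)) y v +
          q * FD (\<lambda>z. a z (us @ w # ws)) y v)) (at y)"
    by (rule has_derivative_transform_within_open[OF _ S]) (simp add: alternating_mapD(1)[OF alt])
  then show "FD (\<lambda>z. a z (us @ (p *\<^sub>R v' + q *\<^sub>R w) # ws)) y v =
      p * FD (\<lambda>z. a z (us @ v' # ws)) y v +
      q * FD (\<lambda>z. a z (us @ w # ws)) y v"
    by (simp add: frechet_derivative_eq)
next
  fix vs :: "'b list" assume vs: "\<not> distinct vs"
  have "((\<lambda>z. a z vs) has_derivative (\<lambda>v. 0)) (at y)"
    by (rule has_derivative_transform_within_open[OF has_derivative_const S])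
      (simp add: alternating_mapD(2)[OF alt vs])
  then show "FD (\<lambda>z. a z vs) y v = 0" by (simp add: frechet_derivative_eq)
qed

lemma coord_ext_deriv_alternating:
  assumes S: "open S" "y \<in> S" and alt: "\<And>z. z \<in> S \<Longrightarrow> alternating_map (a z)"
    and a: "\<And>ws. smooth_on S (\<lambda>z. a z ws)"
  shows "alternating_map (coord_ext_deriv a y)"
  unfolding coord_ext_deriv_def[abs_def]
proof (rule alternating_map_antisymmetrization[where T = "\<lambda>v ws. FD (\<lambda>z. a z ws) y v"])
  show "alternating_map (\<lambda>ws. FD (\<lambda>z. a z ws) y v)" for v
    by (rule alternating_map_derivative[OF S alt a])
  have l: "linear (FD (\<lambda>z. a z ws) y)" for ws
    by (rule linear_frechet_derivative[OF smooth_on_differentiable[OF a S(2)]])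
  show "FD (\<lambda>z. a z ws) y (p *\<^sub>R v + q *\<^sub>R w) =
     p * FD (\<lambda>z. a z ws) y v + q * FD (\<lambda>z. a z ws) y w" for p v q w ws
    by (simp add: linear_add[OF l] linear_scale[OF l])
qed

lemma coord_ext_deriv_smooth:
  assumes "open S" "\<And>ws. smooth_on S (\<lambda>z. a z ws)"
  shows "smooth_on S (\<lambda>y. coord_ext_deriv a y ws)"
  unfolding coord_ext_deriv_def
  by (intro smooth_on_sum smooth_on_mult smooth_on_const smooth_on_frechet_derivative assms) auto

lemma coord_ext_deriv_twice:
  assumes S: "open S" "y \<in> S" and a: "\<And>ws. smooth_on S (\<lambda>z. a z ws)"
  shows "coord_ext_deriv (coord_ext_deriv a) y ws = 0"
proof -
  let ?Q = "\<lambda>u v zs. FD (\<lambda>z. FD (\<lambda>z. a z zs) z v) y u"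
  have d: "((\<lambda>z. coord_ext_deriv a z zs) has_derivative
      (\<lambda>u. \<Sum>j<length zs. (-1) ^ j * ?Q u (zs ! j) (omit j zs))) (at y)" for zs
    unfolding coord_ext_deriv_def
    by (intro has_derivative_sum has_derivative_mult_right
        smooth_on_has_derivative[OF smooth_on_frechet_derivative[OF a] S(2)])
  have "coord_ext_deriv (coord_ext_deriv a) y ws = (\<Sum>i<length ws. (-1) ^ i *
      (\<Sum>j<length (omit i ws). (-1) ^ j * ?Q (ws ! i) (omit i ws ! j) (omit j (omit i ws))))"
    unfolding coord_ext_deriv_def[of "coord_ext_deriv a"] frechet_derivative_eq[OF d] ..
  also have "\<dots> = 0"
    by (rule double_omit_sum_zero) (rule smooth_on_symmetric[OF finite_dimensional_real S a])
  finally show ?thesis .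
qed

section \<open>Atlases and smooth maps\<close>

text \<open>Charts are pairs; quantifiers over them should not be split.\<close>

declare split_paired_All [simp del] split_paired_Ex [simp del]

text \<open>A smooth manifold without the separation and countability axioms, which are not needed for
  the local calculus and would have to be checked for products.\<close>

definition smooth_atlas :: "('m, 'e::real_normed_vector) manifold \<Rightarrow> bool" where
  "smooth_atlas M \<longleftrightarrow>
     finite_dimensional TYPE('e) \<and>
     (\<Union>c\<in>atlas M. fst c) = carr M \<and>
     (\<forall>c\<in>atlas M. openin (mtop M) (fst c) \<and> inj_on (snd c) (fst c) \<and>
        (\<forall>W. openin (mtop M) W \<longrightarrow> open (snd c ` (fst c \<inter> W)))) \<and>
     (\<forall>c\<in>atlas M. \<forall>c'\<in>atlas M. smooth_on (snd c ` (fst c \<inter> fst c')) (snd c' \<circ> chart_inv c))"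

lemma smooth_manifold_imp_smooth_atlas:
  assumes "smooth_manifold M" shows "smooth_atlas M"
proof -
  have "inj_on (snd c) (fst c) \<and> (\<forall>W. openin (mtop M) W \<longrightarrow> open (snd c ` (fst c \<inter> W)))"
    if c: "c \<in> atlas M" for c
  proof -
    have op: "openin (mtop M) (fst c)" "open (snd c ` fst c)"
      and h: "homeomorphic_map (subtopology (mtop M) (fst c)) (top_of_set (snd c ` fst c)) (snd c)"
      using assms c by (auto simp: smooth_manifold_def)
    have "topspace (subtopology (mtop M) (fst c)) = fst c"
      using openin_subset[OF op(1)] by auto
    then have "inj_on (snd c) (fst c)" using h by (simp add: homeomorphic_map_def)
    moreover have "open (snd c ` (fst c \<inter> W))" if "openin (mtop M) W" for W
    proof -
      have "openin (subtopology (mtop M) (fst c)) (fst c \<inter> W)"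
        using that by (simp add: openin_subtopology_Int2)
      then have "openin (top_of_set (snd c ` fst c)) (snd c ` (fst c \<inter> W))"
        using homeomorphic_imp_open_map[OF h] by (auto simp: open_map_def)
      then show ?thesis using op(2) openin_open_eq by blast
    qed
    ultimately show ?thesis by blast
  qed
  then show ?thesis using assms by (auto simp: smooth_manifold_def smooth_atlas_def)
qed

lemma smooth_atlas_finite_dimensional:
  "smooth_atlas (M :: ('m, 'e::real_normed_vector) manifold) \<Longrightarrow> finite_dimensional TYPE('e)"
  by (simp add: smooth_atlas_def)

lemma charts_at_atlas: "c \<in> charts_at M x \<longleftrightarrow> c \<in> atlas M \<and> x \<in> fst c"
  by (simp add: charts_at_def)

lemma charts_at_nonempty: "smooth_atlas M \<Longrightarrow> x \<in> carr M \<Longrightarrow> \<exists>c. c \<in> charts_at M x"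
  by (auto simp: smooth_atlas_def charts_at_def)

lemma charts_at_carr: "smooth_atlas M \<Longrightarrow> c \<in> charts_at M x \<Longrightarrow> x \<in> carr M"
  by (auto simp: smooth_atlas_def charts_at_def)

lemma some_chart: "smooth_atlas M \<Longrightarrow> x \<in> carr M \<Longrightarrow> some_chart M x \<in> charts_at M x"
  unfolding some_chart_def using charts_at_nonempty by (metis someI_ex)

lemma chart_inv_chart:
  "smooth_atlas M \<Longrightarrow> c \<in> charts_at M x \<Longrightarrow> chart_inv c (snd c x) = x"
  by (simp add: smooth_atlas_def charts_at_def chart_inv_def inv_into_f_f)

lemma chart_inv_in: "y \<in> snd c ` fst c \<Longrightarrow> chart_inv c y \<in> fst c"
  by (simp add: chart_inv_def inv_into_into)

lemma chart_chart_inv: "y \<in> snd c ` fst c \<Longrightarrow> snd c (chart_inv c y) = y"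
  by (simp add: chart_inv_def f_inv_into_f)

lemma chart_inv_charts_at: "c \<in> atlas M \<Longrightarrow> y \<in> snd c ` fst c \<Longrightarrow> c \<in> charts_at M (chart_inv c y)"
  by (simp add: charts_at_def chart_inv_in)

lemma open_chart_image:
  "smooth_atlas M \<Longrightarrow> c \<in> atlas M \<Longrightarrow> openin (mtop M) W \<Longrightarrow> open (snd c ` (fst c \<inter> W))"
  by (simp add: smooth_atlas_def)

lemma openin_chart_domain: "smooth_atlas M \<Longrightarrow> c \<in> atlas M \<Longrightarrow> openin (mtop M) (fst c)"
  by (simp add: smooth_atlas_def)

lemma open_chart_range: "smooth_atlas M \<Longrightarrow> c \<in> atlas M \<Longrightarrow> open (snd c ` fst c)"
  using open_chart_image[OF _ _ openin_chart_domain, of M c c] by simp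

section \<open>Smooth maps in coordinates\<close>

definition coord_rep ::
  "('m, 'e) chart \<Rightarrow> ('n, 'f) chart \<Rightarrow> ('m \<Rightarrow> 'n) \<Rightarrow> 'e \<Rightarrow> 'f" where
  "coord_rep c c' f = snd c' \<circ> f \<circ> chart_inv c"

definition rep_domain :: "('m, 'e) chart \<Rightarrow> ('n, 'f) chart \<Rightarrow> ('m \<Rightarrow> 'n) \<Rightarrow> 'e set" where
  "rep_domain c c' f = snd c ` {x \<in> fst c. f x \<in> fst c'}"

lemma rep_domain_chart_inv:
  assumes "y \<in> rep_domain c c' f" "smooth_atlas M" "c \<in> atlas M"
  shows "y \<in> snd c ` fst c" "chart_inv c y \<in> fst c" "f (chart_inv c y) \<in> fst c'"
  using assms chart_inv_chart[of M c] by (auto simp: rep_domain_def charts_at_def)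

lemma open_rep_domain:
  assumes "smooth_atlas M" "smooth_atlas N" "continuous_map (mtop M) (mtop N) f" "c \<in> atlas M" "c' \<in> atlas N"
  shows "open (rep_domain c c' f)"
proof -
  have "openin (mtop M) {x \<in> topspace (mtop M). f x \<in> fst c'}"
    using assms(3) openin_chart_domain[OF assms(2,5)] by (simp add: continuous_map)
  then have "open (snd c ` (fst c \<inter> {x \<in> topspace (mtop M). f x \<in> fst c'}))"
    by (rule open_chart_image[OF assms(1,4)])
  moreover have "{x \<in> fst c. f x \<in> fst c'} = fst c \<inter> {x \<in> topspace (mtop M). f x \<in> fst c'}"
    using openin_subset[OF openin_chart_domain[OF assms(1,4)]] by auto
  ultimately show ?thesis unfolding rep_domain_def by (simp only:)
qed

lemma smooth_map_continuous: "smooth_map M N f \<Longrightarrow> continuous_map (mtop M) (mtop N) f"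
  by (simp add: smooth_map_def)

lemma smooth_map_carr: "smooth_map M N f \<Longrightarrow> x \<in> carr M \<Longrightarrow> f x \<in> carr N"
  by (auto simp: smooth_map_def carr_def continuous_map_def)

lemma smooth_map_rep:
  assumes "smooth_atlas M" "smooth_atlas N" "smooth_map M N f" "c \<in> atlas M" "c' \<in> atlas N"
  shows "open (rep_domain c c' f)" "smooth_on (rep_domain c c' f) (coord_rep c c' f)"
  using assms open_rep_domain[OF assms(1,2) _ assms(4,5)]
  by (simp_all add: smooth_map_def rep_domain_def coord_rep_def)

lemma in_rep_domain: "c \<in> charts_at M x \<Longrightarrow> c' \<in> charts_at N (f x) \<Longrightarrow> snd c x \<in> rep_domain c c' f"
  by (auto simp: charts_at_def rep_domain_def)

lemma coord_rep_compose:
  assumes "smooth_atlas N" "c' \<in> atlas N" "f (chart_inv c y) \<in> fst c'"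
  shows "coord_rep c c'' (g \<circ> f) y = coord_rep c' c'' g (coord_rep c c' f y)"
  using assms chart_inv_chart[of N c'] by (simp add: coord_rep_def charts_at_def)

lemma smooth_map_local:
  assumes "smooth_atlas M" "smooth_atlas N" "continuous_map (mtop M) (mtop N) f"
    and "\<And>c c' x. c \<in> charts_at M x \<Longrightarrow> c' \<in> charts_at N (f x) \<Longrightarrow>
       \<exists>T. open T \<and> snd c x \<in> T \<and> smooth_on T (coord_rep c c' f)"
  shows "smooth_map M N f"
  unfolding smooth_map_def
proof (intro conjI ballI)
  fix c c' assume c: "c \<in> atlas M" "c' \<in> atlas N"
  show "smooth_on (snd c ` {x \<in> fst c. f x \<in> fst c'}) (snd c' \<circ> f \<circ> chart_inv c)"
  proof (rule smooth_on_local)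
    fix y assume "y \<in> snd c ` {x \<in> fst c. f x \<in> fst c'}"
    then obtain x where x: "x \<in> fst c" "f x \<in> fst c'" "y = snd c x" by blast
    show "\<exists>T. open T \<and> y \<in> T \<and> smooth_on T (snd c' \<circ> f \<circ> chart_inv c)"
      using assms(4)[of c x c'] c x by (simp add: charts_at_def coord_rep_def)
  qed
qed (rule assms(3))

text \<open>A chart of \<open>N\<close> around \<open>f x\<close> must be inserted between
  \<open>c\<close> and \<open>c''\<close>, and the composite of the two representations is available
  only near \<open>x\<close>; hence the detour through \<open>smooth_map_local\<close>.\<close>

lemma smooth_map_compose:
  assumes "smooth_atlas M" "smooth_atlas N" "smooth_atlas P" "smooth_map M N f" "smooth_map N P g"
  shows "smooth_map M P (g \<circ> f)"
proof (rule smooth_map_local[OF assms(1,3)])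
  show "continuous_map (mtop M) (mtop P) (g \<circ> f)"
    by (rule continuous_map_compose[OF smooth_map_continuous[OF assms(4)] smooth_map_continuous[OF assms(5)]])
  fix c c'' x assume c: "c \<in> charts_at M x" and c'': "c'' \<in> charts_at P ((g \<circ> f) x)"
  have "f x \<in> carr N" by (rule smooth_map_carr[OF assms(4) charts_at_carr[OF assms(1) c]])
  then obtain c' where c': "c' \<in> charts_at N (f x)" using charts_at_nonempty[OF assms(2)] by blast
  let ?S = "rep_domain c c' f" and ?T = "rep_domain c' c'' g"
  note cs = c[unfolded charts_at_atlas] c'[unfolded charts_at_atlas] c''[unfolded charts_at_atlas]
  have S: "open ?S" "smooth_on ?S (coord_rep c c' f)"
    using smooth_map_rep[OF assms(1,2,4)] cs by auto
  have T: "open ?T" "smooth_on ?T (coord_rep c' c'' g)"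
    using smooth_map_rep[OF assms(2,3,5)] cs by auto
  have "continuous_on ?S (coord_rep c c' f)" using S(2) by (auto simp: smooth_on_def dest: spec[of _ 0])
  then have op: "open (coord_rep c c' f -` ?T \<inter> ?S)" (is "open ?W")
    using S(1) T(1) continuous_on_open_vimage by blast
  have "smooth_on ?W (\<lambda>y. coord_rep c' c'' g (coord_rep c c' f y))"
    by (rule smooth_on_compose[OF smooth_atlas_finite_dimensional[OF assms(2)] op T(1) _ smooth_on_subset[OF S(2)] T(2)])
      auto
  moreover have "coord_rep c' c'' g (coord_rep c c' f y) = coord_rep c c'' (g \<circ> f) y" if "y \<in> ?W" for y
    using coord_rep_compose[OF assms(2), of c' f c y c'' g] rep_domain_chart_inv[OF _ assms(1), of y c c' f] that cs by simp
  ultimately have "smooth_on ?W (coord_rep c c'' (g \<circ> f))" by (rule smooth_on_cong[OF op, rotated])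
  moreover have "snd c x \<in> ?W"
    using in_rep_domain[where f = f, OF c c'] in_rep_domain[where f = g, OF c', of c'' P] c'' chart_inv_chart[OF assms(1) c]
    by (simp add: coord_rep_def)
  ultimately show "\<exists>T. open T \<and> snd c x \<in> T \<and> smooth_on T (coord_rep c c'' (g \<circ> f))" using op by blast
qed

lemma smooth_map_id: "smooth_atlas M \<Longrightarrow> smooth_map M M (\<lambda>x. x)"
  unfolding smooth_map_def smooth_atlas_def by (auto simp: o_def Int_def)

lemma smooth_map_cong:
  assumes "smooth_atlas M" "smooth_atlas N" "smooth_map M N f" "\<And>x. x \<in> carr M \<Longrightarrow> f x = g x"
  shows "smooth_map M N g"
  unfolding smooth_map_def
proof (intro conjI ballI)
  show cont: "continuous_map (mtop M) (mtop N) g"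
    by (rule continuous_map_eq[OF smooth_map_continuous[OF assms(3)]]) (simp add: assms(4) carr_def)
  fix c c' assume c: "c \<in> atlas M" "c' \<in> atlas N"
  have sub: "fst c \<subseteq> carr M" using assms(1) c by (auto simp: smooth_atlas_def)
  have d: "rep_domain c c' g = rep_domain c c' f"
    unfolding rep_domain_def using sub assms(4) by (intro image_cong) auto
  have "smooth_on (rep_domain c c' f) (coord_rep c c' g)"
    by (rule smooth_on_cong[OF smooth_map_rep(1)[OF assms(1-3) c]
          _ smooth_map_rep(2)[OF assms(1-3) c]])
      (simp add: coord_rep_def assms(4) subsetD[OF sub rep_domain_chart_inv(2)[where f = f, OF _ assms(1) c(1)]])
  then show "smooth_on (snd c ` {x \<in> fst c. g x \<in> fst c'}) (snd c' \<circ> g \<circ> chart_inv c)"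
    by (simp add: d[symmetric]) (simp add: rep_domain_def coord_rep_def)
qed

subsection \<open>Smooth functions\<close>

lemma smooth_funD: "smooth_fun M f \<Longrightarrow> c \<in> atlas M \<Longrightarrow> smooth_on (snd c ` fst c) (\<lambda>y. f (chart_inv c y))"
  by (simp add: smooth_fun_def o_def)

lemma smooth_fun_compose:
  assumes "smooth_atlas M" "smooth_atlas N" "smooth_map M N f" "smooth_fun N g"
  shows "smooth_fun M (g \<circ> f)"
  unfolding smooth_fun_def
proof (intro ballI smooth_on_local)
  fix c y assume c: "c \<in> atlas M" and y: "y \<in> snd c ` fst c"
  then have "f (chart_inv c y) \<in> carr N"
    by (intro smooth_map_carr[OF assms(3)] charts_at_carr[OF assms(1) chart_inv_charts_at])
  then obtain c' where c': "c' \<in> charts_at N (f (chart_inv c y))" using charts_at_nonempty[OF assms(2)] by blast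
  then have c'A: "c' \<in> atlas N" by (simp add: charts_at_def)
  let ?S = "rep_domain c c' f"
  note S = smooth_map_rep[OF assms(1-3) c c'A]
  have "y \<in> ?S" unfolding rep_domain_def
    using chart_inv_in[OF y] chart_chart_inv[OF y] c' by (intro image_eqI[of _ _ "chart_inv c y"]) (auto simp: charts_at_def)
  moreover have "smooth_on ?S (\<lambda>y. g (chart_inv c' (coord_rep c c' f y)))"
    by (rule smooth_on_compose[OF smooth_atlas_finite_dimensional[OF assms(2)] S(1)
          open_chart_range[OF assms(2) c'A] _ S(2) smooth_funD[OF assms(4) c'A]])
      (auto simp: coord_rep_def rep_domain_chart_inv(3)[where f = f, OF _ assms(1) c])
  then have "smooth_on ?S (g \<circ> f \<circ> chart_inv c)"
    by (rule smooth_on_cong[OF S(1), rotated])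
      (simp add: coord_rep_def charts_at_def c'A chart_inv_chart[OF assms(2)]
        rep_domain_chart_inv(3)[where f = f, OF _ assms(1) c])
  ultimately show "\<exists>T. open T \<and> y \<in> T \<and> smooth_on T (g \<circ> f \<circ> chart_inv c)" using S(1) by blast
qed

lemma smooth_fun_add: "smooth_atlas M \<Longrightarrow> smooth_fun M f \<Longrightarrow> smooth_fun M g \<Longrightarrow> smooth_fun M (\<lambda>x. f x + g x)"
  unfolding smooth_fun_def o_def by (auto intro: smooth_on_add open_chart_range)

lemma smooth_fun_const: "smooth_fun M (\<lambda>x. a)"
  unfolding smooth_fun_def o_def by (auto intro: smooth_on_const)

lemma smooth_fun_exp: "smooth_atlas M \<Longrightarrow> smooth_fun M f \<Longrightarrow> smooth_fun M (\<lambda>x. exp (f x))"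
  unfolding smooth_fun_def o_def by (auto intro: smooth_on_exp open_chart_range)

lemma smooth_fun_scale: "smooth_atlas M \<Longrightarrow> smooth_fun M f \<Longrightarrow> smooth_fun M (\<lambda>x. a * f x)"
  unfolding smooth_fun_def o_def by (auto intro: smooth_on_mult open_chart_range smooth_on_const)

lemma smooth_fun_cong:
  assumes "smooth_atlas M" "smooth_fun M f" "\<And>x. x \<in> carr M \<Longrightarrow> f x = g x"
  shows "smooth_fun M g"
  unfolding smooth_fun_def o_def
proof
  fix c assume c: "c \<in> atlas M"
  show "smooth_on (snd c ` fst c) (\<lambda>y. g (chart_inv c y))"
    by (rule smooth_on_cong[OF open_chart_range[OF assms(1) c] _ smooth_funD[OF assms(2) c]])
      (use assms(3) charts_at_carr[OF assms(1) chart_inv_charts_at[OF c]] in auto)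
qed

subsection \<open>Open submanifolds and products with the line\<close>

lemma carr_open_submanifold: "carr (open_submanifold M V) = carr M \<inter> V"
  by (simp add: carr_def open_submanifold_def)

text \<open>\<open>chart_inv\<close> is an inverse relative to the chart domain, so shrinking the
  domain changes it as a function; agreement holds on the smaller image only.\<close>

lemma chart_inv_restrict:
  assumes "smooth_atlas M" "c \<in> atlas M" "y \<in> snd c ` (fst c \<inter> V)"
  shows "chart_inv (fst c \<inter> V, snd c) y = chart_inv c y"
proof -
  have inj: "inj_on (snd c) (fst c)" using assms by (simp add: smooth_atlas_def)
  obtain x where x: "x \<in> fst c \<inter> V" "y = snd c x" using assms(3) by blast
  have "inj_on (snd c) (fst c \<inter> V)" using inj by (rule inj_on_subset) auto
  then show ?thesis using x inj by (simp add: chart_inv_def inv_into_f_f)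
qed

lemma smooth_atlas_open_submanifold:
  assumes "smooth_atlas M" "openin (mtop M) V"
  shows "smooth_atlas (open_submanifold M V)"
proof -
  let ?r = "\<lambda>c. (fst c \<inter> V, snd c)"
  have "(\<Union>c\<in>atlas M. fst c \<inter> V) = carr M \<inter> V" using assms(1) by (auto simp: smooth_atlas_def)
  moreover have "openin (subtopology (mtop M) V) (fst c \<inter> V)" "inj_on (snd c) (fst c \<inter> V)"
    if "c \<in> atlas M" for c
    using assms(1) that by (auto simp: smooth_atlas_def openin_subtopology_Int intro: inj_on_subset)
  moreover have "open (snd c ` (fst c \<inter> V \<inter> W))" if "c \<in> atlas M" "openin (subtopology (mtop M) V) W" for c W
  proof -
    have "openin (mtop M) (V \<inter> W)"
      using that(2) assms(2) openin_open_subtopology[OF assms(2)] by (auto simp: openin_Int)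
    then show ?thesis using open_chart_image[OF assms(1) that(1)] by (simp add: Int_assoc)
  qed
  moreover have "smooth_on (snd c ` (fst c \<inter> V \<inter> (fst c' \<inter> V))) (snd c' \<circ> chart_inv (?r c))"
    if "c \<in> atlas M" "c' \<in> atlas M" for c c'
  proof (rule smooth_on_cong)
    have "openin (mtop M) (fst c' \<inter> V)" using assms openin_chart_domain that by blast
    then show "open (snd c ` (fst c \<inter> V \<inter> (fst c' \<inter> V)))"
      using open_chart_image[OF assms(1) that(1), of "fst c' \<inter> V"] by (simp add: Int_ac)
    have "smooth_on (snd c ` (fst c \<inter> fst c')) (snd c' \<circ> chart_inv c)"
      using assms(1) that by (simp add: smooth_atlas_def)
    then show "smooth_on (snd c ` (fst c \<inter> V \<inter> (fst c' \<inter> V))) (snd c' \<circ> chart_inv c)"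
      by (rule smooth_on_subset) auto
    show "(snd c' \<circ> chart_inv c) y = (snd c' \<circ> chart_inv (?r c)) y"
      if "y \<in> snd c ` (fst c \<inter> V \<inter> (fst c' \<inter> V))" for y
    proof -
      have "y \<in> snd c ` (fst c \<inter> V)" using that by auto
      then show ?thesis using chart_inv_restrict[OF assms(1) \<open>c \<in> atlas M\<close>] by simp
    qed
  qed
  ultimately show ?thesis
    using assms(1) unfolding smooth_atlas_def by (simp add: open_submanifold_def carr_def)
qed

lemma smooth_map_open_submanifold:
  assumes "smooth_atlas M" "smooth_atlas N" "openin (mtop M) V" "smooth_map M N f"
  shows "smooth_map (open_submanifold M V) N f"
  unfolding smooth_map_def
proof (intro conjI ballI)
  show cont: "continuous_map (mtop (open_submanifold M V)) (mtop N) f"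
    using assms(4) by (simp add: open_submanifold_def continuous_map_from_subtopology smooth_map_def)
  fix d c' assume d: "d \<in> atlas (open_submanifold M V)" and c': "c' \<in> atlas N"
  then obtain c where c: "c \<in> atlas M" and dc: "d = (fst c \<inter> V, snd c)" by (auto simp: open_submanifold_def)
  have op: "open (rep_domain d c' f)"
    by (rule open_rep_domain[OF smooth_atlas_open_submanifold[OF assms(1,3)] assms(2) cont d c'])
  have sub: "rep_domain d c' f \<subseteq> rep_domain c c' f" by (auto simp: rep_domain_def dc)
  have "smooth_on (rep_domain d c' f) (coord_rep d c' f)"
    by (rule smooth_on_cong[OF op _ smooth_on_subset[OF smooth_map_rep(2)[OF assms(1,2,4) c c'] sub]])
      (use chart_inv_restrict[OF assms(1) c] in \<open>auto simp: coord_rep_def rep_domain_def dc\<close>)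
  then show "smooth_on (snd d ` {x \<in> fst d. f x \<in> fst c'}) (snd c' \<circ> f \<circ> chart_inv d)"
    by (simp add: rep_domain_def coord_rep_def)
qed

section \<open>Charts of the product with the line\<close>

definition line_chart :: "('m, 'e) chart \<Rightarrow> ('m \<times> real, 'e \<times> real) chart" where
  "line_chart c = (fst c \<times> UNIV, \<lambda>(x, s). (snd c x, s))"

lemma atlas_times_line: "atlas (times_line M) = line_chart ` atlas M"
  by (simp add: times_line_def line_chart_def)

lemma carr_times_line: "carr (times_line M) = carr M \<times> UNIV"
  by (simp add: carr_def times_line_def)

lemma line_chart_simps:
  "fst (line_chart c) = fst c \<times> UNIV" "snd (line_chart c) p = (snd c (fst p), snd p)"
  by (auto simp: line_chart_def split: prod.splits)

lemma line_chart_image: "snd (line_chart c) ` (A \<times> UNIV) = snd c ` A \<times> UNIV"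
  by (force simp: line_chart_simps image_iff)

lemma charts_at_times_line: "line_chart c \<in> charts_at (times_line M) p" if "c \<in> charts_at M (fst p)"
  using that by (cases p) (simp add: charts_at_def atlas_times_line line_chart_simps)

lemma charts_at_times_lineE:
  assumes "d \<in> charts_at (times_line M) p"
  obtains c where "d = line_chart c" "c \<in> charts_at M (fst p)"
  using assms by (cases p) (auto simp: charts_at_def atlas_times_line line_chart_simps)

lemma inj_on_line_chart: "inj_on (snd c) (fst c) \<Longrightarrow> inj_on (snd (line_chart c)) (fst (line_chart c))"
  by (auto simp: inj_on_def line_chart_simps)

lemma chart_inv_line_chart:
  assumes "smooth_atlas M" "c \<in> atlas M" "fst q \<in> snd c ` fst c"
  shows "chart_inv (line_chart c) q = (chart_inv c (fst q), snd q)"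
proof -
  have inj: "inj_on (snd (line_chart c)) (fst (line_chart c))"
    using assms(1,2) by (intro inj_on_line_chart) (simp add: smooth_atlas_def)
  have "chart_inv (line_chart c) (snd (line_chart c) (chart_inv c (fst q), snd q)) = (chart_inv c (fst q), snd q)"
    unfolding chart_inv_def[of "line_chart c"]
    by (rule inv_into_f_f[OF inj]) (simp add: line_chart_simps chart_inv_in[OF assms(3)])
  then show ?thesis by (simp add: line_chart_simps chart_chart_inv[OF assms(3)])
qed

lemma smooth_atlas_times_line:
  fixes M :: "('m, 'e::real_normed_vector) manifold"
  assumes M: "smooth_atlas M"
  shows "smooth_atlas (times_line M)"
  unfolding smooth_atlas_def
proof (intro conjI ballI allI impI)
  show "finite_dimensional TYPE('e \<times> real)"
    using smooth_atlas_finite_dimensional[OF M] finite_dimensional_real by (rule finite_dimensional_prod)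
  show "(\<Union>c\<in>atlas (times_line M). fst c) = carr (times_line M)"
    using M by (auto simp: smooth_atlas_def carr_times_line atlas_times_line line_chart_simps)
  fix d assume "d \<in> atlas (times_line M)"
  then obtain c where c: "c \<in> atlas M" and d: "d = line_chart c" by (auto simp: atlas_times_line)
  have top: "mtop (times_line M) = prod_topology (mtop M) euclideanreal" by (simp add: times_line_def)
  show "openin (mtop (times_line M)) (fst d)"
    using openin_chart_domain[OF M c] by (simp add: top d line_chart_simps openin_prod_Times_iff)
  show "inj_on (snd d) (fst d)"
    using M c unfolding d by (intro inj_on_line_chart) (simp add: smooth_atlas_def)
  show "open (snd d ` (fst d \<inter> W))" if W: "openin (mtop (times_line M)) W" for W
    unfolding open_prod_def
  proof
    fix q assume "q \<in> snd d ` (fst d \<inter> W)"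
    then obtain x s where x: "x \<in> fst c" "(x, s) \<in> W" "q = (snd c x, s)"
      by (auto simp: d line_chart_simps)
    have "\<exists>A B. openin (mtop M) A \<and> openin euclideanreal B \<and> x \<in> A \<and> s \<in> B \<and> A \<times> B \<subseteq> W"
      using W x(2) unfolding top openin_prod_topology_alt by blast
    then obtain A B where AB: "openin (mtop M) A" "open B" "x \<in> A" "s \<in> B" "A \<times> B \<subseteq> W"
      by (auto simp only: open_openin)
    have "snd c ` (fst c \<inter> A) \<times> B \<subseteq> snd d ` (fst d \<inter> W)"
    proof
      fix r assume "r \<in> snd c ` (fst c \<inter> A) \<times> B"
      then obtain z where "z \<in> fst c" "z \<in> A" "r = (snd c z, snd r)" "snd r \<in> B" by auto
      then show "r \<in> snd d ` (fst d \<inter> W)"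
        using AB(5) by (intro image_eqI[of _ _ "(z, snd r)"]) (auto simp: d line_chart_simps)
    qed
    moreover have "q \<in> snd c ` (fst c \<inter> A) \<times> B" using x AB by auto
    ultimately show "\<exists>A B. open A \<and> open B \<and> q \<in> A \<times> B \<and> A \<times> B \<subseteq> snd d ` (fst d \<inter> W)"
      using open_chart_image[OF M c AB(1)] AB(2) by blast
  qed
  fix d' assume "d' \<in> atlas (times_line M)"
  then obtain c' where c': "c' \<in> atlas M" and d': "d' = line_chart c'" by (auto simp: atlas_times_line)
  let ?S = "snd c ` (fst c \<inter> fst c')"
  have im: "snd d ` (fst d \<inter> fst d') = ?S \<times> UNIV"
    by (simp add: d d' line_chart_simps(1) Times_Int_Times line_chart_image)
  have S: "open ?S" "smooth_on ?S (snd c' \<circ> chart_inv c)"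
    using open_chart_image[OF M c openin_chart_domain[OF M c']] M c c' by (auto simp: smooth_atlas_def)
  have opS: "open (?S \<times> (UNIV :: real set))" using S(1) by (intro open_Times) auto
  have "smooth_on (?S \<times> (UNIV :: real set)) (\<lambda>q. ((snd c' \<circ> chart_inv c) (fst q), snd q))"
    by (rule smooth_on_Pair[OF opS smooth_on_compose[where f = fst, OF smooth_atlas_finite_dimensional[OF M] opS S(1) _
            smooth_on_linear[OF bounded_linear_fst] S(2)] smooth_on_linear[OF bounded_linear_snd]]) auto
  then show "smooth_on (snd d ` (fst d \<inter> fst d')) (snd d' \<circ> chart_inv d)"
    unfolding im
  proof (rule smooth_on_cong[OF opS, rotated])
    fix q assume q: "q \<in> ?S \<times> (UNIV :: real set)"
    then have "fst q \<in> snd c ` fst c" by auto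
    then show "((snd c' \<circ> chart_inv c) (fst q), snd q) = (snd d' \<circ> chart_inv d) q"
      by (simp add: d d' chart_inv_line_chart[OF M c] line_chart_simps)
  qed
qed

lemma smooth_map_fst:
  assumes M: "smooth_atlas M"
  shows "smooth_map (times_line M) M fst"
proof (rule smooth_map_local[OF smooth_atlas_times_line[OF M] M])
  show "continuous_map (mtop (times_line M)) (mtop M) fst"
    by (simp add: times_line_def continuous_map_fst)
  fix d c' p assume d: "d \<in> charts_at (times_line M) p" and c': "c' \<in> charts_at M (fst p)"
  obtain c where c: "c \<in> charts_at M (fst p)" and dc: "d = line_chart c"
    using d by (rule charts_at_times_lineE)
  let ?S = "rep_domain c c' (\<lambda>x. x)"
  have cA: "c \<in> atlas M" "c' \<in> atlas M" using c c' by (auto simp: charts_at_def)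
  note S = smooth_map_rep[OF M M smooth_map_id[OF M] cA]
  have opS: "open (?S \<times> (UNIV :: real set))" using S(1) by (intro open_Times) auto
  have "smooth_on (?S \<times> (UNIV :: real set)) (\<lambda>q. coord_rep c c' (\<lambda>x. x) (fst q))"
    by (rule smooth_on_compose[where f = fst, OF smooth_atlas_finite_dimensional[OF M] opS S(1) _
          smooth_on_linear[OF bounded_linear_fst] S(2)]) auto
  then have "smooth_on (?S \<times> (UNIV :: real set)) (coord_rep d c' fst)"
  proof (rule smooth_on_cong[OF opS, rotated])
    fix q assume "q \<in> ?S \<times> (UNIV :: real set)"
    then have "fst q \<in> snd c ` fst c" by (auto simp: rep_domain_def)
    then show "coord_rep c c' (\<lambda>x. x) (fst q) = coord_rep d c' fst q"
      by (simp add: coord_rep_def dc chart_inv_line_chart[OF M cA(1)])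
  qed
  moreover have "snd d p \<in> ?S \<times> UNIV"
    using in_rep_domain[where f = "\<lambda>x. x", OF c, of c' M] c' by (simp add: dc line_chart_simps)
  ultimately show "\<exists>T. open T \<and> snd d p \<in> T \<and> smooth_on T (coord_rep d c' fst)"
    using opS by (intro exI[of _ "?S \<times> (UNIV :: real set)"]) simp
qed

lemma smooth_fun_snd:
  assumes M: "smooth_atlas M"
  shows "smooth_fun (times_line M) snd"
  unfolding smooth_fun_def
proof
  fix d assume d: "d \<in> atlas (times_line M)"
  then obtain c where c: "c \<in> atlas M" and dc: "d = line_chart c" by (auto simp: atlas_times_line)
  show "smooth_on (snd d ` fst d) (snd \<circ> chart_inv d)"
    by (rule smooth_on_cong[OF open_chart_range[OF smooth_atlas_times_line[OF M] d] _
          smooth_on_linear[OF bounded_linear_snd]])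
      (auto simp: dc line_chart_simps chart_inv_line_chart[OF M c])
qed

text \<open>Charts in a \<open>smooth_atlas\<close> are recorded as injective and open, not as
  continuous, so continuity of \<open>r\<close> does not come with \<open>smooth_fun\<close> and is
  asked separately.\<close>

lemma smooth_map_Pair:
  assumes M: "smooth_atlas M" and N: "smooth_atlas N" and h: "smooth_map M N h"
    and r: "smooth_fun M r" "continuous_map (mtop M) euclideanreal r"
  shows "smooth_map M (times_line N) (\<lambda>x. (h x, r x))"
proof (rule smooth_map_local[OF M smooth_atlas_times_line[OF N]])
  show "continuous_map (mtop M) (mtop (times_line N)) (\<lambda>x. (h x, r x))"
    using smooth_map_continuous[OF h] r(2) by (simp add: times_line_def continuous_map_paired)
  fix c d x assume c: "c \<in> charts_at M x" and d: "d \<in> charts_at (times_line N) (h x, r x)"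
  obtain c' where c': "c' \<in> charts_at N (h x)" and dc: "d = line_chart c'"
    using d by (rule charts_at_times_lineE) simp
  let ?S = "rep_domain c c' h"
  have cA: "c \<in> atlas M" "c' \<in> atlas N" using c c' by (auto simp: charts_at_def)
  note S = smooth_map_rep[OF M N h cA]
  have "?S \<subseteq> snd c ` fst c" by (auto simp: rep_domain_def)
  then have "smooth_on ?S (\<lambda>y. (coord_rep c c' h y, r (chart_inv c y)))"
    by (intro smooth_on_Pair S smooth_on_subset[OF smooth_funD[OF r(1) cA(1)]])
  then have "smooth_on ?S (coord_rep c d (\<lambda>x. (h x, r x)))"
    by (simp add: coord_rep_def dc line_chart_simps o_def)
  then show "\<exists>T. open T \<and> snd c x \<in> T \<and> smooth_on T (coord_rep c d (\<lambda>x. (h x, r x)))"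
    using S(1) in_rep_domain[where f = h, OF c c'] by blast
qed

section \<open>Tangent maps\<close>

lemma coord_rep_has_derivative:
  assumes "smooth_atlas M" "smooth_atlas N" "smooth_map M N f" "c \<in> charts_at M x" "c' \<in> charts_at N (f x)"
  shows "(coord_rep c c' f has_derivative FD (coord_rep c c' f) (snd c x)) (at (snd c x))"
  using smooth_on_has_derivative[OF smooth_map_rep(2)[OF assms(1-3)] in_rep_domain[where f = f, OF assms(4,5)]]
    assms(4,5) by (simp add: charts_at_def)

lemma coord_rep_chain:
  assumes "smooth_atlas M" "smooth_atlas N" "smooth_atlas P" "smooth_map M N f" "smooth_map N P g"
    and c: "c \<in> charts_at M x" "c' \<in> charts_at N (f x)" "c'' \<in> charts_at P (g (f x))"
  shows "FD (coord_rep c c'' (g \<circ> f)) (snd c x) w =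
    FD (coord_rep c' c'' g) (snd c' (f x)) (FD (coord_rep c c' f) (snd c x) w)"
proof -
  have cA: "c \<in> atlas M" "c' \<in> atlas N" "c'' \<in> atlas P" using c by (auto simp: charts_at_def)
  have fx: "coord_rep c c' f (snd c x) = snd c' (f x)"
    using chart_inv_chart[OF assms(1) c(1)] by (simp add: coord_rep_def)
  have "((\<lambda>y. coord_rep c' c'' g (coord_rep c c' f y)) has_derivative
     (\<lambda>w. FD (coord_rep c' c'' g) (snd c' (f x)) (FD (coord_rep c c' f) (snd c x) w)))
     (at (snd c x))"
    by (rule has_derivative_compose[where f = "coord_rep c c' f" and g = "coord_rep c' c'' g",
          OF coord_rep_has_derivative[OF assms(1,2,4) c(1,2)]])
      (use coord_rep_has_derivative[OF assms(2,3,5) c(2,3)] fx in simp)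
  then have "(coord_rep c c'' (g \<circ> f) has_derivative
     (\<lambda>w. FD (coord_rep c' c'' g) (snd c' (f x)) (FD (coord_rep c c' f) (snd c x) w)))
     (at (snd c x))"
    by (rule has_derivative_transform_within_open[OF _ smooth_map_rep(1)[OF assms(1,2,4) cA(1,2)] in_rep_domain[where f = f, OF c(1,2)]])
      (simp only: coord_rep_compose[where f = f and g = g, OF assms(2) cA(2)
          rep_domain_chart_inv(3)[where f = f, OF _ assms(1) cA(1)]])
  then show ?thesis by (simp add: frechet_derivative_eq)
qed

lemma coord_rep_id_self:
  assumes "smooth_atlas M" "c \<in> charts_at M x"
  shows "FD (coord_rep c c (\<lambda>x. x)) (snd c x) w = w"
proof -
  have cA: "c \<in> atlas M" using assms(2) by (simp add: charts_at_def)
  have "(coord_rep c c (\<lambda>x. x) has_derivative (\<lambda>w. w)) (at (snd c x))"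
    by (rule has_derivative_transform_within_open[OF has_derivative_ident open_chart_range[OF assms(1) cA]])
      (use assms(2) in \<open>auto simp: charts_at_def coord_rep_def chart_chart_inv\<close>)
  then show ?thesis by (simp add: frechet_derivative_eq)
qed

lemma coord_rep_linear:
  assumes "smooth_atlas M" "smooth_atlas N" "smooth_map M N f" "c \<in> charts_at M x" "c' \<in> charts_at N (f x)"
  shows "linear (FD (coord_rep c c' f) (snd c x))"
  using coord_rep_has_derivative[OF assms] by (rule has_derivative_linear)

lemma transition_eq: "snd c' \<circ> chart_inv c = coord_rep c c' (\<lambda>x. x)"
  by (simp add: coord_rep_def o_def)

lemma tangent_spaceD:
  assumes "v \<in> tangent_space M x" "c \<in> charts_at M x" "c' \<in> charts_at M x"
  shows "v c' = FD (coord_rep c c' (\<lambda>x. x)) (snd c x) (v c)"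
  using assms unfolding tangent_space_def transition_eq by blast

lemma tangent_space_outside: "v \<in> tangent_space M x \<Longrightarrow> c \<notin> charts_at M x \<Longrightarrow> v c = 0"
  by (simp add: tangent_space_def)

lemma tangent_eqI:
  assumes "v \<in> tangent_space M x" "w \<in> tangent_space M x" "c \<in> charts_at M x" "v c = w c"
  shows "v = w"
proof
  fix c' show "v c' = w c'"
  proof (cases "c' \<in> charts_at M x")
    case True
    then show ?thesis
      using tangent_spaceD[OF assms(1,3) True] tangent_spaceD[OF assms(2,3) True] assms(4) by metis
  qed (use assms(1,2) tangent_space_outside in metis)
qed

lemma tangent_space_combination:
  assumes "smooth_atlas M" "v \<in> tangent_space M x" "w \<in> tangent_space M x"
  shows "(\<lambda>c. a *\<^sub>R v c + b *\<^sub>R w c) \<in> tangent_space M x"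
  unfolding tangent_space_def transition_eq
proof (intro CollectI conjI ballI allI impI)
  fix c c' assume c: "c \<in> charts_at M x" "c' \<in> charts_at M x"
  have l: "linear (FD (coord_rep c c' (\<lambda>x. x)) (snd c x))"
    using coord_rep_linear[OF assms(1,1) smooth_map_id[OF assms(1)] c(1)] c(2) by blast
  show "a *\<^sub>R v c' + b *\<^sub>R w c' = FD (coord_rep c c' (\<lambda>x. x)) (snd c x) (a *\<^sub>R v c + b *\<^sub>R w c)"
    using tangent_spaceD[OF assms(2) c] tangent_spaceD[OF assms(3) c]
    by (simp add: linear_add[OF l] linear_scale[OF l])
qed (simp add: tangent_space_outside[OF assms(2)] tangent_space_outside[OF assms(3)])

lemma tangent_space_zero:
  assumes "smooth_atlas M" shows "(\<lambda>c. 0) \<in> tangent_space M x"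
  unfolding tangent_space_def transition_eq
proof (intro CollectI conjI ballI allI impI)
  fix c c' assume c: "c \<in> charts_at M x" "c' \<in> charts_at M x"
  have l: "linear (FD (coord_rep c c' (\<lambda>x. x)) (snd c x))"
    using coord_rep_linear[OF assms(1,1) smooth_map_id[OF assms(1)] c(1)] c(2) by blast
  show "0 = FD (coord_rep c c' (\<lambda>x. x)) (snd c x) 0"
    by (simp add: linear_0[OF l])
qed simp

lemma tmap_eq:
  "tmap M N f x v = (\<lambda>c'. if c' \<in> charts_at N (f x)
     then FD (coord_rep (some_chart M x) c' f) (snd (some_chart M x) x) (v (some_chart M x))
     else 0)"
  unfolding tmap_def coord_rep_def ..

text \<open>Independence of the chart chosen in \<open>tmap\<close>: insert the transition from
  \<open>c\<close> to the chosen chart and use that the coordinates of \<open>v\<close> are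
  compatible with it.\<close>

lemma tmap_coord:
  assumes "smooth_atlas M" "smooth_atlas N" "smooth_map M N f" "v \<in> tangent_space M x"
    and c: "c \<in> charts_at M x" "c' \<in> charts_at N (f x)"
  shows "tmap M N f x v c' = FD (coord_rep c c' f) (snd c x) (v c)"
proof -
  let ?s = "some_chart M x"
  have s: "?s \<in> charts_at M x" using some_chart[OF assms(1)] charts_at_carr[OF assms(1) c(1)] by blast
  have "FD (coord_rep c c' (f \<circ> (\<lambda>x. x))) (snd c x) (v c) =
    FD (coord_rep ?s c' f) (snd ?s x)
      (FD (coord_rep c ?s (\<lambda>x. x)) (snd c x) (v c))"
    using coord_rep_chain[OF assms(1,1,2) smooth_map_id[OF assms(1)] assms(3) c(1) s c(2)] .
  also have "FD (coord_rep c ?s (\<lambda>x. x)) (snd c x) (v c) = v ?s"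
    using tangent_spaceD[OF assms(4) c(1) s] by simp
  finally show ?thesis using c(2) by (simp add: tmap_eq o_def)
qed

lemma tmap_tangent:
  assumes "smooth_atlas M" "smooth_atlas N" "smooth_map M N f" "x \<in> carr M"
  shows "tmap M N f x v \<in> tangent_space N (f x)"
  unfolding tangent_space_def transition_eq
proof (intro CollectI conjI ballI allI impI)
  fix c c' assume c: "c \<in> charts_at N (f x)" "c' \<in> charts_at N (f x)"
  have s: "some_chart M x \<in> charts_at M x" using some_chart[OF assms(1,4)] .
  show "tmap M N f x v c' = FD (coord_rep c c' (\<lambda>x. x)) (snd c (f x)) (tmap M N f x v c)"
    using c coord_rep_chain[OF assms(1,2,2,3) smooth_map_id[OF assms(2)] s c]
    by (simp add: tmap_eq o_def)
qed (simp add: tmap_eq)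

lemma tmap_id:
  assumes "smooth_atlas M" "v \<in> tangent_space M x" "x \<in> carr M"
  shows "tmap M M (\<lambda>x. x) x v = v"
proof -
  obtain c where c: "c \<in> charts_at M x" using charts_at_nonempty[OF assms(1,3)] by blast
  show ?thesis
    by (rule tangent_eqI[OF tmap_tangent[OF assms(1,1) smooth_map_id[OF assms(1)] assms(3)] assms(2) c])
      (use tmap_coord[OF assms(1,1) smooth_map_id[OF assms(1)] assms(2) c] c
        coord_rep_id_self[OF assms(1) c] in simp)
qed

lemma tmap_compose:
  assumes "smooth_atlas M" "smooth_atlas N" "smooth_atlas P" "smooth_map M N f" "smooth_map N P g"
    and x: "x \<in> carr M" and v: "v \<in> tangent_space M x"
  shows "tmap M P (g \<circ> f) x v = tmap N P g (f x) (tmap M N f x v)"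
proof -
  note fx = smooth_map_carr[OF assms(4) x]
  note gf = smooth_map_compose[OF assms(1-5)]
  obtain c c' c'' where c: "c \<in> charts_at M x" "c' \<in> charts_at N (f x)" "c'' \<in> charts_at P (g (f x))"
    using charts_at_nonempty[OF assms(1) x] charts_at_nonempty[OF assms(2) fx]
      charts_at_nonempty[OF assms(3) smooth_map_carr[OF assms(5) fx]] by blast
  note fv = tmap_tangent[OF assms(1,2,4) x, of v]
  show ?thesis
    by (rule tangent_eqI[of _ _ "g (f x)", OF _ tmap_tangent[OF assms(2,3,5) fx] c(3)])
      (use tmap_tangent[OF assms(1,3) gf x, of v] tmap_coord[OF assms(1,3) gf v c(1)] c
        tmap_coord[OF assms(2,3,5) fv c(2,3)] tmap_coord[OF assms(1,2,4) v c(1,2)]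
        coord_rep_chain[OF assms(1-5) c] in simp_all)
qed

lemma tmap_combination:
  assumes "smooth_atlas M" "smooth_atlas N" "smooth_map M N f" "x \<in> carr M"
  shows "tmap M N f x (\<lambda>c. a *\<^sub>R v c + b *\<^sub>R w c) = (\<lambda>c. a *\<^sub>R tmap M N f x v c + b *\<^sub>R tmap M N f x w c)"
proof
  fix c
  show "tmap M N f x (\<lambda>c. a *\<^sub>R v c + b *\<^sub>R w c) c = a *\<^sub>R tmap M N f x v c + b *\<^sub>R tmap M N f x w c"
  proof (cases "c \<in> charts_at N (f x)")
    case True
    have l: "linear (FD (coord_rep (some_chart M x) c f) (snd (some_chart M x) x))"
      by (rule coord_rep_linear[OF assms(1-3) some_chart[OF assms(1,4)] True])
    show ?thesis using True by (simp add: tmap_eq linear_add[OF l] linear_scale[OF l])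
  qed (simp add: tmap_eq)
qed

text \<open>Smoothness is asked of one map, so that the other may be a local flow at a fixed time,
  of which only the values near \<open>x\<close> are known.\<close>

lemma tmap_cong_open:
  assumes "smooth_atlas M" "smooth_atlas N" "smooth_map M N f" "openin (mtop M) W" "x \<in> W" "x \<in> carr M"
    and "\<And>y. y \<in> W \<Longrightarrow> f y = g y"
  shows "tmap M N g x v = tmap M N f x v"
proof
  fix c'
  let ?s = "some_chart M x"
  have s: "?s \<in> charts_at M x" using some_chart[OF assms(1,6)] .
  have sA: "?s \<in> atlas M" "x \<in> fst ?s" using s by (auto simp: charts_at_def)
  have gx: "g x = f x" using assms(5,7) by simp
  show "tmap M N g x v c' = tmap M N f x v c'"
  proof (cases "c' \<in> charts_at N (f x)")
    case True
    have "(coord_rep ?s c' g has_derivative FD (coord_rep ?s c' f) (snd ?s x)) (at (snd ?s x))"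
      by (rule has_derivative_transform_within_open[OF coord_rep_has_derivative[OF assms(1-3) s True]
            open_chart_image[OF assms(1) sA(1) assms(4)]])
        (use sA assms(5,7) chart_inv_chart[OF assms(1), of ?s] in \<open>auto simp: coord_rep_def charts_at_def\<close>)
    then show ?thesis by (simp add: tmap_eq gx frechet_derivative_eq)
  qed (simp add: tmap_eq gx)
qed

section \<open>Tangent vectors with given coordinates\<close>

lemma tvec_of_eq:
  "tvec_of M c x w = (\<lambda>c'. if c' \<in> charts_at M x
     then FD (coord_rep c c' (\<lambda>x. x)) (snd c x) w else 0)"
  unfolding tvec_of_def transition_eq ..

lemma tvec_of_tangent:
  assumes "smooth_atlas M" "c \<in> charts_at M x"
  shows "tvec_of M c x w \<in> tangent_space M x"
  unfolding tangent_space_def transition_eq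
proof (intro CollectI conjI ballI allI impI)
  fix d d' assume d: "d \<in> charts_at M x" "d' \<in> charts_at M x"
  show "tvec_of M c x w d' = FD (coord_rep d d' (\<lambda>x. x)) (snd d x) (tvec_of M c x w d)"
    using d coord_rep_chain[OF assms(1,1,1) smooth_map_id[OF assms(1)] smooth_map_id[OF assms(1)] assms(2) d]
    by (simp add: tvec_of_eq o_def)
qed (simp add: tvec_of_eq)

lemma tvec_of_coord: "smooth_atlas M \<Longrightarrow> c \<in> charts_at M x \<Longrightarrow> tvec_of M c x w c = w"
  by (simp add: tvec_of_eq coord_rep_id_self)

lemma tvec_of_inverse:
  assumes "smooth_atlas M" "c \<in> charts_at M x" "v \<in> tangent_space M x"
  shows "tvec_of M c x (v c) = v"
  by (rule tangent_eqI[OF tvec_of_tangent[OF assms(1,2)] assms(3,2)]) (simp add: tvec_of_coord assms)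

lemma tvec_of_combination:
  assumes "smooth_atlas M" "c \<in> charts_at M x"
  shows "tvec_of M c x (a *\<^sub>R v + b *\<^sub>R w) = (\<lambda>c'. a *\<^sub>R tvec_of M c x v c' + b *\<^sub>R tvec_of M c x w c')"
  by (rule tangent_eqI[OF tvec_of_tangent[OF assms] _ assms(2)])
    (simp_all add: tvec_of_coord assms tangent_space_combination tvec_of_tangent)

subsection \<open>Derivatives along curves\<close>

text \<open>The coordinate expression of \<open>f\<close> can be used along the curve only while
  \<gamma> stays in the domain of \<open>c\<close>; continuity of \<gamma> makes this an open set of
  times around \<open>t\<close>.\<close>

lemma curve_push_forward:
  fixes \<gamma> :: "real \<Rightarrow> 'm"
  assumes "smooth_atlas M" "smooth_atlas N" "smooth_map M N f"
    and "open I" "t \<in> I" "continuous_map (top_of_set I) (mtop M) \<gamma>"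
    and c: "c \<in> charts_at M (\<gamma> t)" "c' \<in> charts_at N (f (\<gamma> t))"
    and d: "((\<lambda>r. snd c (\<gamma> r)) has_vector_derivative v c) (at t)" and v: "v \<in> tangent_space M (\<gamma> t)"
  shows "((\<lambda>r. snd c' (f (\<gamma> r))) has_vector_derivative tmap M N f (\<gamma> t) v c') (at t)"
proof -
  have cA: "c \<in> atlas M" using c by (simp add: charts_at_def)
  let ?D = "FD (coord_rep c c' f) (snd c (\<gamma> t))"
  note D = coord_rep_has_derivative[OF assms(1-3) c]
  have "((\<lambda>r. coord_rep c c' f (snd c (\<gamma> r))) has_derivative (\<lambda>r. ?D (r *\<^sub>R v c))) (at t)"
    by (rule has_derivative_compose[where f = "\<lambda>r. snd c (\<gamma> r)", OF d[unfolded has_vector_derivative_def] D])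
  then have "((\<lambda>r. coord_rep c c' f (snd c (\<gamma> r))) has_vector_derivative ?D (v c)) (at t)"
    by (simp add: has_vector_derivative_def linear_scale[OF has_derivative_linear[OF D]])
  moreover have "openin (top_of_set I) {r \<in> I. \<gamma> r \<in> fst c}"
    using assms(6) openin_chart_domain[OF assms(1) cA] by (simp add: continuous_map)
  then have "open {r \<in> I. \<gamma> r \<in> fst c}" using assms(4) openin_open_eq by blast
  ultimately have "((\<lambda>r. snd c' (f (\<gamma> r))) has_vector_derivative ?D (v c)) (at t)"
    by (rule has_vector_derivative_transform_within_open)
      (use c assms(5) chart_inv_chart[OF assms(1)] cA in \<open>auto simp: charts_at_def coord_rep_def\<close>)
  then show ?thesis using tmap_coord[OF assms(1-3) v c] by simp
qed

section \<open>Differential forms in charts\<close>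

text \<open>Tangent vectors are functions on charts with operations written out pointwise; passing
  to vectors of the model space makes \<open>alternating_map\<close> and its lemmas applicable.
  Nothing is lost at points of the chart, by \<open>form_eq_local_form\<close>.\<close>

definition local_form :: "('m, 'e::real_normed_vector) manifold \<Rightarrow> ('m, 'e) chart \<Rightarrow> ('m, 'e) form \<Rightarrow> 'e \<Rightarrow> 'e list \<Rightarrow> real" where
  "local_form M c \<alpha> y ws = \<alpha> (chart_inv c y) (map (tvec_of M c (chart_inv c y)) ws)"

lemma Omega_support:
  "\<alpha> \<in> Omega M k \<Longrightarrow> \<not> (x \<in> carr M \<and> set vs \<subseteq> tangent_space M x \<and> int (length vs) = k) \<Longrightarrow> \<alpha> x vs = 0"
  unfolding Omega_def by blast

lemma Omega_combination_arg:
  assumes "\<alpha> \<in> Omega M k" "x \<in> carr M" "set us \<subseteq> tangent_space M x" "set ws \<subseteq> tangent_space M x"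
    "v \<in> tangent_space M x" "w \<in> tangent_space M x"
  shows "\<alpha> x (us @ (\<lambda>c. a *\<^sub>R v c + b *\<^sub>R w c) # ws) = a * \<alpha> x (us @ v # ws) + b * \<alpha> x (us @ w # ws)"
  using assms unfolding Omega_def by (simp add: lists_eq_set)

lemma Omega_distinct: "\<alpha> \<in> Omega M k \<Longrightarrow> x \<in> carr M \<Longrightarrow> \<not> distinct vs \<Longrightarrow> \<alpha> x vs = 0"
  unfolding Omega_def by blast

lemma Omega_smooth: "\<alpha> \<in> Omega M k \<Longrightarrow> c \<in> atlas M \<Longrightarrow> smooth_on (snd c ` fst c) (\<lambda>y. local_form M c \<alpha> y ws)"
  unfolding Omega_def local_form_def by blast

lemma map_tvec_of:
  assumes "smooth_atlas M" "c \<in> charts_at M x" "set vs \<subseteq> tangent_space M x"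
  shows "map (tvec_of M c x) (map (\<lambda>v. v c) vs) = vs"
  unfolding map_map using assms(3) tvec_of_inverse[OF assms(1,2)] by (intro map_idI) auto

lemma local_form_chart:
  assumes "smooth_atlas M" "c \<in> charts_at M x"
  shows "local_form M c \<alpha> (snd c x) ws = \<alpha> x (map (tvec_of M c x) ws)"
  by (simp add: local_form_def chart_inv_chart[OF assms])

lemma form_eq_local_form:
  assumes "smooth_atlas M" "c \<in> charts_at M x" "set vs \<subseteq> tangent_space M x"
  shows "\<alpha> x vs = local_form M c \<alpha> (snd c x) (map (\<lambda>v. v c) vs)"
  by (simp only: local_form_chart[OF assms(1,2)] map_tvec_of[OF assms])

lemma set_map_tvec_of:
  "smooth_atlas M \<Longrightarrow> c \<in> charts_at M x \<Longrightarrow> set (map (tvec_of M c x) ws) \<subseteq> tangent_space M x"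
  using tvec_of_tangent by fastforce

lemma Omega_alternating:
  assumes M: "smooth_atlas M" and \<alpha>: "\<alpha> \<in> Omega M k" and c: "c \<in> atlas M" "y \<in> snd c ` fst c"
  shows "alternating_map (local_form M c \<alpha> y)"
proof -
  let ?x = "chart_inv c y"
  have x: "c \<in> charts_at M ?x" by (rule chart_inv_charts_at[OF c])
  have xc: "?x \<in> carr M" by (rule charts_at_carr[OF M x])
  show ?thesis
    unfolding alternating_map_def local_form_def
    using Omega_combination_arg[OF \<alpha> xc set_map_tvec_of[OF M x] set_map_tvec_of[OF M x]
        tvec_of_tangent[OF M x] tvec_of_tangent[OF M x]] Omega_distinct[OF \<alpha> xc]
    by (auto simp: tvec_of_combination[OF M x] distinct_map)
qed

text \<open>Taking coordinates in a chart at \<open>x\<close> is linear and injective on the tangent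
  space, so linearity and alternation there follow from those of the coordinate expression.\<close>

lemma OmegaI:
  assumes M: "smooth_atlas M"
    and support: "\<And>x vs. \<not> (x \<in> carr M \<and> set vs \<subseteq> tangent_space M x \<and> int (length vs) = k) \<Longrightarrow> \<alpha> x vs = 0"
    and alt: "\<And>c y. c \<in> atlas M \<Longrightarrow> y \<in> snd c ` fst c \<Longrightarrow> alternating_map (local_form M c \<alpha> y)"
    and smooth: "\<And>c ws. c \<in> atlas M \<Longrightarrow> smooth_on (snd c ` fst c) (\<lambda>y. local_form M c \<alpha> y ws)"
  shows "\<alpha> \<in> Omega M k"
proof -
  have A: "alternating_map (local_form M (some_chart M x) \<alpha> (snd (some_chart M x) x))" if "x \<in> carr M" for x
    using some_chart[OF M that] by (intro alt) (auto simp: charts_at_def)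
  note eq = form_eq_local_form[OF M some_chart[OF M], of _ _ \<alpha>]
  have "\<alpha> x (us @ (\<lambda>c. a *\<^sub>R v c + b *\<^sub>R w c) # ws) = a * \<alpha> x (us @ v # ws) + b * \<alpha> x (us @ w # ws)"
    if x: "x \<in> carr M" and us: "us \<in> lists (tangent_space M x)" "ws \<in> lists (tangent_space M x)"
      and v: "v \<in> tangent_space M x" "w \<in> tangent_space M x" for x us ws v w a b
  proof -
    have "set us \<subseteq> tangent_space M x" "set ws \<subseteq> tangent_space M x" using us by auto
    then show ?thesis
      using v tangent_space_combination[OF M v, of a b] by (simp add: eq[OF x] alternating_mapD(1)[OF A[OF x]])
  qed
  moreover have "\<alpha> x vs = 0" if x: "x \<in> carr M" and vs: "\<not> distinct vs" for x vs
  proof (cases "set vs \<subseteq> tangent_space M x")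
    case True
    have "\<not> distinct (map (\<lambda>v. v (some_chart M x)) vs)" using vs by (simp add: distinct_map)
    then show ?thesis using eq[OF x True] alternating_mapD(2)[OF A[OF x]] by simp
  qed (simp add: support)
  moreover note support smooth
  ultimately show ?thesis unfolding Omega_def local_form_def by blast
qed

lemma Omega_combination:
  assumes M: "smooth_atlas M" and \<alpha>: "\<alpha> \<in> Omega M k" "\<beta> \<in> Omega M k" and g: "smooth_fun M g" "smooth_fun M h"
  shows "(\<lambda>x vs. g x * \<alpha> x vs + h x * \<beta> x vs) \<in> Omega M k" (is "?\<gamma> \<in> _")
proof (rule OmegaI[OF M])
  show "?\<gamma> x vs = 0" if "\<not> (x \<in> carr M \<and> set vs \<subseteq> tangent_space M x \<and> int (length vs) = k)" for x vs
    using Omega_support[OF \<alpha>(1) that] Omega_support[OF \<alpha>(2) that] by simp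
next
  fix c y assume c: "c \<in> atlas M" "y \<in> snd c ` fst c"
  show "alternating_map (local_form M c ?\<gamma> y)"
    using alternating_map_combination[OF Omega_alternating[OF M \<alpha>(1) c] Omega_alternating[OF M \<alpha>(2) c]]
    by (simp add: local_form_def[abs_def])
next
  fix c ws assume c: "c \<in> atlas M"
  show "smooth_on (snd c ` fst c) (\<lambda>y. local_form M c ?\<gamma> y ws)"
    using smooth_on_add[OF open_chart_range[OF M c]
        smooth_on_mult[OF open_chart_range[OF M c] smooth_funD[OF g(1) c] Omega_smooth[OF \<alpha>(1) c]]
        smooth_on_mult[OF open_chart_range[OF M c] smooth_funD[OF g(2) c] Omega_smooth[OF \<alpha>(2) c]]]
    by (simp add: local_form_def)
qed

lemma Omega_scale:
  assumes "smooth_atlas M" "\<alpha> \<in> Omega M k" "smooth_fun M g"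
  shows "(\<lambda>x vs. g x * \<alpha> x vs) \<in> Omega M k"
  using Omega_combination[OF assms(1,2,2,3) smooth_fun_const[of M 0]] by simp

subsection \<open>Pullback\<close>

lemma local_form_pullback:
  assumes M: "smooth_atlas M" and N: "smooth_atlas N" and f: "smooth_map M N f"
    and c: "c \<in> atlas M" "c' \<in> atlas N" and y: "y \<in> rep_domain c c' f"
  shows "local_form M c (pullback M N f \<alpha>) y ws =
    local_form N c' \<alpha> (coord_rep c c' f y) (map (FD (coord_rep c c' f) y) ws)"
proof -
  let ?x = "chart_inv c y"
  note yd = rep_domain_chart_inv[OF y M c(1)]
  have x: "c \<in> charts_at M ?x" by (rule chart_inv_charts_at[OF c(1) yd(1)])
  have xc: "?x \<in> carr M" by (rule charts_at_carr[OF M x])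
  have fx: "c' \<in> charts_at N (f ?x)" using c(2) yd(3) by (simp add: charts_at_def)
  let ?vs = "map (tmap M N f ?x) (map (tvec_of M c ?x) ws)"
  have "local_form M c (pullback M N f \<alpha>) y ws = \<alpha> (f ?x) ?vs"
    using set_map_tvec_of[OF M x, of ws] xc by (simp add: local_form_def pullback_def)
  also have "\<dots> = local_form N c' \<alpha> (snd c' (f ?x)) (map (\<lambda>v. v c') ?vs)"
    using tmap_tangent[OF M N f xc] by (intro form_eq_local_form[OF N fx]) auto
  also have "map (\<lambda>v. v c') ?vs = map (FD (coord_rep c c' f) y) ws"
    using tmap_coord[OF M N f tvec_of_tangent[OF M x] x fx]
    by (simp add: tvec_of_coord[OF M x] chart_chart_inv[OF yd(1)])
  finally show ?thesis by (simp add: coord_rep_def)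
qed

lemma pullback_Omega:
  fixes N :: "('n, 'f::real_normed_vector) manifold"
  assumes M: "smooth_atlas M" and N: "smooth_atlas N" and f: "smooth_map M N f" and \<alpha>: "\<alpha> \<in> Omega N k"
  shows "pullback M N f \<alpha> \<in> Omega M k"
proof (rule OmegaI[OF M])
  fix x and vs assume "\<not> (x \<in> carr M \<and> set vs \<subseteq> tangent_space M x \<and> int (length vs) = k)"
  then show "pullback M N f \<alpha> x vs = 0" using Omega_support[OF \<alpha>] by (auto simp: pullback_def)
next
  fix c y assume c: "c \<in> atlas M" "y \<in> snd c ` fst c"
  then obtain x where x: "c \<in> charts_at M x" "y = snd c x" by (auto simp: charts_at_def)
  obtain c' where c': "c' \<in> charts_at N (f x)"
    using charts_at_nonempty[OF N smooth_map_carr[OF f charts_at_carr[OF M x(1)]]] by blast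
  then have c'A: "c' \<in> atlas N" by (simp add: charts_at_def)
  have "local_form M c (pullback M N f \<alpha>) y =
      (\<lambda>ws. local_form N c' \<alpha> (snd c' (f x)) (map (FD (coord_rep c c' f) y) ws))"
    using local_form_pullback[OF M N f c(1) c'A in_rep_domain[where f = f, OF x(1) c']]
    by (simp add: x(2) coord_rep_def chart_inv_chart[OF M x(1)] fun_eq_iff)
  then show "alternating_map (local_form M c (pullback M N f \<alpha>) y)"
    using alternating_map_compose_linear[OF Omega_alternating[OF N \<alpha> c'A] coord_rep_linear[OF M N f x(1) c']] c'
    by (simp add: x(2) charts_at_def)
next
  fix c ws assume c: "c \<in> atlas M"
  show "smooth_on (snd c ` fst c) (\<lambda>y. local_form M c (pullback M N f \<alpha>) y ws)"
  proof (rule smooth_on_local)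
    fix y assume "y \<in> snd c ` fst c"
    then obtain x where x: "c \<in> charts_at M x" "y = snd c x" using c by (auto simp: charts_at_def)
    then obtain c' where c': "c' \<in> charts_at N (f x)"
      using charts_at_nonempty[OF N smooth_map_carr[OF f charts_at_carr[OF M x(1)]]] by blast
    then have c'A: "c' \<in> atlas N" by (simp add: charts_at_def)
    let ?S = "rep_domain c c' f" and ?\<psi> = "coord_rep c c' f"
    note S = smooth_map_rep[OF M N f c c'A]
    obtain B :: "'f set" and \<kappa> where B: "coord_system B \<kappa>"
      using smooth_atlas_finite_dimensional[OF N] by (rule finite_dimensional_coord_system)
    have im: "?\<psi> z \<in> snd c' ` fst c'" if "z \<in> ?S" for z
      using rep_domain_chart_inv(3)[OF that M c] by (simp add: coord_rep_def)
    have "smooth_on ?S (\<lambda>y. local_form N c' \<alpha> (?\<psi> y) ([] @ map (\<lambda>h. h y) (map (\<lambda>w y. FD ?\<psi> y w) ws)))"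
    proof (rule smooth_on_alternating[OF B S(1)])
      show "alternating_map (local_form N c' \<alpha> (?\<psi> z))" if "z \<in> ?S" for z
        by (rule Omega_alternating[OF N \<alpha> c'A im[OF that]])
      show "smooth_on ?S (\<lambda>y. local_form N c' \<alpha> (?\<psi> y) ws)" for ws
        by (rule smooth_on_compose[where f = ?\<psi>, OF smooth_atlas_finite_dimensional[OF N] S(1)
              open_chart_range[OF N c'A] _ S(2) Omega_smooth[OF \<alpha> c'A]]) (use im in auto)
      show "smooth_on ?S h" if "h \<in> set (map (\<lambda>w y. FD ?\<psi> y w) ws)" for h
        using that smooth_on_frechet_derivative[OF S(2)] by auto
    qed
    then have "smooth_on ?S (\<lambda>y. local_form M c (pullback M N f \<alpha>) y ws)"
      by (rule smooth_on_cong[OF S(1), rotated]) (simp add: local_form_pullback[OF M N f c c'A] o_def)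
    then show "\<exists>T. open T \<and> y \<in> T \<and> smooth_on T (\<lambda>y. local_form M c (pullback M N f \<alpha>) y ws)"
      using S(1) in_rep_domain[where f = f, OF x(1) c'] x(2) by blast
  qed
qed

lemma pullback_id:
  assumes M: "smooth_atlas M" and \<alpha>: "\<alpha> \<in> Omega M k"
  shows "pullback M M (\<lambda>x. x) \<alpha> = \<alpha>"
proof (intro ext)
  fix x vs
  show "pullback M M (\<lambda>x. x) \<alpha> x vs = \<alpha> x vs"
  proof (cases "x \<in> carr M \<and> set vs \<subseteq> tangent_space M x")
    case True
    then have "map (tmap M M (\<lambda>x. x) x) vs = vs" using tmap_id[OF M] by (intro map_idI) auto
    then show ?thesis using True by (simp add: pullback_def)
  qed (use Omega_support[OF \<alpha>] in \<open>auto simp: pullback_def\<close>)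
qed

lemma pullback_compose:
  assumes M: "smooth_atlas M" and N: "smooth_atlas N" and P: "smooth_atlas P"
    and f: "smooth_map M N f" and g: "smooth_map N P g"
  shows "pullback M N f (pullback N P g \<alpha>) = pullback M P (g \<circ> f) \<alpha>"
proof (intro ext)
  fix x vs
  show "pullback M N f (pullback N P g \<alpha>) x vs = pullback M P (g \<circ> f) \<alpha> x vs"
  proof (cases "x \<in> carr M \<and> set vs \<subseteq> tangent_space M x")
    case True
    then have "map (tmap M P (g \<circ> f) x) vs = map (tmap N P g (f x)) (map (tmap M N f x) vs)"
      using tmap_compose[OF M N P f g] by auto
    then show ?thesis
      using True smooth_map_carr[OF f] tmap_tangent[OF M N f] by (auto simp: pullback_def simp del: map_map)
  qed (auto simp: pullback_def)
qed

lemma pullback_cong: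
  assumes M: "smooth_atlas M" and N: "smooth_atlas N" and f: "smooth_map M N f" and eq: "\<And>x. x \<in> carr M \<Longrightarrow> f x = g x"
  shows "pullback M N g \<alpha> = pullback M N f \<alpha>"
proof (intro ext)
  fix x vs
  have "tmap M N g x v = tmap M N f x v" if "x \<in> carr M" for v
    by (rule tmap_cong_open[OF M N f _ that that eq]) (simp add: carr_def)
  then have "tmap M N g x = tmap M N f x" if "x \<in> carr M" using that by (simp add: fun_eq_iff)
  then show "pullback M N g \<alpha> x vs = pullback M N f \<alpha> x vs" by (auto simp: pullback_def eq)
qed

subsection \<open>Exterior derivative\<close>

lemma ext_deriv_some_chart:
  "ext_deriv M \<alpha> x vs = (if x \<in> carr M \<and> set vs \<subseteq> tangent_space M x
     then coord_ext_deriv (local_form M (some_chart M x) \<alpha>) (snd (some_chart M x) x) (map (\<lambda>v. v (some_chart M x)) vs)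
     else 0)"
  by (auto simp: ext_deriv_def coord_ext_deriv_def local_form_def Let_def map_omit[symmetric] o_def)

lemma coord_ext_deriv_local_pullback:
  assumes M: "smooth_atlas M" and N: "smooth_atlas N" and f: "smooth_map M N f" and \<alpha>: "\<alpha> \<in> Omega N k"
    and c: "c \<in> charts_at M x" "c' \<in> charts_at N (f x)"
  shows "coord_ext_deriv (local_form M c (pullback M N f \<alpha>)) (snd c x) ws =
    coord_ext_deriv (local_form N c' \<alpha>) (snd c' (f x))
      (map (FD (coord_rep c c' f) (snd c x)) ws)"
proof -
  have cA: "c \<in> atlas M" "c' \<in> atlas N" using c by (auto simp: charts_at_def)
  let ?S = "rep_domain c c' f" and ?\<psi> = "coord_rep c c' f"
  let ?b = "\<lambda>y ws. local_form N c' \<alpha> (?\<psi> y) (map (FD ?\<psi> y) ws)"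
  note S = smooth_map_rep[OF M N f cA]
  note x = in_rep_domain[where f = f, OF c]
  have im: "?\<psi> z \<in> snd c' ` fst c'" if "z \<in> ?S" for z
    using rep_domain_chart_inv(3)[OF that M cA(1)] by (simp add: coord_rep_def)
  have fx: "?\<psi> (snd c x) = snd c' (f x)" by (simp add: coord_rep_def chart_inv_chart[OF M c(1)])
  have sm: "smooth_on ?S (\<lambda>y. local_form M c (pullback M N f \<alpha>) y zs)" for zs
    by (rule smooth_on_subset[OF Omega_smooth[OF pullback_Omega[OF M N f \<alpha>] cA(1)]]) (auto simp: rep_domain_def)
  have "coord_ext_deriv ?b (snd c x) ws = coord_ext_deriv (local_form M c (pullback M N f \<alpha>)) (snd c x) ws"
    by (rule coord_ext_deriv_cong[OF S(1) x])
      (simp_all add: local_form_pullback[OF M N f cA] smooth_on_differentiable[OF sm x])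
  moreover have "coord_ext_deriv ?b (snd c x) ws =
      coord_ext_deriv (local_form N c' \<alpha>) (?\<psi> (snd c x)) (map (FD ?\<psi> (snd c x)) ws)"
    by (rule coord_ext_deriv_pullback[OF smooth_atlas_finite_dimensional[OF N] S(1) x open_chart_range[OF N cA(2)] _ S(2)
          Omega_alternating[OF N \<alpha> cA(2)] Omega_smooth[OF \<alpha> cA(2)]]) (use im in auto)
  ultimately show ?thesis by (simp add: fx)
qed

lemma map_tangent_transition:
  assumes "set vs \<subseteq> tangent_space M x" "c \<in> charts_at M x" "c' \<in> charts_at M x"
  shows "map (FD (coord_rep c c' (\<lambda>x. x)) (snd c x)) (map (\<lambda>v. v c) vs) = map (\<lambda>v. v c') vs"
  using assms(1) tangent_spaceD[OF _ assms(2,3)] by auto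

text \<open>Independence of the chosen chart: naturality for the identity map, read with
  \<open>c\<close> on the source side and \<open>some_chart\<close> on the target side.\<close>

lemma ext_deriv_chart:
  assumes M: "smooth_atlas M" and \<alpha>: "\<alpha> \<in> Omega M k" and c: "c \<in> charts_at M x" and vs: "set vs \<subseteq> tangent_space M x"
  shows "ext_deriv M \<alpha> x vs = coord_ext_deriv (local_form M c \<alpha>) (snd c x) (map (\<lambda>v. v c) vs)"
proof -
  have x: "x \<in> carr M" by (rule charts_at_carr[OF M c])
  show ?thesis
    using coord_ext_deriv_local_pullback[OF M M smooth_map_id[OF M] \<alpha> c some_chart[OF M x], of "map (\<lambda>v. v c) vs"]
      map_tangent_transition[OF vs c some_chart[OF M x]] vs x
    by (simp add: pullback_id[OF M \<alpha>] ext_deriv_some_chart del: map_map)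
qed

lemma local_form_ext_deriv:
  assumes M: "smooth_atlas M" and \<alpha>: "\<alpha> \<in> Omega M k" and c: "c \<in> atlas M" "y \<in> snd c ` fst c"
  shows "local_form M c (ext_deriv M \<alpha>) y ws = coord_ext_deriv (local_form M c \<alpha>) y ws"
proof -
  note x = chart_inv_charts_at[OF c]
  have "map (\<lambda>v. v c) (map (tvec_of M c (chart_inv c y)) ws) = ws"
    by (simp add: o_def tvec_of_coord[OF M x])
  then show ?thesis
    using ext_deriv_chart[OF M \<alpha> x set_map_tvec_of[OF M x], of ws] by (simp add: local_form_def chart_chart_inv[OF c(2)])
qed

lemma ext_deriv_Omega:
  assumes M: "smooth_atlas M" and \<alpha>: "\<alpha> \<in> Omega M k"
  shows "ext_deriv M \<alpha> \<in> Omega M (k + 1)"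
proof (rule OmegaI[OF M])
  fix x vs assume a: "\<not> (x \<in> carr M \<and> set vs \<subseteq> tangent_space M x \<and> int (length vs) = k + 1)"
  show "ext_deriv M \<alpha> x vs = 0"
  proof (cases "x \<in> carr M \<and> set vs \<subseteq> tangent_space M x")
    case True
    with a have l: "int (length vs) \<noteq> k + 1" by simp
    have "local_form M (some_chart M x) \<alpha> z (omit i (map (\<lambda>v. v (some_chart M x)) vs)) = 0"
      if "i < length vs" for z i
      unfolding local_form_def using l that by (intro Omega_support[OF \<alpha>]) (auto simp: length_omit)
    then show ?thesis using True by (simp add: ext_deriv_some_chart coord_ext_deriv_def)
  qed (auto simp: ext_deriv_def)
next
  fix c y assume c: "c \<in> atlas M" "y \<in> snd c ` fst c"
  have "local_form M c (ext_deriv M \<alpha>) y = coord_ext_deriv (local_form M c \<alpha>) y"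
    using local_form_ext_deriv[OF M \<alpha> c] by blast
  then show "alternating_map (local_form M c (ext_deriv M \<alpha>) y)"
    using coord_ext_deriv_alternating[OF open_chart_range[OF M c(1)] c(2) Omega_alternating[OF M \<alpha> c(1)]
        Omega_smooth[OF \<alpha> c(1)]] by simp
next
  fix c ws assume c: "c \<in> atlas M"
  show "smooth_on (snd c ` fst c) (\<lambda>y. local_form M c (ext_deriv M \<alpha>) y ws)"
    by (rule smooth_on_cong[OF open_chart_range[OF M c] _
          coord_ext_deriv_smooth[OF open_chart_range[OF M c] Omega_smooth[OF \<alpha> c]]])
      (simp add: local_form_ext_deriv[OF M \<alpha> c])
qed

lemma ext_deriv_pullback:
  assumes M: "smooth_atlas M" and N: "smooth_atlas N" and f: "smooth_map M N f" and \<alpha>: "\<alpha> \<in> Omega N k"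
  shows "ext_deriv M (pullback M N f \<alpha>) = pullback M N f (ext_deriv N \<alpha>)"
proof (intro ext)
  fix x vs
  show "ext_deriv M (pullback M N f \<alpha>) x vs = pullback M N f (ext_deriv N \<alpha>) x vs"
  proof (cases "x \<in> carr M \<and> set vs \<subseteq> tangent_space M x")
    case True
    then have x: "x \<in> carr M" and vs: "set vs \<subseteq> tangent_space M x" by auto
    note c = some_chart[OF M x] and c' = some_chart[OF N smooth_map_carr[OF f x]]
    have vs': "set (map (tmap M N f x) vs) \<subseteq> tangent_space N (f x)" using tmap_tangent[OF M N f x] by auto
    have "map (\<lambda>v. v (some_chart N (f x))) (map (tmap M N f x) vs) =
        map (FD (coord_rep (some_chart M x) (some_chart N (f x)) f) (snd (some_chart M x) x))
          (map (\<lambda>v. v (some_chart M x)) vs)"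
      using vs tmap_coord[OF M N f _ c c'] by auto
    then show ?thesis
      using ext_deriv_chart[OF M pullback_Omega[OF M N f \<alpha>] c vs]
        coord_ext_deriv_local_pullback[OF M N f \<alpha> c c'] ext_deriv_chart[OF N \<alpha> c' vs'] x vs
      by (simp add: pullback_def[of M N f "ext_deriv N \<alpha>"] del: map_map)
  qed (auto simp: pullback_def ext_deriv_def)
qed

lemma ext_deriv_twice:
  assumes M: "smooth_atlas M" and \<alpha>: "\<alpha> \<in> Omega M k"
  shows "ext_deriv M (ext_deriv M \<alpha>) x vs = 0"
proof (cases "x \<in> carr M \<and> set vs \<subseteq> tangent_space M x")
  case True
  then have x: "x \<in> carr M" and vs: "set vs \<subseteq> tangent_space M x" by auto
  note c = some_chart[OF M x]
  let ?c = "some_chart M x"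
  have cA: "?c \<in> atlas M" "snd ?c x \<in> snd ?c ` fst ?c" using c by (auto simp: charts_at_def)
  note op = open_chart_range[OF M cA(1)] and sm = Omega_smooth[OF \<alpha> cA(1)]
  have "coord_ext_deriv (local_form M ?c (ext_deriv M \<alpha>)) (snd ?c x) ws =
      coord_ext_deriv (coord_ext_deriv (local_form M ?c \<alpha>)) (snd ?c x) ws" for ws
    by (rule coord_ext_deriv_cong[OF op cA(2)])
      (simp_all add: local_form_ext_deriv[OF M \<alpha> cA(1)] smooth_on_differentiable[OF coord_ext_deriv_smooth[OF op sm] cA(2)])
  then show ?thesis
    using ext_deriv_chart[OF M ext_deriv_Omega[OF M \<alpha>] c vs] coord_ext_deriv_twice[OF op cA(2) sm] by simp
qed (auto simp: ext_deriv_def)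

lemma fun_form_Omega:
  fixes M :: "('m, 'e::real_normed_vector) manifold"
  assumes M: "smooth_atlas M" and g: "smooth_fun M g"
  shows "fun_form M g \<in> Omega M 0"
proof (rule OmegaI[OF M])
  fix c assume c: "c \<in> atlas M"
  have e: "local_form M c (fun_form M g) y ws = (if ws = [] then g (chart_inv c y) else 0)" if "y \<in> snd c ` fst c" for y ws
    using charts_at_carr[OF M chart_inv_charts_at[OF c that]] by (simp add: local_form_def fun_form_def)
  then show "alternating_map (local_form M c (fun_form M g) y)" if "y \<in> snd c ` fst c" for y
    using that by (simp add: alternating_map_def)
  fix ws :: "'e list"
  have "smooth_on (snd c ` fst c) (\<lambda>y. if ws = [] then g (chart_inv c y) else 0)"
    using smooth_funD[OF g c] by (cases "ws = []") (simp_all add: smooth_on_const)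
  then show "smooth_on (snd c ` fst c) (\<lambda>y. local_form M c (fun_form M g) y ws)"
    by (rule smooth_on_cong[OF open_chart_range[OF M c], rotated]) (simp add: e)
qed (auto simp: fun_form_def)

lemma ext_deriv_fun_form:
  assumes M: "smooth_atlas M" and g: "smooth_fun M g" and c: "c \<in> charts_at M x" and v: "v \<in> tangent_space M x"
  shows "ext_deriv M (fun_form M g) x [v] = FD (\<lambda>y. g (chart_inv c y)) (snd c x) (v c)"
proof -
  have cA: "c \<in> atlas M" "snd c x \<in> snd c ` fst c" using c by (auto simp: charts_at_def)
  have "((\<lambda>y. local_form M c (fun_form M g) y []) has_derivative
      FD (\<lambda>y. g (chart_inv c y)) (snd c x)) (at (snd c x))"
    by (rule has_derivative_transform_within_open[OF smooth_on_has_derivative[OF smooth_funD[OF g cA(1)] cA(2)]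
          open_chart_range[OF M cA(1)] cA(2)])
      (use charts_at_carr[OF M chart_inv_charts_at[OF cA(1)]] in \<open>auto simp: local_form_def fun_form_def\<close>)
  then show ?thesis
    using ext_deriv_chart[OF M fun_form_Omega[OF M g] c, of "[v]"] v
    by (simp add: coord_ext_deriv_def omit_def frechet_derivative_eq)
qed

lemma ext_deriv_fun_form_outside:
  "v \<notin> tangent_space M x \<or> x \<notin> carr M \<Longrightarrow> ext_deriv M (fun_form M g) x [v] = 0"
  by (auto simp: ext_deriv_def)

lemma nth_or_omit_outside:
  assumes "\<not> set vs \<subseteq> A" "i < length vs" "vs ! i \<in> A"
  shows "\<not> set (omit i vs) \<subseteq> A"
proof -
  have "set vs = set (take i vs @ vs ! i # drop (Suc i) vs)" by (simp add: id_take_nth_drop[OF assms(2), symmetric])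
  then show ?thesis using assms(1,3) by (auto simp: omit_def)
qed

text \<open>In each summand either the entry fed to dg is not tangent, or it is and a non-tangent
  entry is left for \<open>\<alpha>\<close>; one factor vanishes in any case.\<close>

lemma wedge1_outside:
  assumes "\<alpha> \<in> Omega M k" "\<not> (x \<in> carr M \<and> set vs \<subseteq> tangent_space M x)"
  shows "wedge1 (ext_deriv M (fun_form M g)) \<alpha> x vs = 0"
  unfolding wedge1_def
proof (rule sum.neutral, rule ballI)
  fix i assume i: "i \<in> {..<length vs}"
  show "(-1) ^ i * ext_deriv M (fun_form M g) x [vs ! i] * \<alpha> x (omit i vs) = 0"
  proof (cases "x \<in> carr M \<and> vs ! i \<in> tangent_space M x")
    case True
    then have "\<alpha> x (omit i vs) = 0"
      using assms i nth_or_omit_outside[of vs "tangent_space M x" i] by (intro Omega_support[OF assms(1)]) auto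
    then show ?thesis by simp
  qed (auto simp: ext_deriv_fun_form_outside)
qed

lemma ext_deriv_scale:
  assumes M: "smooth_atlas M" and g: "smooth_fun M g" and \<alpha>: "\<alpha> \<in> Omega M k"
  shows "ext_deriv M (\<lambda>x vs. g x * \<alpha> x vs) x vs =
    wedge1 (ext_deriv M (fun_form M g)) \<alpha> x vs + g x * ext_deriv M \<alpha> x vs"
proof (cases "x \<in> carr M \<and> set vs \<subseteq> tangent_space M x")
  case True
  then have x: "x \<in> carr M" and vs: "set vs \<subseteq> tangent_space M x" by auto
  note c = some_chart[OF M x]
  let ?c = "some_chart M x"
  let ?\<phi> = "snd ?c" and ?g = "\<lambda>y. g (chart_inv ?c y)"
  have cA: "?c \<in> atlas M" "?\<phi> x \<in> ?\<phi> ` fst ?c" using c by (auto simp: charts_at_def)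
  let ?vs = "map (\<lambda>v. v ?c) vs"
  have gx: "?g (?\<phi> x) = g x" by (simp add: chart_inv_chart[OF M c])
  have d: "((\<lambda>y. ?g y * local_form M ?c \<alpha> y ws) has_derivative
    (\<lambda>v. g x * FD (\<lambda>y. local_form M ?c \<alpha> y ws) (?\<phi> x) v +
        FD ?g (?\<phi> x) v * local_form M ?c \<alpha> (?\<phi> x) ws)) (at (?\<phi> x))" for ws
    using has_derivative_mult[OF smooth_on_has_derivative[OF smooth_funD[OF g cA(1)] cA(2)]
        smooth_on_has_derivative[OF Omega_smooth[OF \<alpha> cA(1)] cA(2)]] by (simp add: gx)
  have lf: "local_form M ?c (\<lambda>x vs. g x * \<alpha> x vs) = (\<lambda>y ws. ?g y * local_form M ?c \<alpha> y ws)"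
    by (simp add: local_form_def fun_eq_iff)
  have "ext_deriv M (\<lambda>x vs. g x * \<alpha> x vs) x vs =
    (\<Sum>i<length vs. (-1) ^ i * (g x * FD (\<lambda>y. local_form M ?c \<alpha> y (omit i ?vs)) (?\<phi> x) ((vs ! i) ?c) +
        FD ?g (?\<phi> x) ((vs ! i) ?c) * local_form M ?c \<alpha> (?\<phi> x) (omit i ?vs)))"
    using ext_deriv_chart[OF M Omega_scale[OF M \<alpha> g] c vs]
    by (simp add: coord_ext_deriv_def lf frechet_derivative_eq[OF d])
  also have "\<dots> = (\<Sum>i<length vs. (-1) ^ i * (FD ?g (?\<phi> x) ((vs ! i) ?c) * local_form M ?c \<alpha> (?\<phi> x) (omit i ?vs))) +
     g x * (\<Sum>i<length vs. (-1) ^ i * FD (\<lambda>y. local_form M ?c \<alpha> y (omit i ?vs)) (?\<phi> x) ((vs ! i) ?c))"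
    by (simp add: algebra_simps sum.distrib sum_distrib_left)
  also have "(\<Sum>i<length vs. (-1) ^ i * FD (\<lambda>y. local_form M ?c \<alpha> y (omit i ?vs)) (?\<phi> x) ((vs ! i) ?c)) =
      ext_deriv M \<alpha> x vs"
    using ext_deriv_chart[OF M \<alpha> c vs] by (simp add: coord_ext_deriv_def)
  also have "(\<Sum>i<length vs. (-1) ^ i * (FD ?g (?\<phi> x) ((vs ! i) ?c) * local_form M ?c \<alpha> (?\<phi> x) (omit i ?vs))) =
      wedge1 (ext_deriv M (fun_form M g)) \<alpha> x vs"
    unfolding wedge1_def
  proof (intro sum.cong refl)
    fix i assume i: "i \<in> {..<length vs}"
    then have "vs ! i \<in> tangent_space M x" using vs by auto
    moreover have "set (omit i vs) \<subseteq> tangent_space M x" using vs set_omit_subset[of i vs] by blast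
    ultimately show "(-1) ^ i * (FD ?g (?\<phi> x) ((vs ! i) ?c) * local_form M ?c \<alpha> (?\<phi> x) (omit i ?vs)) =
        (-1) ^ i * ext_deriv M (fun_form M g) x [vs ! i] * \<alpha> x (omit i vs)"
      using ext_deriv_fun_form[OF M g c] form_eq_local_form[OF M c, of "omit i vs" \<alpha>] by (simp add: map_omit)
  qed
  finally show ?thesis .
next
  case False
  then show ?thesis using wedge1_outside[OF \<alpha> False] by (auto simp: ext_deriv_def)
qed

lemma ext_deriv_combination:
  assumes M: "smooth_atlas M" and \<alpha>: "\<alpha> \<in> Omega M k" "\<beta> \<in> Omega M k"
  shows "ext_deriv M (\<lambda>x vs. a * \<alpha> x vs + b * \<beta> x vs) x vs = a * ext_deriv M \<alpha> x vs + b * ext_deriv M \<beta> x vs"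
proof (cases "x \<in> carr M \<and> set vs \<subseteq> tangent_space M x")
  case True
  then have x: "x \<in> carr M" and vs: "set vs \<subseteq> tangent_space M x" by auto
  note c = some_chart[OF M x]
  let ?c = "some_chart M x"
  have cA: "?c \<in> atlas M" "snd ?c x \<in> snd ?c ` fst ?c" using c by (auto simp: charts_at_def)
  let ?A = "\<lambda>ws. FD (\<lambda>y. local_form M ?c \<alpha> y ws) (snd ?c x)"
  let ?B = "\<lambda>ws. FD (\<lambda>y. local_form M ?c \<beta> y ws) (snd ?c x)"
  have d: "((\<lambda>y. a * local_form M ?c \<alpha> y ws + b * local_form M ?c \<beta> y ws) has_derivative
      (\<lambda>v. a * ?A ws v + b * ?B ws v)) (at (snd ?c x))" for ws
    by (intro has_derivative_add has_derivative_mult_right smooth_on_has_derivative[OF Omega_smooth[OF \<alpha>(1) cA(1)] cA(2)]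
        smooth_on_has_derivative[OF Omega_smooth[OF \<alpha>(2) cA(1)] cA(2)])
  have lf: "local_form M ?c (\<lambda>x vs. a * \<alpha> x vs + b * \<beta> x vs) = (\<lambda>y ws. a * local_form M ?c \<alpha> y ws + b * local_form M ?c \<beta> y ws)"
    by (simp add: local_form_def fun_eq_iff)
  show ?thesis
    using x vs by (simp add: ext_deriv_some_chart coord_ext_deriv_def lf frechet_derivative_eq[OF d] sum.distrib
        sum_distrib_left algebra_simps)
qed (auto simp: ext_deriv_def)

lemma wedge1_combination:
  "wedge1 \<sigma> (\<lambda>x vs. a * \<alpha> x vs + b * \<beta> x vs) x vs = a * wedge1 \<sigma> \<alpha> x vs + b * wedge1 \<sigma> \<beta> x vs"
  by (simp add: wedge1_def algebra_simps sum.distrib sum_distrib_left)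

text \<open>By Leibniz' rule the product is d(g \<alpha>) - g d\<alpha>, so smoothness and
  alternation are inherited from \<open>ext_deriv\<close>.\<close>

lemma wedge1_Omega:
  assumes M: "smooth_atlas M" and g: "smooth_fun M g" and \<alpha>: "\<alpha> \<in> Omega M k"
  shows "wedge1 (ext_deriv M (fun_form M g)) \<alpha> \<in> Omega M (k + 1)"
proof -
  have "wedge1 (ext_deriv M (fun_form M g)) \<alpha> =
      (\<lambda>x vs. 1 * ext_deriv M (\<lambda>x vs. g x * \<alpha> x vs) x vs + (- 1 * g x) * ext_deriv M \<alpha> x vs)"
    by (simp add: fun_eq_iff ext_deriv_scale[OF M g \<alpha>])
  also have "\<dots> \<in> Omega M (k + 1)"
    by (intro Omega_combination[OF M] ext_deriv_Omega[OF M] Omega_scale[OF M] \<alpha> g smooth_fun_const smooth_fun_scale[OF M])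
  finally show ?thesis .
qed

lemma wedge1_insertion:
  "wedge1 \<sigma> \<alpha> x (X x # vs) = \<sigma> x [X x] * \<alpha> x vs - wedge1 \<sigma> (insertion X \<alpha>) x vs"
  by (simp add: wedge1_def insertion_def omit_def sum.lessThan_Suc_shift sum_negf[symmetric] del: sum.lessThan_Suc)

subsection \<open>Insertion of vector fields\<close>

lemma vector_field_tangent: "vector_field M X \<Longrightarrow> x \<in> carr M \<Longrightarrow> X x \<in> tangent_space M x"
  by (simp add: vector_field_def)

lemma insertion_Omega:
  fixes M :: "('m, 'e::real_normed_vector) manifold"
  assumes M: "smooth_atlas M" and X: "vector_field M X" and \<alpha>: "\<alpha> \<in> Omega M k"
  shows "insertion X \<alpha> \<in> Omega M (k - 1)"
proof (rule OmegaI[OF M])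
  fix x vs assume "\<not> (x \<in> carr M \<and> set vs \<subseteq> tangent_space M x \<and> int (length vs) = k - 1)"
  then show "insertion X \<alpha> x vs = 0" unfolding insertion_def by (intro Omega_support[OF \<alpha>]) auto
next
  fix c assume c: "c \<in> atlas M"
  let ?S = "snd c ` fst c"
  have e: "local_form M c (insertion X \<alpha>) y ws = local_form M c \<alpha> y (X (chart_inv c y) c # ws)" if "y \<in> ?S" for y ws
    using tvec_of_inverse[OF M _ vector_field_tangent[OF X charts_at_carr[OF M]]] chart_inv_charts_at[OF c that]
    by (simp add: local_form_def insertion_def)
  have "local_form M c (insertion X \<alpha>) y = (\<lambda>ws. local_form M c \<alpha> y (X (chart_inv c y) c # ws))" if "y \<in> ?S" for y
    using e[OF that] by blast
  then show "alternating_map (local_form M c (insertion X \<alpha>) y)" if "y \<in> ?S" for y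
    using alternating_map_Cons[OF Omega_alternating[OF M \<alpha> c that]] that by simp
  fix ws
  obtain B :: "'e set" and \<kappa> where B: "coord_system B \<kappa>"
    using smooth_atlas_finite_dimensional[OF M] by (rule finite_dimensional_coord_system)
  let ?hs = "(\<lambda>y. X (chart_inv c y) c) # map (\<lambda>w y. w) ws"
  have "smooth_on ?S (\<lambda>y. local_form M c \<alpha> y ([] @ map (\<lambda>h. h y) ?hs))"
  proof (rule smooth_on_alternating[OF B open_chart_range[OF M c] Omega_alternating[OF M \<alpha> c] Omega_smooth[OF \<alpha> c]])
    show "smooth_on ?S h" if "h \<in> set ?hs" for h
      using that X c by (auto simp: vector_field_def smooth_on_const)
  qed
  then show "smooth_on ?S (\<lambda>y. local_form M c (insertion X \<alpha>) y ws)"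
    by (rule smooth_on_cong[OF open_chart_range[OF M c], rotated]) (simp add: e o_def)
qed

section \<open>Differentials of functions\<close>

definition dfun :: "('m, 'e::real_normed_vector) manifold \<Rightarrow> ('m \<Rightarrow> real) \<Rightarrow> 'm \<Rightarrow> ('m, 'e) tvec \<Rightarrow> real" where
  "dfun M g x v = ext_deriv M (fun_form M g) x [v]"

lemma fun_form_cong: "(\<And>x. x \<in> carr M \<Longrightarrow> g x = h x) \<Longrightarrow> fun_form M g = fun_form M h"
  by (auto simp: fun_form_def fun_eq_iff)

lemma dfun_cong: "(\<And>x. x \<in> carr M \<Longrightarrow> g x = h x) \<Longrightarrow> dfun M g = dfun M h"
  using fun_form_cong[of M g h] by (auto simp: dfun_def intro!: ext)

lemma dfun_outside: "v \<notin> tangent_space M x \<or> x \<notin> carr M \<Longrightarrow> dfun M g x v = 0"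
  unfolding dfun_def by (rule ext_deriv_fun_form_outside)

lemma dfun_tmap:
  assumes M: "smooth_atlas M" and N: "smooth_atlas N" and f: "smooth_map M N f" and g: "smooth_fun N g"
    and x: "x \<in> carr M" and v: "v \<in> tangent_space M x"
  shows "dfun N g (f x) (tmap M N f x v) = dfun M (g \<circ> f) x v"
proof -
  have e: "pullback M N f (fun_form N g) = fun_form M (g \<circ> f)"
    using smooth_map_carr[OF f] by (auto simp: pullback_def fun_form_def fun_eq_iff)
  have "ext_deriv M (pullback M N f (fun_form N g)) x [v] = pullback M N f (ext_deriv N (fun_form N g)) x [v]"
    using ext_deriv_pullback[OF M N f fun_form_Omega[OF N g]] by simp
  then show ?thesis using x v by (simp add: e dfun_def pullback_def[of M N f "ext_deriv N (fun_form N g)"])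
qed

lemma dfun_chain:
  assumes M: "smooth_atlas M" and g: "smooth_fun M g" "smooth_fun M (\<lambda>x. h (g x))"
    and h: "\<And>r. (h has_real_derivative h' r) (at r)"
  shows "dfun M (\<lambda>x. h (g x)) x v = h' (g x) * dfun M g x v"
proof (cases "x \<in> carr M \<and> v \<in> tangent_space M x")
  case True
  then obtain c where c: "c \<in> charts_at M x" using charts_at_nonempty[OF M] by blast
  have cA: "c \<in> atlas M" "snd c x \<in> snd c ` fst c" using c by (auto simp: charts_at_def)
  let ?g = "\<lambda>y. g (chart_inv c y)"
  have "((\<lambda>y. h (?g y)) has_derivative (\<lambda>v. h' (?g (snd c x)) * FD ?g (snd c x) v)) (at (snd c x))"
    by (rule has_derivative_compose[where f = ?g and g = h, OF
          smooth_on_has_derivative[OF smooth_funD[OF g(1) cA(1)] cA(2)] h[unfolded has_field_derivative_def]])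
  then show ?thesis
    using ext_deriv_fun_form[OF M g(1) c] ext_deriv_fun_form[OF M g(2) c] True
    by (simp add: dfun_def frechet_derivative_eq chart_inv_chart[OF M c])
qed (use dfun_outside[of v M x] in auto)

lemma curve_smooth_fun:
  fixes \<gamma> :: "real \<Rightarrow> 'm"
  assumes M: "smooth_atlas M" and g: "smooth_fun M g"
    and "open I" "t \<in> I" "continuous_map (top_of_set I) (mtop M) \<gamma>"
    and c: "c \<in> charts_at M (\<gamma> t)"
    and d: "((\<lambda>r. snd c (\<gamma> r)) has_vector_derivative v c) (at t)" and v: "v \<in> tangent_space M (\<gamma> t)"
  shows "((\<lambda>r. g (\<gamma> r)) has_real_derivative dfun M g (\<gamma> t) v) (at t)"
proof -
  have cA: "c \<in> atlas M" "snd c (\<gamma> t) \<in> snd c ` fst c" using c by (auto simp: charts_at_def)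
  let ?g = "\<lambda>y. g (chart_inv c y)"
  let ?D = "FD ?g (snd c (\<gamma> t))"
  note D = smooth_on_has_derivative[OF smooth_funD[OF g cA(1)] cA(2)]
  have "((\<lambda>r. ?g (snd c (\<gamma> r))) has_derivative (\<lambda>r. ?D (r *\<^sub>R v c))) (at t)"
    by (rule has_derivative_compose[where f = "\<lambda>r. snd c (\<gamma> r)" and g = ?g, OF d[unfolded has_vector_derivative_def] D])
  then have "((\<lambda>r. ?g (snd c (\<gamma> r))) has_vector_derivative ?D (v c)) (at t)"
    by (simp add: has_vector_derivative_def linear_scale[OF has_derivative_linear[OF D]])
  moreover have "openin (top_of_set I) {r \<in> I. \<gamma> r \<in> fst c}"
    using assms(5) openin_chart_domain[OF M cA(1)] by (simp add: continuous_map)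
  then have "open {r \<in> I. \<gamma> r \<in> fst c}" using assms(3) openin_open_eq by blast
  ultimately have "((\<lambda>r. g (\<gamma> r)) has_vector_derivative ?D (v c)) (at t)"
    by (rule has_vector_derivative_transform_within_open)
      (use c assms(4) chart_inv_chart[OF M] cA in \<open>auto simp: charts_at_def\<close>)
  then show ?thesis
    using ext_deriv_fun_form[OF M g c v] by (simp add: dfun_def has_real_derivative_iff_has_vector_derivative)
qed

subsection \<open>Tangent vectors of a product with the line\<close>

lemma tmap_fst_coord:
  assumes M: "smooth_atlas M" and u: "u \<in> tangent_space (times_line M) p" and c: "c \<in> charts_at M (fst p)"
  shows "tmap (times_line M) M fst p u c = fst (u (line_chart c))"
proof -
  note W = smooth_atlas_times_line[OF M]
  note lc = charts_at_times_line[OF c]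
  have cA: "c \<in> atlas M" "line_chart c \<in> atlas (times_line M)" "snd (line_chart c) p \<in> snd (line_chart c) ` fst (line_chart c)"
    using c lc by (auto simp: charts_at_def)
  have "(coord_rep (line_chart c) c fst has_derivative fst) (at (snd (line_chart c) p))"
    by (rule has_derivative_transform_within_open[OF bounded_linear_imp_has_derivative[OF bounded_linear_fst]
          open_chart_range[OF W cA(2)] cA(3)])
      (auto simp: coord_rep_def line_chart_simps chart_inv_line_chart[OF M cA(1)] chart_chart_inv)
  then show ?thesis
    using tmap_coord[OF W M smooth_map_fst[OF M] u lc c] by (simp add: frechet_derivative_eq)
qed

lemma dfun_snd_coord:
  assumes M: "smooth_atlas M" and u: "u \<in> tangent_space (times_line M) p" and c: "c \<in> charts_at M (fst p)"
  shows "dfun (times_line M) snd p u = snd (u (line_chart c))"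
proof -
  note W = smooth_atlas_times_line[OF M]
  note lc = charts_at_times_line[OF c]
  have cA: "c \<in> atlas M" "line_chart c \<in> atlas (times_line M)" "snd (line_chart c) p \<in> snd (line_chart c) ` fst (line_chart c)"
    using c lc by (auto simp: charts_at_def)
  have "((\<lambda>y. snd (chart_inv (line_chart c) y)) has_derivative snd) (at (snd (line_chart c) p))"
    by (rule has_derivative_transform_within_open[OF bounded_linear_imp_has_derivative[OF bounded_linear_snd]
          open_chart_range[OF W cA(2)] cA(3)])
      (auto simp: line_chart_simps chart_inv_line_chart[OF M cA(1)])
  then show ?thesis
    using ext_deriv_fun_form[OF W smooth_fun_snd[OF M] lc u] by (simp add: dfun_def frechet_derivative_eq)
qed

lemma d_ds_line_chart:
  assumes "c \<in> charts_at M (fst p)"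
  shows "d_ds M p (line_chart c) = (0, 1)"
proof -
  have "((\<lambda>r. (snd c (fst p), r)) has_vector_derivative (0, 1)) (at (snd p))"
    unfolding has_vector_derivative_def by (auto intro!: derivative_eq_intros)
  then show ?thesis
    using charts_at_times_line[OF assms] by (simp add: d_ds_def line_chart_simps vector_derivative_at)
qed

lemma smooth_map_slice:
  assumes M: "smooth_atlas M"
  shows "smooth_map M (times_line M) (\<lambda>x. (x, t))"
  by (rule smooth_map_Pair[OF M M smooth_map_id[OF M] smooth_fun_const]) simp

lemma tmap_slice_coord:
  assumes M: "smooth_atlas M" and v: "v \<in> tangent_space M x" and c: "c \<in> charts_at M x"
  shows "tmap M (times_line M) (\<lambda>x. (x, t)) x v (line_chart c) = (v c, 0)"
proof -
  note W = smooth_atlas_times_line[OF M]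
  have cA: "c \<in> atlas M" "snd c x \<in> snd c ` fst c" using c by (auto simp: charts_at_def)
  have lc: "line_chart c \<in> charts_at (times_line M) (x, t)" using c by (intro charts_at_times_line) simp
  have "((\<lambda>y. (y, t)) has_derivative (\<lambda>w. (w, 0))) (at (snd c x))" by (auto intro!: derivative_eq_intros)
  then have "(coord_rep c (line_chart c) (\<lambda>x. (x, t)) has_derivative (\<lambda>w. (w, 0))) (at (snd c x))"
    by (rule has_derivative_transform_within_open[OF _ open_chart_range[OF M cA(1)] cA(2)])
      (auto simp: coord_rep_def line_chart_simps chart_chart_inv)
  then show ?thesis
    using tmap_coord[OF M W smooth_map_slice[OF M] v c lc] by (simp add: frechet_derivative_eq)
qed

section \<open>Straightened vector fields and their flow\<close>

text \<open>The diffeomorphism and its inverse become parameters, so that projection, height and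
  flow are given by formulas.\<close>

locale straightened_field =
  fixes U :: "('m, 'e::real_normed_vector) manifold" and N :: "('m, 'f::real_normed_vector) manifold"
    and X :: "'m \<Rightarrow> ('m, 'e) tvec" and F :: "'m \<Rightarrow> 'm \<times> real" and G :: "'m \<times> real \<Rightarrow> 'm"
  assumes U: "smooth_atlas U" and N: "smooth_atlas N" and X: "vector_field U X" and NU: "carr N \<subseteq> carr U"
    and F: "smooth_map U (times_line N) F" and G: "smooth_map (times_line N) U G"
    and GF: "\<And>x. x \<in> carr U \<Longrightarrow> G (F x) = x" and FG: "\<And>p. p \<in> carr (times_line N) \<Longrightarrow> F (G p) = p"
    and FX: "\<And>x. x \<in> carr U \<Longrightarrow> tmap U (times_line N) F x (X x) = d_ds N (F x)"
    and F0: "\<And>x. x \<in> carr N \<Longrightarrow> F x = (x, 0)"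
begin

abbreviation "W \<equiv> times_line N"

definition pr :: "'m \<Rightarrow> 'm" where "pr = fst \<circ> F"

definition ht :: "'m \<Rightarrow> real" where "ht = snd \<circ> F"

definition flow :: "real \<Rightarrow> 'm \<Rightarrow> 'm" where "flow t x = G (pr x, ht x + t)"

lemma W: "smooth_atlas W"
  by (rule smooth_atlas_times_line[OF N])

lemma F_eq: "F x = (pr x, ht x)"
  by (simp add: pr_def ht_def)

lemma pr_smooth: "smooth_map U N pr"
  unfolding pr_def by (rule smooth_map_compose[OF U W N F smooth_map_fst[OF N]])

lemma ht_smooth: "smooth_fun U ht"
  unfolding ht_def by (rule smooth_fun_compose[OF U W F smooth_fun_snd[OF N]])

lemma ht_continuous: "continuous_map (mtop U) euclideanreal ht"
proof -
  have "continuous_map (mtop W) euclideanreal snd" by (simp add: times_line_def continuous_map_snd)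
  then show ?thesis unfolding ht_def by (rule continuous_map_compose[OF smooth_map_continuous[OF F]])
qed

lemma pr_carr: "x \<in> carr U \<Longrightarrow> pr x \<in> carr N"
  by (rule smooth_map_carr[OF pr_smooth])

lemma in_W: "y \<in> carr N \<Longrightarrow> (y, t) \<in> carr W"
  by (simp add: carr_times_line)

lemma pr_N: "x \<in> carr N \<Longrightarrow> pr x = x" and ht_N: "x \<in> carr N \<Longrightarrow> ht x = 0"
  using F0 by (simp_all add: pr_def ht_def)

lemma flow_carr: "x \<in> carr U \<Longrightarrow> flow t x \<in> carr U"
  unfolding flow_def by (rule smooth_map_carr[OF G in_W[OF pr_carr]])

lemma F_flow: "x \<in> carr U \<Longrightarrow> F (flow t x) = (pr x, ht x + t)"
  unfolding flow_def by (rule FG[OF in_W[OF pr_carr]])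

lemma pr_flow: "x \<in> carr U \<Longrightarrow> pr (flow t x) = pr x"
  and ht_flow: "x \<in> carr U \<Longrightarrow> ht (flow t x) = ht x + t"
  using F_flow by (simp_all add: F_eq)

lemma flow_0: "x \<in> carr U \<Longrightarrow> flow 0 x = x"
  using GF by (simp add: flow_def F_eq)

lemma flow_flow: "x \<in> carr U \<Longrightarrow> flow h (flow t x) = flow (t + h) x"
  unfolding flow_def[of h] flow_def[of "t + h"] by (simp add: pr_flow ht_flow add.assoc)

lemma flow_to_N: "x \<in> carr U \<Longrightarrow> flow (- ht x) x = pr x"
  using GF[of "pr x"] F0[OF pr_carr] NU pr_carr by (auto simp: flow_def)

text \<open>The inclusion is \<open>G\<close> after the zero slice, since
  \<open>F x = (x, 0)\<close> on \<open>N\<close>.\<close>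

lemma inclusion_smooth: "smooth_map N U (\<lambda>x. x)"
proof (rule smooth_map_cong[OF N U smooth_map_compose[OF N W U smooth_map_slice[OF N, of 0] G]])
  show "(G \<circ> (\<lambda>x. (x, 0))) x = x" if "x \<in> carr N" for x
    using GF[of x] F0[OF that] that NU by auto
qed

text \<open>Joint smoothness in point and time is demanded by \<open>local_flow\<close>, and it is
  what allows differentiating pullbacks along the flow with respect to time.\<close>

lemma joint_flow_smooth: "smooth_map (times_line U) U (\<lambda>(x, t). flow t x)"
proof -
  note LU = smooth_atlas_times_line[OF U]
  note fst' = smooth_map_fst[OF U]
  have "smooth_map (times_line U) W (\<lambda>p. ((pr \<circ> fst) p, (ht \<circ> fst) p + snd p))"
  proof (rule smooth_map_Pair[OF LU N])
    show "smooth_map (times_line U) N (pr \<circ> fst)" by (rule smooth_map_compose[OF LU U N fst' pr_smooth])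
    show "smooth_fun (times_line U) (\<lambda>p. (ht \<circ> fst) p + snd p)"
      by (rule smooth_fun_add[OF LU smooth_fun_compose[OF LU U fst' ht_smooth] smooth_fun_snd[OF U]])
    have "continuous_map (mtop (times_line U)) euclideanreal (ht \<circ> fst)"
      by (rule continuous_map_compose[OF smooth_map_continuous[OF fst'] ht_continuous])
    moreover have "continuous_map (mtop (times_line U)) euclideanreal snd"
      by (simp add: times_line_def continuous_map_snd)
    ultimately show "continuous_map (mtop (times_line U)) euclideanreal (\<lambda>p. (ht \<circ> fst) p + snd p)"
      by (rule continuous_map_add)
  qed
  from smooth_map_compose[OF LU W U this G] show ?thesis
    by (simp add: o_def flow_def case_prod_beta')
qed

lemma flow_smooth: "smooth_map U U (flow t)"
  using smooth_map_compose[OF U smooth_atlas_times_line[OF U] U smooth_map_slice[OF U, of t] joint_flow_smooth]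
  by (simp add: o_def)

section \<open>Tangent vectors in the straightened coordinates\<close>

lemma X_tangent: "x \<in> carr U \<Longrightarrow> X x \<in> tangent_space U x"
  by (rule vector_field_tangent[OF X])

text \<open>The differential of \<open>F\<close> splits into those of \<open>pr\<close> and
  \<open>ht\<close>; equalities of tangent vectors of \<open>U\<close> are proved through these two
  components.\<close>

lemma dpr_coord:
  assumes x: "x \<in> carr U" and v: "v \<in> tangent_space U x" and c: "c \<in> charts_at N (pr x)"
  shows "tmap U W F x v (line_chart c) = (tmap U N pr x v c, dfun U ht x v)"
proof -
  have c': "c \<in> charts_at N (fst (F x))" using c by (simp add: pr_def)
  note T = tmap_tangent[OF U W F x, of v]
  show ?thesis
    using tmap_fst_coord[OF N T c'] dfun_snd_coord[OF N T c'] dfun_tmap[OF U W F smooth_fun_snd[OF N] x v]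
      tmap_compose[OF U W N F smooth_map_fst[OF N] x v]
    by (simp add: pr_def[symmetric] ht_def[symmetric] prod_eq_iff)
qed

lemma tmap_G_F:
  assumes x: "x \<in> carr U" and v: "v \<in> tangent_space U x"
  shows "tmap W U G (F x) (tmap U W F x v) = v"
proof -
  have "tmap U U (G \<circ> F) x v = tmap U U (\<lambda>x. x) x v"
    by (rule tmap_cong_open[OF U U smooth_map_id[OF U] _ x x]) (use GF in \<open>auto simp: carr_def\<close>)
  then show ?thesis using tmap_compose[OF U W U F G x v] tmap_id[OF U v x] by simp
qed

text \<open>The differential of \<open>F\<close> is injective because that of \<open>G\<close>
  inverts it.\<close>

lemma tangent_determined:
  assumes x: "x \<in> carr U" and v: "v \<in> tangent_space U x" "w \<in> tangent_space U x"
    and eq: "tmap U N pr x v = tmap U N pr x w" "dfun U ht x v = dfun U ht x w"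
  shows "v = w"
proof -
  obtain c where c: "c \<in> charts_at N (pr x)" using charts_at_nonempty[OF N pr_carr[OF x]] by blast
  have lc: "line_chart c \<in> charts_at W (F x)" using c by (intro charts_at_times_line) (simp add: pr_def)
  have "tmap U W F x v = tmap U W F x w"
    by (rule tangent_eqI[OF tmap_tangent[OF U W F x] tmap_tangent[OF U W F x] lc])
      (simp add: dpr_coord[OF x _ c] v eq)
  then have "tmap W U G (F x) (tmap U W F x v) = tmap W U G (F x) (tmap U W F x w)" by (rule arg_cong)
  then show ?thesis unfolding tmap_G_F[OF x v(1)] tmap_G_F[OF x v(2)] .
qed

text \<open>\<open>F\<close> carries \<open>X\<close> to the vertical unit field, whose coordinates
  in a product chart are (0, 1).\<close>

lemma dpr_X: "x \<in> carr U \<Longrightarrow> tmap U N pr x (X x) = (\<lambda>c. 0)"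
  and dht_X: "x \<in> carr U \<Longrightarrow> dfun U ht x (X x) = 1"
proof -
  assume x: "x \<in> carr U"
  have *: "(tmap U N pr x (X x) c, dfun U ht x (X x)) = (0, 1)" if c: "c \<in> charts_at N (pr x)" for c
    using dpr_coord[OF x X_tangent[OF x] c] FX[OF x] d_ds_line_chart[of c N "F x"] c by (simp add: pr_def)
  obtain c where c: "c \<in> charts_at N (pr x)" using charts_at_nonempty[OF N pr_carr[OF x]] by blast
  show "dfun U ht x (X x) = 1" using *[OF c] by simp
  show "tmap U N pr x (X x) = (\<lambda>c. 0)"
    by (rule tangent_eqI[OF tmap_tangent[OF U N pr_smooth x] tangent_space_zero[OF N] c]) (use *[OF c] in simp)
qed

lemma dpr_flow:
  assumes x: "x \<in> carr U" and v: "v \<in> tangent_space U x"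
  shows "tmap U N pr (flow t x) (tmap U U (flow t) x v) = tmap U N pr x v"
proof -
  have "tmap U N (pr \<circ> flow t) x v = tmap U N pr x v"
    by (rule tmap_cong_open[OF U N pr_smooth _ x x]) (use pr_flow in \<open>auto simp: carr_def\<close>)
  then show ?thesis using tmap_compose[OF U U N flow_smooth pr_smooth x v] by simp
qed

lemma dht_flow:
  assumes x: "x \<in> carr U" and v: "v \<in> tangent_space U x"
  shows "dfun U ht (flow t x) (tmap U U (flow t) x v) = dfun U ht x v"
proof -
  have "dfun U ht (flow t x) (tmap U U (flow t) x v) = dfun U (ht \<circ> flow t) x v"
    by (rule dfun_tmap[OF U U flow_smooth ht_smooth x v])
  also have "\<dots> = dfun U (\<lambda>x. ht x + t) x v" using ht_flow by (simp cong: dfun_cong)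
  also have "\<dots> = 1 * dfun U ht x v"
    by (rule dfun_chain[OF U ht_smooth smooth_fun_add[OF U ht_smooth smooth_fun_const]])
      (auto intro!: derivative_eq_intros)
  finally show ?thesis by simp
qed

lemma tmap_flow_X:
  assumes x: "x \<in> carr U"
  shows "tmap U U (flow t) x (X x) = X (flow t x)"
  by (rule tangent_determined[OF flow_carr[OF x] tmap_tangent[OF U U flow_smooth x] X_tangent[OF flow_carr[OF x]]])
    (simp_all add: dpr_flow dht_flow X_tangent dpr_X dht_X flow_carr x)

text \<open>The curve is the image under \<open>G\<close> of a vertical line with velocity
  \<open>d_ds\<close>, and the differential of \<open>G\<close> takes this velocity back to
  \<open>X\<close>.\<close>

lemma flow_curve:
  assumes y: "y \<in> carr U"
  shows "continuous_map (top_of_set UNIV) (mtop U) (\<lambda>r. flow r y)"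
    and "c \<in> charts_at U (flow t y) \<Longrightarrow> ((\<lambda>r. snd c (flow r y)) has_vector_derivative X (flow t y) c) (at t)"
proof -
  let ?\<gamma> = "\<lambda>r. (pr y, ht y + r)"
  have cont: "continuous_map (top_of_set UNIV) (mtop W) ?\<gamma>"
    using pr_carr[OF y] by (auto simp: times_line_def continuous_map_paired carr_def intro!: continuous_intros)
  show "continuous_map (top_of_set UNIV) (mtop U) (\<lambda>r. flow r y)"
    using continuous_map_compose[OF cont smooth_map_continuous[OF G]] by (simp add: o_def flow_def)
  assume c: "c \<in> charts_at U (flow t y)"
  obtain d where d: "d \<in> charts_at N (pr y)" using charts_at_nonempty[OF N pr_carr[OF y]] by blast
  have ld: "line_chart d \<in> charts_at W (?\<gamma> t)" using d by (intro charts_at_times_line) simp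
  note fl = F_flow[OF y, of t]
  have v: "d_ds N (?\<gamma> t) \<in> tangent_space W (?\<gamma> t)"
    using tmap_tangent[OF U W F flow_carr[OF y], of t "X (flow t y)"] FX[OF flow_carr[OF y]] fl by simp
  have der: "((\<lambda>r. snd (line_chart d) (?\<gamma> r)) has_vector_derivative d_ds N (?\<gamma> t) (line_chart d)) (at t)"
    using d_ds_line_chart[of d N "?\<gamma> t"] d
    by (auto simp: line_chart_simps has_vector_derivative_def intro!: derivative_eq_intros)
  have "((\<lambda>r. snd c (G (?\<gamma> r))) has_vector_derivative tmap W U G (?\<gamma> t) (d_ds N (?\<gamma> t)) c) (at t)"
    by (rule curve_push_forward[OF W U G open_UNIV UNIV_I cont ld _ der v]) (use c in \<open>simp add: flow_def\<close>)
  moreover have "tmap W U G (?\<gamma> t) (d_ds N (?\<gamma> t)) = X (flow t y)"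
    using tmap_G_F[OF flow_carr[OF y] X_tangent[OF flow_carr[OF y]], of t] FX[OF flow_carr[OF y], of t] fl by simp
  ultimately show "((\<lambda>r. snd c (flow r y)) has_vector_derivative X (flow t y) c) (at t)"
    by (simp add: flow_def)
qed

text \<open>The flow exists for all times on all of \<open>U\<close>; the time radius 1 is an
  arbitrary choice.\<close>

lemma local_flow_flow:
  assumes x: "x \<in> carr U"
  shows "local_flow U X x flow"
  unfolding local_flow_def
proof (intro exI conjI)
  have op: "openin (mtop (times_line U)) (carr U \<times> {-1<..<1::real})"
    by (simp add: times_line_def openin_prod_Times_iff carr_def)
  show "smooth_map (open_submanifold (times_line U) (carr U \<times> {-1<..<1})) U (\<lambda>(y, t). flow t y)"
    by (rule smooth_map_open_submanifold[OF smooth_atlas_times_line[OF U] U op joint_flow_smooth])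
  show "openin (mtop U) (carr U)" by (simp add: carr_def)
qed (use x flow_0 flow_curve in auto)

text \<open>Along an integral curve \<open>ht\<close> has derivative 1 and \<open>pr\<close> has
  derivative 0 in charts. Hence \<open>ht\<close> increases by the elapsed time, \<open>pr\<close>
  is constant, and the two together determine the point.\<close>

lemma integral_curve_unique:
  fixes \<gamma> :: "real \<Rightarrow> 'm"
  assumes e: "e > 0" and cont: "continuous_map (top_of_set {-e<..<e}) (mtop U) \<gamma>"
    and der: "\<And>t c. t \<in> {-e<..<e} \<Longrightarrow> c \<in> charts_at U (\<gamma> t) \<Longrightarrow>
      ((\<lambda>r. snd c (\<gamma> r)) has_vector_derivative X (\<gamma> t) c) (at t)"
    and t: "t \<in> {-e<..<e}"
  shows "\<gamma> t = flow t (\<gamma> 0)"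
proof -
  let ?I = "{-e<..<e}"
  have I: "open ?I" "connected ?I" "0 \<in> ?I" using e by auto
  have carr: "\<gamma> r \<in> carr U" if "r \<in> ?I" for r
    using cont that by (auto simp: continuous_map_def carr_def)
  have chart: "\<exists>c. c \<in> charts_at U (\<gamma> r)" if "r \<in> ?I" for r using charts_at_nonempty[OF U carr[OF that]] .
  have h: "((\<lambda>r. ht (\<gamma> r)) has_real_derivative 1) (at r)" if r: "r \<in> ?I" for r
  proof -
    obtain c where c: "c \<in> charts_at U (\<gamma> r)" using chart[OF r] by blast
    show ?thesis
      using curve_smooth_fun[OF U ht_smooth I(1) r cont c der[OF r c] X_tangent[OF carr[OF r]]] dht_X[OF carr[OF r]]
      by simp
  qed
  have "((\<lambda>r. ht (\<gamma> r) - r) has_real_derivative 0) (at r within ?I)" if "r \<in> ?I" for r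
    using DERIV_diff[OF h[OF that] DERIV_ident] by (simp add: has_field_derivative_at_within)
  then obtain k where "\<And>r. r \<in> ?I \<Longrightarrow> ht (\<gamma> r) - r = k"
    using has_field_derivative_zero_constant[of ?I "\<lambda>r. ht (\<gamma> r) - r"] by auto
  from this[OF t] this[OF I(3)] have ht: "ht (\<gamma> t) = ht (\<gamma> 0) + t" by simp
  have cpr: "continuous_map (top_of_set ?I) (mtop N) (\<lambda>r. pr (\<gamma> r))"
    using continuous_map_compose[OF cont smooth_map_continuous[OF pr_smooth]] by (simp add: o_def)
  \<comment> \<open>\<open>pr\<close> takes values in a manifold, so a vanishing derivative gives
    constancy only while the curve stays in one chart of \<open>N\<close>; connectedness of the
    interval makes it global.\<close>
  have "(\<lambda>r. pr (\<gamma> r)) constant_on ?I"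
  proof (rule locally_constant_imp_constant[OF I(2)])
    fix a assume a: "a \<in> ?I"
    obtain c' where c': "c' \<in> charts_at N (pr (\<gamma> a))" using charts_at_nonempty[OF N pr_carr[OF carr[OF a]]] by blast
    then have c'A: "c' \<in> atlas N" by (simp add: charts_at_def)
    let ?J = "{r \<in> ?I. pr (\<gamma> r) \<in> fst c'}"
    have "openin (top_of_set ?I) ?J" using cpr openin_chart_domain[OF N c'A] by (simp add: continuous_map)
    then have J: "open ?J" using I(1) openin_open_eq by blast
    have "a \<in> ?J" using a c' by (simp add: charts_at_def)
    with J obtain d where d: "d > 0" "ball a d \<subseteq> ?J" by (rule openE)
    have "((\<lambda>r. snd c' (pr (\<gamma> r))) has_vector_derivative 0) (at r within ball a d)" if "r \<in> ball a d" for r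
    proof -
      have r: "r \<in> ?I" "c' \<in> charts_at N (pr (\<gamma> r))" using d(2) that c'A by (auto simp: charts_at_def)
      obtain c where c: "c \<in> charts_at U (\<gamma> r)" using chart[OF r(1)] by blast
      show ?thesis
        using curve_push_forward[OF U N pr_smooth I(1) r(1) cont c r(2) der[OF r(1) c] X_tangent[OF carr[OF r(1)]]]
          dpr_X[OF carr[OF r(1)]] by (simp add: has_vector_derivative_at_within)
    qed
    then obtain k where k: "\<And>r. r \<in> ball a d \<Longrightarrow> snd c' (pr (\<gamma> r)) = k"
      using has_vector_derivative_zero_constant[of "ball a d" "\<lambda>r. snd c' (pr (\<gamma> r))"] by auto
    have const: "pr (\<gamma> r) = pr (\<gamma> a)" if r: "r \<in> ball a d" for r
    proof -
      have "c' \<in> charts_at N (pr (\<gamma> r))" using r d(2) c'A by (auto simp: charts_at_def)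
      then have "pr (\<gamma> r) = chart_inv c' (snd c' (pr (\<gamma> r)))" by (rule chart_inv_chart[OF N, symmetric])
      also have "\<dots> = chart_inv c' (snd c' (pr (\<gamma> a)))" using k[OF r] k[of a] d(1) by simp
      also have "\<dots> = pr (\<gamma> a)" by (rule chart_inv_chart[OF N c'])
      finally show ?thesis .
    qed
    show "\<exists>T. openin (top_of_set ?I) T \<and> a \<in> T \<and> (\<forall>x\<in>T. pr (\<gamma> x) = pr (\<gamma> a))"
    proof (intro exI conjI ballI)
      show "openin (top_of_set ?I) (ball a d)" using d(2) by (intro open_subset) auto
      show "a \<in> ball a d" using d(1) by simp
    qed (rule const)
  qed
  then have "pr (\<gamma> t) = pr (\<gamma> 0)" using t I(3) unfolding constant_on_def by metis
  then show ?thesis using GF[OF carr[OF t]] ht by (simp add: flow_def F_eq)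
qed

lemma local_flow_unique:
  assumes "local_flow U X x \<theta>"
  obtains e V where "e > 0" "openin (mtop U) V" "x \<in> V"
    "\<And>y t. y \<in> V \<Longrightarrow> \<bar>t\<bar> < e \<Longrightarrow> \<theta> t y = flow t y"
proof -
  obtain e V where e: "e > 0" and V: "openin (mtop U) V" "x \<in> V"
    and sm: "smooth_map (open_submanifold (times_line U) (V \<times> {-e<..<e})) U (\<lambda>(y, t). \<theta> t y)"
    and 0: "\<And>y. y \<in> V \<Longrightarrow> \<theta> 0 y = y"
    and der: "\<And>y t c. y \<in> V \<Longrightarrow> t \<in> {-e<..<e} \<Longrightarrow> c \<in> charts_at U (\<theta> t y) \<Longrightarrow>
        ((\<lambda>r. snd c (\<theta> r y)) has_vector_derivative X (\<theta> t y) c) (at t)"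
    using assms unfolding local_flow_def by blast
  have "\<theta> t y = flow t y" if y: "y \<in> V" and t: "\<bar>t\<bar> < e" for y t
  proof -
    have yU: "y \<in> topspace (mtop U)" using V y openin_subset by blast
    have "continuous_map (top_of_set {-e<..<e}) (subtopology (prod_topology (mtop U) euclideanreal) (V \<times> {-e<..<e})) (\<lambda>r. (y, r))"
      using y yU by (auto simp: continuous_map_in_subtopology continuous_map_paired)
    from continuous_map_compose[OF this, of "mtop U" "\<lambda>(y, t). \<theta> t y"] smooth_map_continuous[OF sm]
    have "continuous_map (top_of_set {-e<..<e}) (mtop U) (\<lambda>r. \<theta> r y)"
      by (simp add: open_submanifold_def times_line_def o_def)
    moreover have "t \<in> {-e<..<e}" using t by auto
    ultimately show ?thesis using integral_curve_unique[OF e _ der[OF y], of t] 0[OF y] by simp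
  qed
  then show ?thesis using that[OF e V] by blast
qed

section \<open>The Lie derivative through the flow\<close>

text \<open>Some local flow exists, so the chosen one is a local flow. It agrees with
  \<open>flow\<close> on a neighbourhood of \<open>x\<close> for small times, hence so do its
  tangent maps at \<open>x\<close>, and \<open>deriv\<close> depends only on times near 0.\<close>

lemma lie_derivative_flow:
  assumes x: "x \<in> carr U" and vs: "set vs \<subseteq> tangent_space U x"
  shows "lie_derivative U X \<alpha> x vs = deriv (\<lambda>t. pullback U U (flow t) \<alpha> x vs) 0"
proof -
  define \<theta> where "\<theta> = (SOME \<theta>. local_flow U X x \<theta>)"
  have "local_flow U X x \<theta>" unfolding \<theta>_def by (rule someI[of "local_flow U X x", OF local_flow_flow[OF x]])
  then obtain e V where e: "e > 0" and V: "openin (mtop U) V" "x \<in> V"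
    and eq: "\<And>y t. y \<in> V \<Longrightarrow> \<bar>t\<bar> < e \<Longrightarrow> \<theta> t y = flow t y"
    using local_flow_unique by blast
  have "\<alpha> (\<theta> t x) (map (tmap U U (\<theta> t) x) vs) = pullback U U (flow t) \<alpha> x vs" if t: "\<bar>t\<bar> < e" for t
  proof -
    have "tmap U U (\<theta> t) x v = tmap U U (flow t) x v" for v
      by (rule tmap_cong_open[OF U U flow_smooth V x]) (simp add: eq t)
    then show ?thesis using x vs by (simp add: pullback_def eq[OF V(2) t] cong: map_cong)
  qed
  then have "eventually (\<lambda>t. \<alpha> (\<theta> t x) (map (tmap U U (\<theta> t) x) vs) = pullback U U (flow t) \<alpha> x vs) (nhds 0)"
    using e by (auto simp: eventually_nhds_metric intro!: exI[of _ e])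
  from deriv_cong_ev[OF this refl] show ?thesis
    using x vs by (simp add: lie_derivative_def \<theta>_def Let_def)
qed

text \<open>The pullbacks for all times are the restrictions to the slices t = const of a single
  smooth form on the product of \<open>U\<close> with the line. The vectors tangent to the slices
  have coordinates (v c, 0) independent of t, so the function of t is one smooth coefficient along a
  line.\<close>

lemma pullback_flow_differentiable:
  assumes \<alpha>: "\<alpha> \<in> Omega U k" and x: "x \<in> carr U" and vs: "set vs \<subseteq> tangent_space U x"
  shows "(\<lambda>t. pullback U U (flow t) \<alpha> x vs) differentiable (at t)"
proof -
  note LU = smooth_atlas_times_line[OF U]
  let ?\<Theta> = "\<lambda>(x, t). flow t x"
  let ?\<beta> = "pullback (times_line U) U ?\<Theta> \<alpha>"
  note \<beta> = pullback_Omega[OF LU U joint_flow_smooth \<alpha>]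
  obtain c where c: "c \<in> charts_at U x" using charts_at_nonempty[OF U x] by blast
  let ?ws = "map (\<lambda>v. (v c, 0)) vs"
  let ?h = "\<lambda>y. local_form (times_line U) (line_chart c) ?\<beta> y ?ws"
  have lc: "line_chart c \<in> charts_at (times_line U) (x, t)" for t using c by (intro charts_at_times_line) simp
  have eq: "pullback U U (flow t) \<alpha> x vs = ?h (snd c x, t)" for t
  proof -
    have e: "flow t = ?\<Theta> \<circ> (\<lambda>x. (x, t))" by (simp add: fun_eq_iff)
    have vs': "set (map (tmap U (times_line U) (\<lambda>x. (x, t)) x) vs) \<subseteq> tangent_space (times_line U) (x, t)"
      using tmap_tangent[OF U LU smooth_map_slice[OF U] x] by auto
    have "pullback U U (flow t) \<alpha> x vs = pullback U (times_line U) (\<lambda>x. (x, t)) ?\<beta> x vs"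
      unfolding e pullback_compose[OF U LU U smooth_map_slice[OF U] joint_flow_smooth] ..
    also have "\<dots> = ?\<beta> (x, t) (map (tmap U (times_line U) (\<lambda>x. (x, t)) x) vs)"
      using x vs by (simp add: pullback_def[of U])
    also have "\<dots> = local_form (times_line U) (line_chart c) ?\<beta> (snd (line_chart c) (x, t))
        (map (\<lambda>v. v (line_chart c)) (map (tmap U (times_line U) (\<lambda>x. (x, t)) x) vs))"
      by (rule form_eq_local_form[OF LU lc vs'])
    also have "map (\<lambda>v. v (line_chart c)) (map (tmap U (times_line U) (\<lambda>x. (x, t)) x) vs) = ?ws"
      using vs tmap_slice_coord[OF U _ c] by auto
    finally show ?thesis by (simp add: line_chart_simps)
  qed
  have lcA: "line_chart c \<in> atlas (times_line U)" "(snd c x, t) \<in> snd (line_chart c) ` fst (line_chart c)"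
    using lc[of t] by (auto simp: charts_at_def line_chart_simps image_iff intro!: bexI[of _ "(x, t)"])
  have "(?h has_derivative FD ?h (snd c x, t)) (at (snd c x, t))"
    by (rule smooth_on_has_derivative[OF Omega_smooth[OF \<beta> lcA(1)] lcA(2)])
  then have "((\<lambda>t. ?h (snd c x, t)) has_derivative (\<lambda>r. FD ?h (snd c x, t) (0, r))) (at t)"
    by (rule has_derivative_compose[where f = "\<lambda>t. (snd c x, t)" and g = ?h, rotated]) (auto intro!: derivative_eq_intros)
  then show ?thesis unfolding eq differentiable_def by blast
qed

section \<open>The one-parameter group of pullbacks\<close>

lemma pullback_flow_0:
  assumes "\<alpha> \<in> Omega U k" shows "pullback U U (flow 0) \<alpha> = \<alpha>"
  using pullback_cong[OF U U smooth_map_id[OF U], of "flow 0"] pullback_id[OF U assms] flow_0 by simp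

lemma pullback_flow_flow:
  "pullback U U (flow t) (pullback U U (flow h) \<alpha>) = pullback U U (flow (t + h)) \<alpha>"
  unfolding pullback_compose[OF U U U flow_smooth flow_smooth]
  by (rule pullback_cong[OF U U flow_smooth]) (simp add: flow_flow)

text \<open>The definition gives the derivative at time 0. It is applied at the point
  \<open>flow t x\<close> to the transported vectors, and the group law identifies the result with
  the derivative at time \<open>t\<close> at the point \<open>x\<close>.\<close>

lemma pullback_flow_derivative:
  assumes \<alpha>: "\<alpha> \<in> Omega U k" and x: "x \<in> carr U" and vs: "set vs \<subseteq> tangent_space U x"
  shows "((\<lambda>t. pullback U U (flow t) \<alpha> x vs) has_real_derivative
    pullback U U (flow t) (lie_derivative U X \<alpha>) x vs) (at t)"
proof -
  let ?vs = "map (tmap U U (flow t) x) vs"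
  note x' = flow_carr[OF x, of t]
  have vs': "set ?vs \<subseteq> tangent_space U (flow t x)" using tmap_tangent[OF U U flow_smooth x] by auto
  have "(\<lambda>h. pullback U U (flow h) \<alpha> (flow t x) ?vs) differentiable (at 0)"
    by (rule pullback_flow_differentiable[OF \<alpha> x' vs'])
  then have "((\<lambda>h. pullback U U (flow h) \<alpha> (flow t x) ?vs) has_real_derivative
      deriv (\<lambda>h. pullback U U (flow h) \<alpha> (flow t x) ?vs) 0) (at 0)"
    by (auto simp: real_differentiable_def dest: DERIV_imp_deriv)
  then have "((\<lambda>h. pullback U U (flow h) \<alpha> (flow t x) ?vs) has_real_derivative
      lie_derivative U X \<alpha> (flow t x) ?vs) (at 0)"
    by (simp only: lie_derivative_flow[OF x' vs'])
  moreover have "pullback U U (flow h) \<alpha> (flow t x) ?vs = pullback U U (flow (h + t)) \<alpha> x vs" for h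
    using fun_cong[OF fun_cong[OF pullback_flow_flow[of t h \<alpha>]], of x vs] x vs
    by (simp add: pullback_def[of U U "flow t"] add.commute)
  ultimately have "((\<lambda>h. pullback U U (flow (h + t)) \<alpha> x vs) has_real_derivative
      lie_derivative U X \<alpha> (flow t x) ?vs) (at 0)" by simp
  then have "((\<lambda>t. pullback U U (flow t) \<alpha> x vs) has_real_derivative lie_derivative U X \<alpha> (flow t x) ?vs) (at (0 + t))"
    by (subst DERIV_shift)
  then show ?thesis using x vs by (simp add: pullback_def[of U U "flow t" "lie_derivative U X \<alpha>"])
qed

lemma homogeneous_iff_flow:
  assumes \<alpha>: "\<alpha> \<in> Omega U k"
  shows "homogeneous U X n \<alpha> \<longleftrightarrow> (\<forall>t. pullback U U (flow t) \<alpha> = (\<lambda>x vs. exp (n * t) * \<alpha> x vs))"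
proof
  assume hom: "homogeneous U X n \<alpha>"
  have "pullback U U (flow t) \<alpha> x vs = exp (n * t) * \<alpha> x vs" for t x vs
  proof (cases "x \<in> carr U \<and> set vs \<subseteq> tangent_space U x")
    case True
    have "((\<lambda>t. pullback U U (flow t) \<alpha> x vs) has_real_derivative n * pullback U U (flow t) \<alpha> x vs) (at t)" for t
      using pullback_flow_derivative[OF \<alpha>, of x vs t] True hom by (simp add: homogeneous_def pullback_def)
    from exponential_growth[OF this] show ?thesis by (simp add: pullback_flow_0[OF \<alpha>])
  next
    case False
    then have "\<alpha> x vs = 0" by (intro Omega_support[OF \<alpha>]) blast
    then show ?thesis using False by (auto simp: pullback_def)
  qed
  then show "\<forall>t. pullback U U (flow t) \<alpha> = (\<lambda>x vs. exp (n * t) * \<alpha> x vs)" by blast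
next
  assume inv: "\<forall>t. pullback U U (flow t) \<alpha> = (\<lambda>x vs. exp (n * t) * \<alpha> x vs)"
  have "lie_derivative U X \<alpha> x vs = n * \<alpha> x vs" for x vs
  proof (cases "x \<in> carr U \<and> set vs \<subseteq> tangent_space U x")
    case True
    have "((\<lambda>t. exp (n * t) * \<alpha> x vs) has_real_derivative n * \<alpha> x vs) (at 0)"
      by (auto intro!: derivative_eq_intros)
    then show ?thesis using True lie_derivative_flow[of x vs \<alpha>] inv by (simp add: DERIV_imp_deriv)
  next
    case False
    then have "\<alpha> x vs = 0" by (intro Omega_support[OF \<alpha>]) blast
    then show ?thesis using False by (auto simp: lie_derivative_def)
  qed
  then show "homogeneous U X n \<alpha>" by (simp add: homogeneous_def fun_eq_iff)
qed

section \<open>Basic forms\<close>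

definition dht :: "('m, 'e) form" where "dht = ext_deriv U (fun_form U ht)"

lemma dht_single: "dht x [v] = dfun U ht x v"
  by (simp add: dht_def dfun_def)

lemma wedge_dht_Omega: "\<alpha> \<in> Omega U k \<Longrightarrow> wedge1 dht \<alpha> \<in> Omega U (k + 1)"
  unfolding dht_def by (rule wedge1_Omega[OF U ht_smooth])

lemma wedge_dht_Omega': "\<alpha> \<in> Omega U (k - 1) \<Longrightarrow> wedge1 dht \<alpha> \<in> Omega U k"
  using wedge_dht_Omega[of \<alpha> "k - 1"] by simp

definition horizontal :: "('m, 'e) form \<Rightarrow> bool" where
  "horizontal \<beta> \<longleftrightarrow> insertion X \<beta> = zero_form"

definition invariant :: "('m, 'e) form \<Rightarrow> bool" where
  "invariant \<beta> \<longleftrightarrow> (\<forall>t. pullback U U (flow t) \<beta> = \<beta>)"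

lemma horizontalD: "horizontal \<beta> \<Longrightarrow> \<beta> x (X x # vs) = 0"
  by (simp add: horizontal_def insertion_def zero_form_def fun_eq_iff)

text \<open>Invariance is homogeneity of degree 0.\<close>

lemma invariant_iff:
  assumes "\<beta> \<in> Omega U k"
  shows "invariant \<beta> \<longleftrightarrow> lie_derivative U X \<beta> = zero_form"
  using homogeneous_iff_flow[OF assms, of 0] by (auto simp: invariant_def homogeneous_def zero_form_def)

lemma basic_iff:
  assumes "(\<beta>0, \<beta>1) \<in> jsections U k"
  shows "basic U X (\<beta>0, \<beta>1) \<longleftrightarrow> horizontal \<beta>0 \<and> horizontal \<beta>1 \<and> invariant \<beta>0 \<and> invariant \<beta>1"
  using assms invariant_iff by (auto simp: basic_def jsections_def horizontal_def)

text \<open>The time is frozen at - ht x, so this is not the differential of the projection to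
  \<open>N\<close>: the flow preserves the \<open>ht\<close>-component of \<open>v\<close>, which
  survives as a multiple of \<open>X\<close>. Both sides have the same components at
  \<open>pr x\<close>, and \<open>tangent_determined\<close> concludes.\<close>

lemma dflow_to_N:
  assumes x: "x \<in> carr U" and v: "v \<in> tangent_space U x"
  shows "tmap U U (flow (- ht x)) x v =
    (\<lambda>c. 1 *\<^sub>R tmap N U (\<lambda>x. x) (pr x) (tmap U N pr x v) c + dfun U ht x v *\<^sub>R X (pr x) c)"
    (is "?l = (\<lambda>c. 1 *\<^sub>R ?j c + ?a *\<^sub>R X ?q c)")
proof -
  note q = pr_carr[OF x]
  have qU: "?q \<in> carr U" using q NU by blast
  have to_q: "flow (- ht x) x = ?q" by (rule flow_to_N[OF x])
  have w: "tmap U N pr x v \<in> tangent_space N ?q" by (rule tmap_tangent[OF U N pr_smooth x])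
  have jT: "?j \<in> tangent_space U ?q" by (rule tmap_tangent[OF N U inclusion_smooth q])
  have lT: "?l \<in> tangent_space U ?q" using tmap_tangent[OF U U flow_smooth x, of "- ht x" v] to_q by simp
  note XT = X_tangent[OF qU]
  have rT: "(\<lambda>c. 1 *\<^sub>R ?j c + ?a *\<^sub>R X ?q c) \<in> tangent_space U ?q" by (rule tangent_space_combination[OF U jT XT])
  have "tmap N N (\<lambda>x. pr x) ?q (tmap U N pr x v) = tmap N N (\<lambda>x. x) ?q (tmap U N pr x v)"
    by (rule tmap_cong_open[OF N N smooth_map_id[OF N] _ q q]) (use pr_N in \<open>auto simp: carr_def\<close>)
  then have pj: "tmap U N pr ?q ?j = tmap U N pr x v"
    using tmap_compose[OF N U N inclusion_smooth pr_smooth q w] tmap_id[OF N w q] by (simp add: o_def)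
  have "dfun U ht ?q ?j = dfun N (ht \<circ> (\<lambda>x. x)) ?q (tmap U N pr x v)"
    by (rule dfun_tmap[OF N U inclusion_smooth ht_smooth q w])
  also have "\<dots> = dfun N (\<lambda>x. 0) ?q (tmap U N pr x v)" using ht_N by (simp cong: dfun_cong)
  also have "\<dots> = 0"
    using dfun_chain[OF N smooth_fun_const smooth_fun_const, of "\<lambda>r. 0" "\<lambda>r. 0" 0] by simp
  finally have hj: "dfun U ht ?q ?j = 0" .
  obtain c where c: "c \<in> charts_at N ?q" using charts_at_nonempty[OF N q] by blast
  have "tmap U N pr ?q ?l = tmap U N pr x v" using dpr_flow[OF x v, of "- ht x"] to_q by simp
  moreover have "dfun U ht ?q ?l = ?a" using dht_flow[OF x v, of "- ht x"] to_q by simp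
  moreover have "tmap U N pr ?q (\<lambda>c. 1 *\<^sub>R ?j c + ?a *\<^sub>R X ?q c) = tmap U N pr x v"
    unfolding tmap_combination[OF U N pr_smooth qU] by (simp add: pj dpr_X[OF qU])
  moreover have "dfun U ht ?q (\<lambda>c. 1 *\<^sub>R ?j c + ?a *\<^sub>R X ?q c) = 1 * dfun U ht ?q ?j + ?a * dfun U ht ?q (X ?q)"
    using Omega_combination_arg[OF ext_deriv_Omega[OF U fun_form_Omega[OF U ht_smooth]] qU, of "[]" "[]" ?j "X ?q" 1 ?a] jT XT
    by (simp add: dfun_def)
  ultimately show ?thesis
    by (intro tangent_determined[OF qU lT rT]) (simp_all add: hj dht_X[OF qU])
qed

section \<open>Basic forms as pullbacks from the hypersurface\<close>

abbreviation "res \<equiv> pullback N U (\<lambda>x. x)"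

text \<open>Invariance moves the evaluation from \<open>x\<close> to \<open>pr x\<close>. The
  transported vectors differ from the projected ones by multiples of \<open>X\<close>, which a
  horizontal form does not see.\<close>

lemma basic_form_eq_pullback:
  assumes \<beta>: "\<beta> \<in> Omega U k" and hor: "horizontal \<beta>" and inv: "invariant \<beta>"
  shows "pullback U N pr (res \<beta>) = \<beta>"
proof (intro ext)
  fix x vs
  show "pullback U N pr (res \<beta>) x vs = \<beta> x vs"
  proof (cases "x \<in> carr U \<and> set vs \<subseteq> tangent_space U x")
    case True
    then have x: "x \<in> carr U" and vs: "set vs \<subseteq> tangent_space U x" by auto
    let ?q = "pr x" and ?t = "- ht x"
    note q = pr_carr[OF x]
    have qU: "?q \<in> carr U" using q NU by blast
    have to_q: "flow ?t x = ?q" by (rule flow_to_N[OF x])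
    obtain c where c: "c \<in> charts_at U ?q" using charts_at_nonempty[OF U qU] by blast
    let ?a = "local_form U c \<beta> (snd c ?q)"
    let ?j = "\<lambda>v. tmap N U (\<lambda>x. x) ?q (tmap U N pr x v)"
    have cA: "c \<in> atlas U" "snd c ?q \<in> snd c ` fst c" using c by (auto simp: charts_at_def)
    have alt: "alternating_map ?a" by (rule Omega_alternating[OF U \<beta> cA])
    have ker: "?a (X ?q c # ws) = 0" for ws
      using horizontalD[OF hor, of ?q "map (tvec_of U c ?q) ws"]
      by (simp add: local_form_chart[OF U c] tvec_of_inverse[OF U c X_tangent[OF qU]])
    have jT: "set (map ?j vs) \<subseteq> tangent_space U ?q" using tmap_tangent[OF N U inclusion_smooth q] by auto
    have fT: "set (map (tmap U U (flow ?t) x) vs) \<subseteq> tangent_space U ?q"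
      using tmap_tangent[OF U U flow_smooth x, of ?t] to_q by auto
    have "\<beta> x vs = pullback U U (flow ?t) \<beta> x vs" using inv by (simp add: invariant_def)
    also have "\<dots> = \<beta> ?q (map (tmap U U (flow ?t) x) vs)" using x vs to_q by (simp add: pullback_def)
    also have "\<dots> = ?a (map (\<lambda>v. v c) (map (tmap U U (flow ?t) x) vs))"
      by (rule form_eq_local_form[OF U c fT])
    also have "map (\<lambda>v. v c) (map (tmap U U (flow ?t) x) vs) = map (\<lambda>v. ?j v c + dfun U ht x v *\<^sub>R X ?q c) vs"
      using vs dflow_to_N[OF x] by auto
    also have "?a \<dots> = ?a (map (\<lambda>v. ?j v c) vs)"
      using alternating_map_mod_kernel[OF alt ker, of "[]"] by simp
    also have "\<dots> = \<beta> ?q (map ?j vs)"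
      using form_eq_local_form[OF U c jT, of \<beta>] by (simp add: o_def)
    also have "\<dots> = pullback U N pr (res \<beta>) x vs"
    proof -
      have "set (map (tmap U N pr x) vs) \<subseteq> tangent_space N ?q" using tmap_tangent[OF U N pr_smooth x] by auto
      then show ?thesis using x vs q by (simp add: pullback_def o_def)
    qed
    finally show ?thesis by simp
  qed (use Omega_support[OF \<beta>] in \<open>auto simp: pullback_def\<close>)
qed

lemma res_Omega: "\<beta> \<in> Omega U k \<Longrightarrow> res \<beta> \<in> Omega N k"
  by (rule pullback_Omega[OF N U inclusion_smooth])

lemma pullback_pr_Omega: "\<gamma> \<in> Omega N k \<Longrightarrow> pullback U N pr \<gamma> \<in> Omega U k"
  by (rule pullback_Omega[OF U N pr_smooth])

lemma pullback_pr_horizontal: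
  assumes \<gamma>: "\<gamma> \<in> Omega N k"
  shows "horizontal (pullback U N pr \<gamma>)"
proof -
  have "pullback U N pr \<gamma> x (X x # vs) = 0" for x vs
  proof (cases "x \<in> carr U \<and> set (X x # vs) \<subseteq> tangent_space U x")
    case True
    then have x: "x \<in> carr U" by blast
    note q = pr_carr[OF x]
    note T0 = tangent_space_zero[OF N, of "pr x"]
    have "set (map (tmap U N pr x) vs) \<subseteq> tangent_space N (pr x)" using tmap_tangent[OF U N pr_smooth x] by auto
    then have "\<gamma> (pr x) ([] @ (\<lambda>c. 0) # map (tmap U N pr x) vs) = 0"
      using Omega_combination_arg[OF \<gamma> q _ _ T0 T0, of "[]" "map (tmap U N pr x) vs" 0 0] by simp
    then show ?thesis using True by (simp add: pullback_def dpr_X[OF x])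
  qed (auto simp: pullback_def)
  then show ?thesis by (simp add: horizontal_def insertion_def zero_form_def)
qed

lemma pullback_pr_invariant: "invariant (pullback U N pr \<gamma>)"
  unfolding invariant_def pullback_compose[OF U U N flow_smooth pr_smooth]
  by (intro allI pullback_cong[OF U N pr_smooth]) (simp add: pr_flow)

lemma res_pullback_pr:
  assumes "\<gamma> \<in> Omega N k" shows "res (pullback U N pr \<gamma>) = \<gamma>"
  unfolding pullback_compose[OF N U N inclusion_smooth pr_smooth]
  using pullback_cong[OF N N smooth_map_id[OF N], of "pr \<circ> (\<lambda>x. x)" \<gamma>] pr_N pullback_id[OF N assms] by simp

section \<open>The homogeneous function and the map Psi\<close>

text \<open>The restriction matches \<open>one_tilde\<close>, which is chosen among extensional
  functions.\<close>

definition eht :: "'m \<Rightarrow> real" where "eht = restrict (\<lambda>x. exp (ht x)) (carr U)"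

lemma exp_ht_smooth: "smooth_fun U (\<lambda>x. exp (ht x))"
  by (rule smooth_fun_exp[OF U ht_smooth])

lemma dexp_ht: "dfun U (\<lambda>x. exp (ht x)) x v = exp (ht x) * dfun U ht x v"
  by (rule dfun_chain[OF U ht_smooth exp_ht_smooth]) (rule DERIV_exp)

text \<open>For uniqueness, a solution grows exponentially along each flow line, and its value 1 on
  \<open>N\<close> fixes the constant.\<close>

lemma one_tilde_eq: "one_tilde U X (carr N) = eht"
  unfolding one_tilde_def
proof (rule the_equality)
  have "dfun U eht x (X x) = eht x" if x: "x \<in> carr U" for x
  proof -
    have "dfun U eht x (X x) = dfun U (\<lambda>x. exp (ht x)) x (X x)" by (simp add: eht_def cong: dfun_cong)
    then show ?thesis using x by (simp add: dexp_ht dht_X[OF x] eht_def)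
  qed
  moreover have "eht x = 1" if "x \<in> carr N" for x using that NU ht_N by (auto simp: eht_def)
  moreover have "smooth_fun U eht" by (rule smooth_fun_cong[OF U exp_ht_smooth]) (simp add: eht_def)
  ultimately show "smooth_fun U eht \<and> eht \<in> extensional (carr U) \<and>
     (\<forall>x\<in>carr U. vf_apply U X eht x = eht x) \<and> (\<forall>x\<in>carr N. eht x = 1)"
    by (simp add: vf_apply_def dfun_def) (simp add: eht_def)
next
  fix g assume g: "smooth_fun U g \<and> g \<in> extensional (carr U) \<and>
     (\<forall>x\<in>carr U. vf_apply U X g x = g x) \<and> (\<forall>x\<in>carr N. g x = 1)"
  have "g x = exp (ht x)" if x: "x \<in> carr U" for x
  proof -
    have "((\<lambda>r. g (flow r x)) has_real_derivative 1 * g (flow t x)) (at t)" for t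
    proof -
      note x' = flow_carr[OF x, of t]
      obtain c where c: "c \<in> charts_at U (flow t x)" using charts_at_nonempty[OF U x'] by blast
      show ?thesis
        using curve_smooth_fun[OF U _ open_UNIV UNIV_I flow_curve(1)[OF x] c flow_curve(2)[OF x c] X_tangent[OF x'], of g] g x'
        by (simp add: vf_apply_def dfun_def)
    qed
    \<comment> \<open>The time - ht x is the one at which the flow line of \<open>x\<close> meets
      \<open>N\<close>.\<close>
    from exponential_growth[of "\<lambda>r. g (flow r x)", OF this, of "- ht x"]
    have "1 = exp (- ht x) * g x" using g pr_carr[OF x] flow_to_N[OF x] flow_0[OF x] by simp
    then show ?thesis by (simp add: exp_minus field_simps)
  qed
  then show "g = eht" using g by (intro extensionalityI[of g "carr U"]) (auto simp: eht_def)
qed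

lemma dln_eht: "ext_deriv U (fun_form U (\<lambda>x. ln (eht x))) = dht"
proof -
  have "fun_form U (\<lambda>x. ln (eht x)) = fun_form U ht" by (rule fun_form_cong) (simp add: eht_def)
  then show ?thesis by (simp add: dht_def)
qed

section \<open>The decomposition behind \<open>Psi\<close> and its inverse\<close>

definition compose_form :: "('m, 'e) form \<Rightarrow> ('m, 'e) form \<Rightarrow> ('m, 'e) form" where
  "compose_form \<beta>0 \<beta>1 = (\<lambda>x vs. exp (ht x) * (\<beta>0 x vs + wedge1 dht \<beta>1 x vs))"

lemma compose_form_Omega:
  assumes "\<beta>0 \<in> Omega U k" "\<beta>1 \<in> Omega U (k - 1)"
  shows "compose_form \<beta>0 \<beta>1 \<in> Omega U k"
  using Omega_combination[OF U assms(1) wedge_dht_Omega'[OF assms(2)] exp_ht_smooth exp_ht_smooth]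
  by (simp add: compose_form_def distrib_left)

text \<open>Insertion into dht \<and> \<beta>1 gives dht(X) \<beta>1 - dht \<and> i_X \<beta>1,
  where dht(X) = 1 and i_X \<beta>1 = 0. Inserting \<open>X\<close> therefore isolates \<beta>1,
  which is the origin of \<open>part1\<close> and makes the decomposition unique.\<close>

lemma insertion_compose_form:
  assumes \<beta>: "\<beta>0 \<in> Omega U k" "\<beta>1 \<in> Omega U (k - 1)" and hor: "horizontal \<beta>0" "horizontal \<beta>1"
  shows "insertion X (compose_form \<beta>0 \<beta>1) x vs = exp (ht x) * \<beta>1 x vs"
proof (cases "x \<in> carr U")
  case True
  have "wedge1 dht (insertion X \<beta>1) x vs = 0"
    using hor(2) by (simp add: wedge1_def horizontal_def zero_form_def)
  then show ?thesis
    using horizontalD[OF hor(1)]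
    by (simp add: insertion_def[where \<alpha> = "compose_form \<beta>0 \<beta>1"])
      (simp add: compose_form_def wedge1_insertion dht_single dht_X[OF True])
next
  case False
  then have "\<beta>1 x vs = 0" "compose_form \<beta>0 \<beta>1 x (X x # vs) = 0"
    by (auto intro: Omega_support[OF \<beta>(2)] Omega_support[OF compose_form_Omega[OF \<beta>]])
  then show ?thesis by (simp add: insertion_def)
qed

definition part1 :: "('m, 'e) form \<Rightarrow> ('m, 'e) form" where
  "part1 \<alpha> = (\<lambda>x vs. exp (- ht x) * insertion X \<alpha> x vs)"

definition part0 :: "('m, 'e) form \<Rightarrow> ('m, 'e) form" where
  "part0 \<alpha> = (\<lambda>x vs. exp (- ht x) * \<alpha> x vs - wedge1 dht (part1 \<alpha>) x vs)"

lemma exp_minus_ht_smooth: "smooth_fun U (\<lambda>x. exp (- ht x))"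
  using smooth_fun_exp[OF U smooth_fun_scale[OF U ht_smooth, of "-1"]] by simp

lemma part1_Omega: "\<alpha> \<in> Omega U k \<Longrightarrow> part1 \<alpha> \<in> Omega U (k - 1)"
  unfolding part1_def by (rule Omega_scale[OF U insertion_Omega[OF U X] exp_minus_ht_smooth])

lemma part0_Omega: "\<alpha> \<in> Omega U k \<Longrightarrow> part0 \<alpha> \<in> Omega U k"
  using Omega_combination[OF U _ wedge_dht_Omega'[OF part1_Omega] exp_minus_ht_smooth smooth_fun_const[of U "-1"]]
  by (simp add: part0_def)

lemma compose_parts: "compose_form (part0 \<alpha>) (part1 \<alpha>) = \<alpha>"
  by (simp add: compose_form_def part0_def exp_minus fun_eq_iff)

lemma part1_horizontal:
  assumes \<alpha>: "\<alpha> \<in> Omega U k"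
  shows "horizontal (part1 \<alpha>)"
proof -
  have "\<alpha> x (X x # X x # vs) = 0" for x vs
    by (cases "x \<in> carr U") (auto intro: Omega_distinct[OF \<alpha>] Omega_support[OF \<alpha>])
  then show ?thesis by (simp add: horizontal_def part1_def insertion_def zero_form_def)
qed

lemma part0_horizontal:
  assumes \<alpha>: "\<alpha> \<in> Omega U k"
  shows "horizontal (part0 \<alpha>)"
proof -
  have "part0 \<alpha> x (X x # vs) = 0" for x vs
  proof (cases "x \<in> carr U")
    case True
    have "wedge1 dht (insertion X (part1 \<alpha>)) x vs = 0"
      using part1_horizontal[OF \<alpha>] by (simp add: wedge1_def horizontal_def zero_form_def)
    then show ?thesis
      by (simp add: part0_def wedge1_insertion dht_single dht_X[OF True]) (simp add: part1_def insertion_def)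
  qed (auto intro: Omega_support[OF part0_Omega[OF \<alpha>]])
  then show ?thesis by (simp add: horizontal_def insertion_def zero_form_def)
qed

lemma compose_form_unique:
  assumes \<beta>: "\<beta>0 \<in> Omega U k" "\<beta>1 \<in> Omega U (k - 1)" and hor: "horizontal \<beta>0" "horizontal \<beta>1"
  shows "part0 (compose_form \<beta>0 \<beta>1) = \<beta>0" "part1 (compose_form \<beta>0 \<beta>1) = \<beta>1"
proof -
  show 1: "part1 (compose_form \<beta>0 \<beta>1) = \<beta>1"
    by (simp add: part1_def insertion_compose_form[OF assms] exp_minus fun_eq_iff)
  show "part0 (compose_form \<beta>0 \<beta>1) = \<beta>0"
    unfolding part0_def 1 by (simp add: compose_form_def exp_minus fun_eq_iff mult.assoc[symmetric])
qed

lemma Psi_eq: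
  assumes \<alpha>: "\<alpha> \<in> Omega U k"
  shows "Psi U X (carr N) k \<alpha> = (part0 \<alpha>, part1 \<alpha>)"
proof -
  \<comment> \<open>Outside \<open>carr U\<close> the value of \<open>eht\<close> is the default of
    \<open>restrict\<close>, but the forms it multiplies vanish there, so it may be exchanged for
    exp \<circ> ht.\<close>
  have decomp: "(\<alpha> = (\<lambda>x vs. eht x * (\<beta>0 x vs + wedge1 dht \<beta>1 x vs))) = (\<alpha> = compose_form \<beta>0 \<beta>1)"
    if "(\<beta>0, \<beta>1) \<in> jsections U k" for \<beta>0 \<beta>1
  proof -
    have "eht x * (\<beta>0 x vs + wedge1 dht \<beta>1 x vs) = compose_form \<beta>0 \<beta>1 x vs" for x vs
    proof (cases "x \<in> carr U")
      case False
      then have "\<beta>0 x vs = 0" "wedge1 dht \<beta>1 x vs = 0"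
        using that by (auto simp: jsections_def intro: Omega_support wedge_dht_Omega')
      then show ?thesis by (simp add: compose_form_def)
    qed (simp add: compose_form_def eht_def)
    then show ?thesis by (simp add: fun_eq_iff)
  qed
  show ?thesis
    unfolding Psi_def Let_def one_tilde_eq dln_eht
  proof (rule the_equality)
    show "case (part0 \<alpha>, part1 \<alpha>) of (\<beta>0, \<beta>1) \<Rightarrow> (\<beta>0, \<beta>1) \<in> jsections U k \<and>
       insertion X \<beta>0 = zero_form \<and> insertion X \<beta>1 = zero_form \<and>
       \<alpha> = (\<lambda>x vs. eht x * (\<beta>0 x vs + wedge1 dht \<beta>1 x vs))"
      using decomp[of "part0 \<alpha>" "part1 \<alpha>"] part0_Omega[OF \<alpha>] part1_Omega[OF \<alpha>] part0_horizontal[OF \<alpha>]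
        part1_horizontal[OF \<alpha>] compose_parts[of \<alpha>] by (simp add: jsections_def horizontal_def)
  next
    fix p assume "case p of (\<beta>0, \<beta>1) \<Rightarrow> (\<beta>0, \<beta>1) \<in> jsections U k \<and>
       insertion X \<beta>0 = zero_form \<and> insertion X \<beta>1 = zero_form \<and>
       \<alpha> = (\<lambda>x vs. eht x * (\<beta>0 x vs + wedge1 dht \<beta>1 x vs))"
    then obtain \<beta>0 \<beta>1 where p: "p = (\<beta>0, \<beta>1)" and j: "(\<beta>0, \<beta>1) \<in> jsections U k"
      and h: "horizontal \<beta>0" "horizontal \<beta>1"
      and e: "\<alpha> = (\<lambda>x vs. eht x * (\<beta>0 x vs + wedge1 dht \<beta>1 x vs))"
      by (cases p) (auto simp: horizontal_def)
    have "\<alpha> = compose_form \<beta>0 \<beta>1" using e decomp[OF j] by simp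
    then show "p = (part0 \<alpha>, part1 \<alpha>)"
      using compose_form_unique[of \<beta>0 k \<beta>1] j h by (simp add: p jsections_def)
  qed
qed

subsection \<open>Invariance under the flow\<close>

lemma pullback_flow_wedge_dht:
  assumes \<beta>: "\<beta> \<in> Omega U k"
  shows "pullback U U (flow t) (wedge1 dht \<beta>) = wedge1 dht (pullback U U (flow t) \<beta>)"
proof (intro ext)
  fix x vs
  show "pullback U U (flow t) (wedge1 dht \<beta>) x vs = wedge1 dht (pullback U U (flow t) \<beta>) x vs"
  proof (cases "x \<in> carr U \<and> set vs \<subseteq> tangent_space U x")
    case True
    then have x: "x \<in> carr U" and vs: "set vs \<subseteq> tangent_space U x" by auto
    have "dht (flow t x) [map (tmap U U (flow t) x) vs ! i] * \<beta> (flow t x) (omit i (map (tmap U U (flow t) x) vs)) =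
        dht x [vs ! i] * pullback U U (flow t) \<beta> x (omit i vs)" if i: "i < length vs" for i
    proof -
      have v: "vs ! i \<in> tangent_space U x" using vs i by auto
      have o: "set (omit i vs) \<subseteq> tangent_space U x" using vs set_omit_subset[of i vs] by blast
      show ?thesis using x i o dht_flow[OF x v, of t] by (simp add: dht_single pullback_def map_omit)
    qed
    then show ?thesis
      using x vs unfolding pullback_def[of U U "flow t" "wedge1 dht \<beta>"] by (simp add: wedge1_def mult.assoc)
  next
    case False
    then have "wedge1 dht (pullback U U (flow t) \<beta>) x vs = 0"
      by (intro Omega_support[OF wedge_dht_Omega[OF pullback_Omega[OF U U flow_smooth \<beta>]]]) auto
    then show ?thesis using False by (auto simp: pullback_def)
  qed
qed

text \<open>The flow preserves \<open>X\<close>, by \<open>tmap_flow_X\<close>.\<close>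

lemma pullback_flow_insertion:
  assumes \<alpha>: "\<alpha> \<in> Omega U k"
  shows "pullback U U (flow t) (insertion X \<alpha>) = insertion X (pullback U U (flow t) \<alpha>)"
  using X_tangent by (auto simp: pullback_def insertion_def tmap_flow_X intro!: ext)

lemma pullback_flow_scale:
  "pullback U U (flow t) (\<lambda>x vs. g x * \<alpha> x vs) x vs = g (flow t x) * pullback U U (flow t) \<alpha> x vs"
  by (simp add: pullback_def)

lemma homogeneous_iff: "\<alpha> \<in> Omega U k \<Longrightarrow>
  homogeneous U X 1 \<alpha> \<longleftrightarrow> (\<forall>t. pullback U U (flow t) \<alpha> = (\<lambda>x vs. exp t * \<alpha> x vs))"
  using homogeneous_iff_flow[of \<alpha> k 1] by simp

lemma compose_form_homogeneous:
  assumes \<beta>: "\<beta>0 \<in> Omega U k" "\<beta>1 \<in> Omega U (k - 1)" and inv: "invariant \<beta>0" "invariant \<beta>1"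
  shows "homogeneous U X 1 (compose_form \<beta>0 \<beta>1)"
proof -
  have "pullback U U (flow t) (compose_form \<beta>0 \<beta>1) x vs = exp t * compose_form \<beta>0 \<beta>1 x vs" for t x vs
  proof (cases "x \<in> carr U \<and> set vs \<subseteq> tangent_space U x")
    case True
    have "pullback U U (flow t) (compose_form \<beta>0 \<beta>1) x vs =
       exp (ht (flow t x)) * (pullback U U (flow t) \<beta>0 x vs + pullback U U (flow t) (wedge1 dht \<beta>1) x vs)"
      by (simp add: pullback_def compose_form_def)
    also have "\<dots> = exp (ht x + t) * (\<beta>0 x vs + wedge1 dht \<beta>1 x vs)"
      using inv True by (simp add: invariant_def pullback_flow_wedge_dht[OF \<beta>(2)] ht_flow)
    finally show ?thesis by (simp add: compose_form_def exp_add)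
  next
    case False
    then have "compose_form \<beta>0 \<beta>1 x vs = 0" by (intro Omega_support[OF compose_form_Omega[OF \<beta>]]) auto
    then show ?thesis using False by (auto simp: pullback_def)
  qed
  then show ?thesis by (simp add: homogeneous_iff[OF compose_form_Omega[OF \<beta>]] fun_eq_iff)
qed

lemma parts_invariant:
  assumes \<alpha>: "\<alpha> \<in> Omega U k" and hom: "homogeneous U X 1 \<alpha>"
  shows "invariant (part0 \<alpha>)" "invariant (part1 \<alpha>)"
proof -
  have pb: "pullback U U (flow t) \<alpha> = (\<lambda>x vs. exp t * \<alpha> x vs)" for t using hom homogeneous_iff[OF \<alpha>] by blast
  have 1: "pullback U U (flow t) (part1 \<alpha>) x vs = part1 \<alpha> x vs" for t x vs
  proof (cases "x \<in> carr U")
    case True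
    have "pullback U U (flow t) (part1 \<alpha>) x vs = exp (- ht (flow t x)) * insertion X (pullback U U (flow t) \<alpha>) x vs"
      unfolding part1_def pullback_flow_scale pullback_flow_insertion[OF \<alpha>] ..
    then show ?thesis using True by (simp add: pb insertion_def part1_def ht_flow exp_add exp_minus exp_diff field_simps)
  next
    case False
    then have "part1 \<alpha> x vs = 0" by (intro Omega_support[OF part1_Omega[OF \<alpha>]]) auto
    then show ?thesis using False by (simp add: pullback_def)
  qed
  then show inv1: "invariant (part1 \<alpha>)" by (simp add: invariant_def fun_eq_iff)
  have "pullback U U (flow t) (part0 \<alpha>) x vs = part0 \<alpha> x vs" for t x vs
  proof (cases "x \<in> carr U")
    case True
    have "pullback U U (flow t) (part0 \<alpha>) x vs =
        exp (- ht (flow t x)) * pullback U U (flow t) \<alpha> x vs - pullback U U (flow t) (wedge1 dht (part1 \<alpha>)) x vs"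
      by (simp add: part0_def pullback_def)
    then show ?thesis
      using True inv1 by (simp add: pb pullback_flow_wedge_dht[OF part1_Omega[OF \<alpha>]] invariant_def part0_def ht_flow
          exp_add exp_minus exp_diff field_simps)
  next
    case False
    then have "part0 \<alpha> x vs = 0" by (intro Omega_support[OF part0_Omega[OF \<alpha>]]) auto
    then show ?thesis using False by (simp add: pullback_def)
  qed
  then show "invariant (part0 \<alpha>)" by (simp add: invariant_def fun_eq_iff)
qed

section \<open>The correspondences\<close>

abbreviation "hom_forms k \<equiv> {\<alpha> \<in> Omega U k. homogeneous U X 1 \<alpha>}"

lemma bij_betw_Psi: "bij_betw (Psi U X (carr N) k) (hom_forms k) {p \<in> jsections U k. basic U X p}"
proof (rule bij_betwI[where g = "\<lambda>(\<beta>0, \<beta>1). compose_form \<beta>0 \<beta>1"])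
  show "Psi U X (carr N) k \<in> hom_forms k \<rightarrow> {p \<in> jsections U k. basic U X p}"
  proof
    fix \<alpha> assume "\<alpha> \<in> hom_forms k"
    then have \<alpha>: "\<alpha> \<in> Omega U k" and hom: "homogeneous U X 1 \<alpha>" by auto
    have j: "(part0 \<alpha>, part1 \<alpha>) \<in> jsections U k"
      using part0_Omega[OF \<alpha>] part1_Omega[OF \<alpha>] by (simp add: jsections_def)
    then show "Psi U X (carr N) k \<alpha> \<in> {p \<in> jsections U k. basic U X p}"
      using basic_iff[OF j] parts_invariant[OF \<alpha> hom] part0_horizontal[OF \<alpha>] part1_horizontal[OF \<alpha>]
      by (simp add: Psi_eq[OF \<alpha>])
  qed
  show "(\<lambda>(\<beta>0, \<beta>1). compose_form \<beta>0 \<beta>1) \<in> {p \<in> jsections U k. basic U X p} \<rightarrow> hom_forms k"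
    using basic_iff compose_form_Omega compose_form_homogeneous by (auto simp: jsections_def)
  show "(\<lambda>(\<beta>0, \<beta>1). compose_form \<beta>0 \<beta>1) (Psi U X (carr N) k \<alpha>) = \<alpha>" if "\<alpha> \<in> hom_forms k" for \<alpha>
    using that by (simp add: Psi_eq compose_parts)
  show "Psi U X (carr N) k ((\<lambda>(\<beta>0, \<beta>1). compose_form \<beta>0 \<beta>1) p) = p"
    if p: "p \<in> {p \<in> jsections U k. basic U X p}" for p
  proof -
    obtain \<beta>0 \<beta>1 where pe: "p = (\<beta>0, \<beta>1)" by (cases p)
    then have j: "(\<beta>0, \<beta>1) \<in> jsections U k" and b: "horizontal \<beta>0" "horizontal \<beta>1" using p basic_iff by auto
    then have O: "\<beta>0 \<in> Omega U k" "\<beta>1 \<in> Omega U (k - 1)" by (auto simp: jsections_def)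
    show ?thesis using Psi_eq[OF compose_form_Omega[OF O]] compose_form_unique[OF O b] by (simp add: pe)
  qed
qed

text \<open>On \<open>N\<close> the height is 0, so the factor exp \<circ> ht is 1 and dht vanishes
  on vectors tangent to \<open>N\<close>, which removes the wedge term. Thus \<open>Psi_N\<close> is
  \<open>Psi\<close> followed by restriction, and statements about \<open>Psi\<close> carry
  over.\<close>

lemma Psi_N_eq:
  assumes \<alpha>: "\<alpha> \<in> Omega U k"
  shows "Psi_N U X N \<alpha> = (res (part0 \<alpha>), res (part1 \<alpha>))"
proof -
  have "res \<alpha> x vs = res (part0 \<alpha>) x vs" for x vs
  proof (cases "x \<in> carr N \<and> set vs \<subseteq> tangent_space N x")
    case True
    then have x: "x \<in> carr N" and vs: "set vs \<subseteq> tangent_space N x" by auto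
    have "dfun U ht x (tmap N U (\<lambda>x. x) x v) = 0" if v: "v \<in> tangent_space N x" for v
    proof -
      have "dfun U ht x (tmap N U (\<lambda>x. x) x v) = dfun N (ht \<circ> (\<lambda>x. x)) x v"
        by (rule dfun_tmap[OF N U inclusion_smooth ht_smooth x v])
      also have "\<dots> = dfun N (\<lambda>x. 0) x v" using ht_N by (simp cong: dfun_cong)
      also have "\<dots> = 0" using dfun_chain[OF N smooth_fun_const smooth_fun_const, of "\<lambda>r. 0" "\<lambda>r. 0" 0] by simp
      finally show ?thesis .
    qed
    then have "wedge1 dht (part1 \<alpha>) x (map (tmap N U (\<lambda>x. x) x) vs) = 0"
      unfolding wedge1_def using vs by (intro sum.neutral) (auto simp: dht_single subset_iff)
    then show ?thesis using x vs by (simp add: pullback_def part0_def ht_N)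
  qed (auto simp: pullback_def)
  moreover have "res (insertion X \<alpha>) x vs = res (part1 \<alpha>) x vs" for x vs
    by (simp add: pullback_def part1_def ht_N)
  ultimately show ?thesis by (simp add: Psi_N_def fun_eq_iff)
qed

lemma bij_betw_Psi_N: "bij_betw (Psi_N U X N) (hom_forms k) (jsections N k)"
proof (rule bij_betwI[where g = "\<lambda>(\<gamma>0, \<gamma>1). compose_form (pullback U N pr \<gamma>0) (pullback U N pr \<gamma>1)"])
  show "Psi_N U X N \<in> hom_forms k \<rightarrow> jsections N k"
    using Psi_N_eq part0_Omega part1_Omega by (auto simp: jsections_def intro!: res_Omega)
  show "(\<lambda>(\<gamma>0, \<gamma>1). compose_form (pullback U N pr \<gamma>0) (pullback U N pr \<gamma>1)) \<in> jsections N k \<rightarrow> hom_forms k"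
    by (auto simp: jsections_def intro!: compose_form_Omega compose_form_homogeneous pullback_pr_Omega pullback_pr_invariant)
  show "(\<lambda>(\<gamma>0, \<gamma>1). compose_form (pullback U N pr \<gamma>0) (pullback U N pr \<gamma>1)) (Psi_N U X N \<alpha>) = \<alpha>"
    if "\<alpha> \<in> hom_forms k" for \<alpha>
  proof -
    have \<alpha>: "\<alpha> \<in> Omega U k" and hom: "homogeneous U X 1 \<alpha>" using that by auto
    show ?thesis
      using basic_form_eq_pullback[OF part0_Omega[OF \<alpha>] part0_horizontal[OF \<alpha>] parts_invariant(1)[OF \<alpha> hom]]
        basic_form_eq_pullback[OF part1_Omega[OF \<alpha>] part1_horizontal[OF \<alpha>] parts_invariant(2)[OF \<alpha> hom]]
      by (simp add: Psi_N_eq[OF \<alpha>] compose_parts)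
  qed
  show "Psi_N U X N ((\<lambda>(\<gamma>0, \<gamma>1). compose_form (pullback U N pr \<gamma>0) (pullback U N pr \<gamma>1)) p) = p"
    if p: "p \<in> jsections N k" for p
  proof -
    obtain \<gamma>0 \<gamma>1 where pe: "p = (\<gamma>0, \<gamma>1)" by (cases p)
    then have \<gamma>: "\<gamma>0 \<in> Omega N k" "\<gamma>1 \<in> Omega N (k - 1)" using p by (auto simp: jsections_def)
    note O = pullback_pr_Omega[OF \<gamma>(1)] pullback_pr_Omega[OF \<gamma>(2)]
    show ?thesis
      using Psi_N_eq[OF compose_form_Omega[OF O]]
        compose_form_unique[OF O pullback_pr_horizontal[OF \<gamma>(1)] pullback_pr_horizontal[OF \<gamma>(2)]]
        res_pullback_pr[OF \<gamma>(1)] res_pullback_pr[OF \<gamma>(2)]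
      by (simp add: pe)
  qed
qed

section \<open>The differential of a homogeneous form\<close>

lemma wedge_dexp_ht:
  "wedge1 (ext_deriv U (fun_form U (\<lambda>x. exp (ht x)))) \<alpha> x vs = exp (ht x) * wedge1 dht \<alpha> x vs"
  using dexp_ht by (simp add: wedge1_def dht_def dfun_def sum_distrib_left mult_ac)

text \<open>With \<open>f = exp \<circ> ht\<close> one has \<open>f dht = df\<close>, so the form composed from \<open>\<beta>0\<close> and \<open>\<beta>1\<close> is
  \<open>f \<beta>0 + d(f \<beta>1) - f d\<beta>1\<close>: Leibniz' rule for functions and \<open>d \<circ> d = 0\<close> suffice.\<close>

lemma ext_deriv_compose_form:
  assumes \<beta>: "\<beta>0 \<in> Omega U k" "\<beta>1 \<in> Omega U (k - 1)"
  shows "ext_deriv U (compose_form \<beta>0 \<beta>1) =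
    compose_form (ext_deriv U \<beta>0) (\<lambda>x vs. - ext_deriv U \<beta>1 x vs + \<beta>0 x vs)"
proof (intro ext)
  fix x vs
  let ?f = "\<lambda>x. exp (ht x)"
  have d\<beta>1: "ext_deriv U \<beta>1 \<in> Omega U k" using ext_deriv_Omega[OF U \<beta>(2)] by simp
  have f\<beta>1: "(\<lambda>x vs. ?f x * \<beta>1 x vs) \<in> Omega U (k - 1)" by (rule Omega_scale[OF U \<beta>(2) exp_ht_smooth])
  have df\<beta>1: "ext_deriv U (\<lambda>x vs. ?f x * \<beta>1 x vs) \<in> Omega U k" using ext_deriv_Omega[OF U f\<beta>1] by simp
  have fd\<beta>1: "(\<lambda>x vs. ?f x * ext_deriv U \<beta>1 x vs) \<in> Omega U k" by (rule Omega_scale[OF U d\<beta>1 exp_ht_smooth])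
  have f\<beta>0: "(\<lambda>x vs. ?f x * \<beta>0 x vs) \<in> Omega U k" by (rule Omega_scale[OF U \<beta>(1) exp_ht_smooth])
  let ?\<mu> = "\<lambda>x vs. 1 * ext_deriv U (\<lambda>x vs. ?f x * \<beta>1 x vs) x vs + (-1) * (?f x * ext_deriv U \<beta>1 x vs)"
  have \<mu>: "?\<mu> \<in> Omega U k" by (rule Omega_combination[OF U df\<beta>1 fd\<beta>1 smooth_fun_const smooth_fun_const])
  have "compose_form \<beta>0 \<beta>1 = (\<lambda>x vs. 1 * (?f x * \<beta>0 x vs) + 1 * ?\<mu> x vs)"
    by (simp add: compose_form_def ext_deriv_scale[OF U exp_ht_smooth \<beta>(2)] wedge_dexp_ht fun_eq_iff distrib_left)
  then have "ext_deriv U (compose_form \<beta>0 \<beta>1) x vs =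
      1 * ext_deriv U (\<lambda>x vs. ?f x * \<beta>0 x vs) x vs + 1 * ext_deriv U ?\<mu> x vs"
    by (simp only: ext_deriv_combination[OF U f\<beta>0 \<mu>, of 1 1])
  also have "ext_deriv U ?\<mu> x vs = - ext_deriv U (\<lambda>x vs. ?f x * ext_deriv U \<beta>1 x vs) x vs"
    using ext_deriv_combination[OF U df\<beta>1 fd\<beta>1, of 1 "-1"] ext_deriv_twice[OF U f\<beta>1] by simp
  also have "ext_deriv U (\<lambda>x vs. ?f x * ext_deriv U \<beta>1 x vs) x vs = ?f x * wedge1 dht (ext_deriv U \<beta>1) x vs"
    using ext_deriv_scale[OF U exp_ht_smooth d\<beta>1] ext_deriv_twice[OF U \<beta>(2)] by (simp add: wedge_dexp_ht)
  also have "ext_deriv U (\<lambda>x vs. ?f x * \<beta>0 x vs) x vs = ?f x * wedge1 dht \<beta>0 x vs + ?f x * ext_deriv U \<beta>0 x vs"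
    using ext_deriv_scale[OF U exp_ht_smooth \<beta>(1)] by (simp add: wedge_dexp_ht)
  finally have d: "ext_deriv U (compose_form \<beta>0 \<beta>1) x vs =
      1 * (?f x * wedge1 dht \<beta>0 x vs + ?f x * ext_deriv U \<beta>0 x vs) +
      1 * - (?f x * wedge1 dht (ext_deriv U \<beta>1) x vs)" .
  have w: "wedge1 dht (\<lambda>x vs. - ext_deriv U \<beta>1 x vs + \<beta>0 x vs) x vs =
      wedge1 dht \<beta>0 x vs - wedge1 dht (ext_deriv U \<beta>1) x vs"
    using wedge1_combination[of dht "-1" "ext_deriv U \<beta>1" 1 \<beta>0 x vs] by simp
  show "ext_deriv U (compose_form \<beta>0 \<beta>1) x vs =
      compose_form (ext_deriv U \<beta>0) (\<lambda>x vs. - ext_deriv U \<beta>1 x vs + \<beta>0 x vs) x vs"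
    unfolding d unfolding compose_form_def w by (simp add: algebra_simps)
qed

lemma ext_deriv_basic_horizontal:
  assumes \<beta>: "\<beta> \<in> Omega U k" "horizontal \<beta>" "invariant \<beta>"
  shows "horizontal (ext_deriv U \<beta>)"
proof -
  have "ext_deriv U \<beta> = pullback U N pr (ext_deriv N (res \<beta>))"
    using ext_deriv_pullback[OF U N pr_smooth res_Omega[OF \<beta>(1)]] basic_form_eq_pullback[OF \<beta>] by simp
  then show ?thesis using pullback_pr_horizontal[OF ext_deriv_Omega[OF N res_Omega[OF \<beta>(1)]]] by simp
qed

lemma parts_ext_deriv:
  assumes \<alpha>: "\<alpha> \<in> Omega U k" and hom: "homogeneous U X 1 \<alpha>"
  shows "part0 (ext_deriv U \<alpha>) = ext_deriv U (part0 \<alpha>)"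
    and "part1 (ext_deriv U \<alpha>) = (\<lambda>x vs. - ext_deriv U (part1 \<alpha>) x vs + part0 \<alpha> x vs)"
proof -
  let ?\<beta>0 = "part0 \<alpha>" and ?\<beta>1 = "part1 \<alpha>"
  let ?\<delta> = "\<lambda>x vs. - ext_deriv U ?\<beta>1 x vs + ?\<beta>0 x vs"
  note \<beta> = part0_Omega[OF \<alpha>] part1_Omega[OF \<alpha>]
  have d1: "ext_deriv U ?\<beta>1 \<in> Omega U k" using ext_deriv_Omega[OF U \<beta>(2)] by simp
  have d0: "ext_deriv U ?\<beta>0 \<in> Omega U (k + 1)" by (rule ext_deriv_Omega[OF U \<beta>(1)])
  \<comment> \<open>The degree is left as k + 1 - 1 because \<open>compose_form_unique\<close> is
    used for a composed form of degree k + 1.\<close>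
  have \<delta>: "?\<delta> \<in> Omega U (k + 1 - 1)"
    using Omega_combination[OF U d1 \<beta>(1) smooth_fun_const[of U "-1"] smooth_fun_const[of U 1]] by simp
  have h0: "horizontal (ext_deriv U ?\<beta>0)"
    by (rule ext_deriv_basic_horizontal[OF \<beta>(1) part0_horizontal[OF \<alpha>] parts_invariant(1)[OF \<alpha> hom]])
  have h1: "horizontal (ext_deriv U ?\<beta>1)"
    by (rule ext_deriv_basic_horizontal[OF \<beta>(2) part1_horizontal[OF \<alpha>] parts_invariant(2)[OF \<alpha> hom]])
  have h\<delta>: "horizontal ?\<delta>"
    using horizontalD[OF h1] horizontalD[OF part0_horizontal[OF \<alpha>]]
    by (simp add: horizontal_def insertion_def zero_form_def fun_eq_iff)
  have "ext_deriv U \<alpha> = compose_form (ext_deriv U ?\<beta>0) ?\<delta>"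
    using ext_deriv_compose_form[OF \<beta>] by (simp add: compose_parts)
  then show "part0 (ext_deriv U \<alpha>) = ext_deriv U ?\<beta>0" "part1 (ext_deriv U \<alpha>) = ?\<delta>"
    using compose_form_unique[OF d0 \<delta> h0 h\<delta>] by simp_all
qed

lemma Psi_ext_deriv:
  assumes \<alpha>: "\<alpha> \<in> Omega U k" and hom: "homogeneous U X 1 \<alpha>"
  shows "Psi U X (carr N) (k + 1) (ext_deriv U \<alpha>) = jacobi_deriv U (Psi U X (carr N) k \<alpha>)"
  by (simp add: Psi_eq[OF ext_deriv_Omega[OF U \<alpha>]] Psi_eq[OF \<alpha>] parts_ext_deriv[OF \<alpha> hom] jacobi_deriv_def)

lemma Psi_N_ext_deriv:
  assumes \<alpha>: "\<alpha> \<in> Omega U k" and hom: "homogeneous U X 1 \<alpha>"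
  shows "Psi_N U X N (ext_deriv U \<alpha>) = jacobi_deriv N (Psi_N U X N \<alpha>)"
proof -
  have r: "res (ext_deriv U \<beta>) = ext_deriv N (res \<beta>)" if "\<beta> \<in> Omega U l" for \<beta> l
    using ext_deriv_pullback[OF N U inclusion_smooth that] by simp
  have "res (\<lambda>x vs. - ext_deriv U (part1 \<alpha>) x vs + part0 \<alpha> x vs) =
      (\<lambda>x vs. - ext_deriv N (res (part1 \<alpha>)) x vs + res (part0 \<alpha>) x vs)"
    unfolding r[OF part1_Omega[OF \<alpha>], symmetric] by (simp add: pullback_def fun_eq_iff)
  then show ?thesis
    by (simp add: Psi_N_eq[OF ext_deriv_Omega[OF U \<alpha>]] Psi_N_eq[OF \<alpha>] parts_ext_deriv[OF \<alpha> hom] jacobi_deriv_def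
        r[OF part0_Omega[OF \<alpha>]])
qed

end

section \<open>Restriction of vector fields to open subsets\<close>

text \<open>The identity maps \<open>M\<close> into the submanifold only if \<open>V\<close>
  contains \<open>carr M\<close>, so the lemmas on tangent maps of smooth maps do not apply to it;
  the definition of \<open>tmap\<close> is unfolded and refers to the germ at \<open>x\<close>
  alone.\<close>

lemma vf_restrict_chart:
  assumes M: "smooth_atlas M" and X: "vector_field M X" and c: "c \<in> atlas M" and x: "x \<in> fst c \<inter> V"
  shows "vf_restrict M V X x (fst c \<inter> V, snd c) = X x c"
proof -
  have c': "c \<in> charts_at M x" using c x by (simp add: charts_at_def)
  have xM: "x \<in> carr M" by (rule charts_at_carr[OF M c'])
  let ?s = "some_chart M x"
  note s = some_chart[OF M xM]
  have d: "(fst c \<inter> V, snd c) \<in> charts_at (open_submanifold M V) x"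
    using c x by (auto simp: charts_at_def open_submanifold_def)
  have "vf_restrict M V X x (fst c \<inter> V, snd c) = FD (coord_rep ?s c (\<lambda>x. x)) (snd ?s x) (X x ?s)"
    using d by (simp add: vf_restrict_def tmap_def coord_rep_def)
  also have "\<dots> = X x c" using tangent_spaceD[OF vector_field_tangent[OF X xM] s c'] by simp
  finally show ?thesis .
qed

lemma vector_field_vf_restrict:
  assumes M: "smooth_atlas M" and V: "openin (mtop M) V" and X: "vector_field M X"
  shows "vector_field (open_submanifold M V) (vf_restrict M V X)"
  unfolding vector_field_def
proof (intro conjI ballI)
  let ?U = "open_submanifold M V" and ?r = "\<lambda>c. (fst c \<inter> V, snd c)"
  have atlas: "atlas ?U = ?r ` atlas M" by (simp add: open_submanifold_def)
  fix x assume "x \<in> carr ?U"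
  then have x: "x \<in> carr M" "x \<in> V" by (auto simp: carr_open_submanifold)
  show "vf_restrict M V X x \<in> tangent_space ?U x"
    unfolding tangent_space_def
  proof (intro CollectI conjI ballI allI impI)
    fix d d' assume "d \<in> charts_at ?U x" "d' \<in> charts_at ?U x"
    then obtain c c' where c: "c \<in> atlas M" "d = ?r c" "x \<in> fst c \<inter> V" and c': "c' \<in> atlas M" "d' = ?r c'" "x \<in> fst c' \<inter> V"
      by (auto simp: charts_at_def atlas)
    have cx: "c \<in> charts_at M x" "c' \<in> charts_at M x" using c c' by (auto simp: charts_at_def)
    have "(snd d' \<circ> chart_inv d has_derivative FD (coord_rep c c' (\<lambda>x. x)) (snd c x)) (at (snd c x))"
      by (rule has_derivative_transform_within_open[OF coord_rep_has_derivative[OF M M smooth_map_id[OF M] cx]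
            open_chart_image[OF M c(1) V]])
        (use c c' chart_inv_restrict[OF M c(1), of _ V] in \<open>auto simp: coord_rep_def\<close>)
    then have "FD (snd d' \<circ> chart_inv d) (snd d x) = FD (coord_rep c c' (\<lambda>x. x)) (snd c x)"
      by (simp add: c(2) frechet_derivative_eq)
    then show "vf_restrict M V X x d' = FD (snd d' \<circ> chart_inv d) (snd d x) (vf_restrict M V X x d)"
      using vf_restrict_chart[OF M X c(1,3)] vf_restrict_chart[OF M X c'(1,3)]
        tangent_spaceD[OF vector_field_tangent[OF X x(1)] cx] by (simp add: c(2) c'(2))
  next
    fix d assume "d \<notin> charts_at ?U x"
    then show "vf_restrict M V X x d = 0" by (simp add: vf_restrict_def tmap_def)
  qed
next
  let ?U = "open_submanifold M V" and ?r = "\<lambda>c. (fst c \<inter> V, snd c)"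
  fix d assume "d \<in> atlas ?U"
  then obtain c where c: "c \<in> atlas M" and d: "d = ?r c" by (auto simp: open_submanifold_def)
  have "smooth_on (snd c ` fst c) (\<lambda>y. X (chart_inv c y) c)" using X c by (simp add: vector_field_def)
  then have sm: "smooth_on (snd c ` (fst c \<inter> V)) (\<lambda>y. X (chart_inv c y) c)" by (rule smooth_on_subset) auto
  have "smooth_on (snd c ` (fst c \<inter> V)) (\<lambda>y. vf_restrict M V X (chart_inv d y) d)"
  proof (rule smooth_on_cong[OF open_chart_image[OF M c V] _ sm])
    fix y assume y: "y \<in> snd c ` (fst c \<inter> V)"
    then obtain x where x: "x \<in> fst c \<inter> V" "y = snd c x" by blast
    have "chart_inv c y = x" using chart_inv_chart[OF M] c x by (simp add: charts_at_def)
    then show "X (chart_inv c y) c = vf_restrict M V X (chart_inv d y) d"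
      using chart_inv_restrict[OF M c y] vf_restrict_chart[OF M X c x(1)] by (simp add: d)
  qed
  then show "smooth_on (snd d ` fst d) (\<lambda>y. vf_restrict M V X (chart_inv d y) d)" by (simp add: d)
qed

theorem theorem3p18:
  fixes M :: "('m, 'e::real_normed_vector) manifold"
    and N :: "('m, 'f::real_normed_vector) manifold"
    and \<Delta> :: "'m \<Rightarrow> ('m, 'e) tvec"
    and V :: "'m set"
    and U :: "('m, 'e) manifold"
    and X :: "'m \<Rightarrow> ('m, 'e) tvec"
    and k :: nat
  assumes "smooth_manifold M"
    and "vector_field M \<Delta>"
    and "submanifold N M" and "closedin (mtop M) (carr N)" and "codimension_one N M"
    and "transversal M \<Delta> N"
    and "openin (mtop M) V" and "carr N \<subseteq> V"
    and U: "U = open_submanifold M V" and X: "X = vf_restrict M V \<Delta>"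
    and "diffeo_equivalent_line U N X"
  shows "bij_betw (Psi U X (carr N) (int k))
           {\<alpha> \<in> Omega U (int k). homogeneous U X 1 \<alpha>}
           {p \<in> jsections U (int k). basic U X p}
    \<and> bij_betw (Psi_N U X N)
           {\<alpha> \<in> Omega U (int k). homogeneous U X 1 \<alpha>}
           (jsections N (int k))
    \<and> (\<forall>\<alpha> \<in> Omega U (int k). homogeneous U X 1 \<alpha> \<longrightarrow>
         Psi U X (carr N) (int k + 1) (ext_deriv U \<alpha>) = jacobi_deriv U (Psi U X (carr N) (int k) \<alpha>)
       \<and> Psi_N U X N (ext_deriv U \<alpha>) = jacobi_deriv N (Psi_N U X N \<alpha>))"
proof -
  have M: "smooth_atlas M" by (rule smooth_manifold_imp_smooth_atlas[OF assms(1)])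
  obtain F G where F: "smooth_map U (times_line N) F" and G: "smooth_map (times_line N) U G"
    and GF: "\<forall>x\<in>carr U. G (F x) = x" and FG: "\<forall>y\<in>carr (times_line N). F (G y) = y"
    and FX: "\<forall>x\<in>carr U. tmap U (times_line N) F x (X x) = d_ds N (F x)" and F0: "\<forall>x\<in>carr N. F x = (x, 0)"
    using assms(11) unfolding diffeo_equivalent_line_def diffeomorphism_def by blast
  interpret straightened_field U N X F G
  proof
    show "smooth_atlas U" unfolding U by (rule smooth_atlas_open_submanifold[OF M assms(7)])
    show "smooth_atlas N" using assms(3) smooth_manifold_imp_smooth_atlas by (auto simp: submanifold_def)
    show "vector_field U X" unfolding U X by (rule vector_field_vf_restrict[OF M assms(7,2)])
    show "carr N \<subseteq> carr U" using assms(3,8) by (auto simp: U carr_open_submanifold submanifold_def)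
  qed (use F G GF FG FX F0 in auto)
  show ?thesis using bij_betw_Psi bij_betw_Psi_N Psi_ext_deriv Psi_N_ext_deriv by blast
qed

end
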